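(* Let $(M,g,J,\Psi)$ be an almost Calabi-Yau with torsion (ACYT) 6-manifold whose Nijenhuis tensor $N$ has constant norm and whose Lee form $\theta$ is parallel with respect to the torsion connection $\nabla$, i.e. $\nabla\theta=0$. Then the torsion connection $\nabla$ is an $SU(3)$-instanton if and only if its torsion 3-form $T$ is $\nabla$-parallel, $\nabla T=0$.
   Context: Setting. $M$ is a smooth 6-manifold, $g$ a Riemannian metric, $J$ an almost complex structure with $g(JX,JY)=g(X,Y)$. The Kähler form is $F(X,Y)=g(X,JY)$. The Nijenhuis tensor is $N(X,Y)=[JX,JY]-[X,Y]-J[JX,Y]-J[X,JY]$, and also $N(X,Y,Z)=g(N(X,Y),Z)$. The codifferential is $\delta=-*d*$, and the Lee form is $\theta(X)=(\delta F)(JX)$. $SU(3)$-structure. $\Psi=\Psi^++\sqrt{-1}\,\Psi^-$ is a complex 3-form of type $(3,0)$ with respect to $J$ such that near each point there is a local orthonormal coframe $e_1,\dots,e_6$ with $F=-e_{12}-e_{34}-e_{56}$ and $\Psi=-(e_1+\sqrt{-1}e_2)\wedge(e_3+\sqrt{-1}e_4)\wedge(e_5+\sqrt{-1}e_6)$ (here $e_{ij}=e_i\wedge e_j$). ACYT. $(M,g,J,\Psi)$ is ACYT if there is a linear connection $\nabla$ with $\nabla g=\nabla J=\nabla\Psi^+=\nabla\Psi^-=0$ whose torsion $T(X,Y)=\nabla_XY-\nabla_YX-[X,Y]$ is totally skew-symmetric, i.e. $T(X,Y,Z)=g(T(X,Y),Z)$ is a 3-form. Such a $\nabla$ is unique and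 is called the torsion connection; $T$ is called the torsion. (In this case $N(X,Y,Z)$ is a 3-form.) Instanton. With $R(X,Y)Z=[\nabla_X,\nabla_Y]Z-\nabla_{[X,Y]}Z$ and $R(X,Y,Z,V)=g(R(X,Y)Z,V)$, the connection $\nabla$ (or its curvature) is an $SU(3)$-instanton if the curvature 2-form lies in $\mathfrak{su}(3)$ in its first two arguments: $R(JX,JY,Z,V)=R(X,Y,Z,V)$ and $\sum_{i=1}^6R(e_i,Je_i,Z,V)=0$ for all $X,Y,Z,V$ and any orthonormal basis $\{e_i\}$. *)

theory Defs
  imports "HOL-Analysis.Analysis" "HOL-Library.Function_Algebras"
begin

section \<open>Smooth 6-manifolds\<close>

primrec Ck_on :: "nat \<Rightarrow> 'e::real_normed_vector set \<Rightarrow> ('e \<Rightarrow> 'f::real_normed_vector) \<Rightarrow> bool" where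
  "Ck_on 0 S f \<longleftrightarrow> continuous_on S f"
| "Ck_on (Suc k) S f \<longleftrightarrow>
     (\<forall>x\<in>S. f differentiable (at x)) \<and> (\<forall>v. Ck_on k S (\<lambda>x. frechet_derivative f (at x) v))"

text \<open>Only used for open sets \<open>S\<close> of a Euclidean space.\<close>

definition smooth_on :: "'e::real_normed_vector set \<Rightarrow> ('e \<Rightarrow> 'f::real_normed_vector) \<Rightarrow> bool" where
  "smooth_on S f \<longleftrightarrow> (\<forall>k. Ck_on k S f)"

type_synonym 'a chart = "'a set \<times> ('a \<Rightarrow> real ^ 6)"

text \<open>
  The manifold is the whole (Hausdorff, second countable) type \<open>'a\<close>; an atlas need not be maximal.
\<close>

definition smooth_manifold6 ::
    "('a::{t2_space, second_countable_topology}) chart set \<Rightarrow> bool" where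
  "smooth_manifold6 A \<longleftrightarrow>
     (\<Union>(U, \<phi>)\<in>A. U) = UNIV \<and>
     (\<forall>(U, \<phi>)\<in>A. open U \<and> open (\<phi> ` U) \<and> homeomorphism U (\<phi> ` U) \<phi> (inv_into U \<phi>)) \<and>
     (\<forall>(U, \<phi>)\<in>A. \<forall>(V, \<psi>)\<in>A. smooth_on (\<phi> ` (U \<inter> V)) (\<psi> \<circ> inv_into U \<phi>))"

definition smooth_fun_on :: "'a chart set \<Rightarrow> 'a set \<Rightarrow> ('a \<Rightarrow> real) \<Rightarrow> bool" where
  "smooth_fun_on A W f \<longleftrightarrow> (\<forall>(U, \<phi>)\<in>A. smooth_on (\<phi> ` (U \<inter> W)) (f \<circ> inv_into U \<phi>))"

abbreviation smooth_fun :: "'a chart set \<Rightarrow> ('a \<Rightarrow> real) \<Rightarrow> bool" where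
  "smooth_fun A \<equiv> smooth_fun_on A UNIV"


section \<open>Vector fields and tensor fields\<close>

text \<open>
  A vector field is a derivation of the algebra of smooth functions; it is set to \<open>0\<close> on
  non-smooth functions, so that equality of vector fields is equality of HOL functions.
  \<open>X f p\<close> is the derivative of \<open>f\<close> at \<open>p\<close> in the direction \<open>X\<^sub>p\<close>. Sums, differences and products
  of functions are the pointwise ones.
\<close>

type_synonym 'a vfield = "('a \<Rightarrow> real) \<Rightarrow> 'a \<Rightarrow> real"

definition vfields :: "'a chart set \<Rightarrow> 'a vfield set" where
  "vfields A = {X.
     (\<forall>f. smooth_fun A f \<longrightarrow> smooth_fun A (X f)) \<and>
     (\<forall>f. \<not> smooth_fun A f \<longrightarrow> X f = 0) \<and>
     (\<forall>f h. smooth_fun A f \<longrightarrow> smooth_fun A h \<longrightarrow> X (f + h) = X f + X h) \<and>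
     (\<forall>c f. smooth_fun A f \<longrightarrow> X ((\<lambda>p. c) * f) = (\<lambda>p. c) * X f) \<and>
     (\<forall>f h. smooth_fun A f \<longrightarrow> smooth_fun A h \<longrightarrow> X (f * h) = X f * h + f * X h)}"

definition fscale :: "('a \<Rightarrow> real) \<Rightarrow> 'a vfield \<Rightarrow> 'a vfield"  (infixr "\<cdot>\<^sub>v" 75) where
  "f \<cdot>\<^sub>v X = (\<lambda>h. f * X h)"

definition lie_bracket :: "'a vfield \<Rightarrow> 'a vfield \<Rightarrow> 'a vfield" where
  "lie_bracket X Y = (\<lambda>f. X (Y f) - Y (X f))"

text \<open>
  Covariant tensor fields of rank \<open>k\<close> are function-linear maps on lists of \<open>k\<close> vector fields,
  so that \<open>\<alpha> [X, Y] p\<close> stands for \<open>\<alpha>\<^sub>p(X\<^sub>p, Y\<^sub>p)\<close>. A tensor field that is defined only on an open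
  set \<open>W\<close> is given by its values, over \<open>W\<close>, on (restrictions of) global vector fields.
\<close>

type_synonym ('a, 'b) ctensor = "'a vfield list \<Rightarrow> 'a \<Rightarrow> 'b"

definition tensor_on :: "'a chart set \<Rightarrow> 'a set \<Rightarrow> nat \<Rightarrow> ('a, real) ctensor \<Rightarrow> bool" where
  "tensor_on A W k \<alpha> \<longleftrightarrow>
     (\<forall>ws. length ws = k \<longrightarrow> set ws \<subseteq> vfields A \<longrightarrow>
        smooth_fun_on A W (\<alpha> ws) \<and>
        (\<forall>i<k. \<forall>p\<in>W. \<forall>X\<in>vfields A. \<forall>Y\<in>vfields A. \<forall>f. smooth_fun A f \<longrightarrow>
           \<alpha> (ws[i := X + Y]) p = \<alpha> (ws[i := X]) p + \<alpha> (ws[i := Y]) p \<and>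
           \<alpha> (ws[i := f \<cdot>\<^sub>v X]) p = f p * \<alpha> (ws[i := X]) p))"

definition k_form :: "'a chart set \<Rightarrow> nat \<Rightarrow> ('a, real) ctensor \<Rightarrow> bool" where
  "k_form A k \<alpha> \<longleftrightarrow> tensor_on A UNIV k \<alpha> \<and>
     (\<forall>ws i j. length ws = k \<longrightarrow> set ws \<subseteq> vfields A \<longrightarrow> i < k \<longrightarrow> j < k \<longrightarrow> i \<noteq> j \<longrightarrow>
        \<alpha> (ws[i := ws ! j, j := ws ! i]) = - \<alpha> ws)"

text \<open>
  \<open>(\<alpha>\<^sub>1 \<and> \<dots> \<and> \<alpha>\<^sub>k)(X\<^sub>1, \<dots>, X\<^sub>k) = det (\<alpha>\<^sub>i(X\<^sub>j))\<close> for 1-forms, without a factor \<open>1/k!\<close>.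
\<close>

definition wedge :: "('a, 'b::comm_ring_1) ctensor list \<Rightarrow> ('a, 'b) ctensor" where
  "wedge \<alpha>s ws p = (\<Sum>\<pi> | \<pi> permutes {..<length \<alpha>s}.
     of_int (sign \<pi>) * (\<Prod>i<length \<alpha>s. (\<alpha>s ! i) [ws ! \<pi> i] p))"

text \<open>Invariant formula for the exterior derivative; the degree is read off from the list.\<close>

definition ext_d :: "('a, real) ctensor \<Rightarrow> ('a, real) ctensor" where
  "ext_d \<alpha> ws p =
     (\<Sum>i<length ws. (-1) ^ i * (ws ! i) (\<alpha> (nths ws (- {i}))) p) +
     (\<Sum>j<length ws. \<Sum>i<j. (-1) ^ (i + j) *
        \<alpha> (lie_bracket (ws ! i) (ws ! j) # nths ws (- {i, j})) p)"


section \<open>Almost Hermitian structures\<close>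

definition riemannian_metric :: "'a chart set \<Rightarrow> ('a, real) ctensor \<Rightarrow> bool" where
  "riemannian_metric A g \<longleftrightarrow> tensor_on A UNIV 2 g \<and>
     (\<forall>X\<in>vfields A. \<forall>Y\<in>vfields A. g [X, Y] = g [Y, X]) \<and>
     (\<forall>X\<in>vfields A. \<forall>p. (\<exists>f. X f p \<noteq> 0) \<longrightarrow> g [X, X] p > 0)"

definition almost_complex :: "'a chart set \<Rightarrow> ('a vfield \<Rightarrow> 'a vfield) \<Rightarrow> bool" where
  "almost_complex A J \<longleftrightarrow>
     (\<forall>X\<in>vfields A. J X \<in> vfields A \<and> J (J X) = - X) \<and>
     (\<forall>X\<in>vfields A. \<forall>Y\<in>vfields A. J (X + Y) = J X + J Y) \<and>
     (\<forall>f. \<forall>X\<in>vfields A. smooth_fun A f \<longrightarrow> J (f \<cdot>\<^sub>v X) = f \<cdot>\<^sub>v J X)"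

definition almost_hermitian ::
    "'a chart set \<Rightarrow> ('a, real) ctensor \<Rightarrow> ('a vfield \<Rightarrow> 'a vfield) \<Rightarrow> bool" where
  "almost_hermitian A g J \<longleftrightarrow> riemannian_metric A g \<and> almost_complex A J \<and>
     (\<forall>X\<in>vfields A. \<forall>Y\<in>vfields A. g [J X, J Y] = g [X, Y])"

definition kaehler_form ::
    "('a, real) ctensor \<Rightarrow> ('a vfield \<Rightarrow> 'a vfield) \<Rightarrow> ('a, real) ctensor" where
  "kaehler_form g J ws = g [ws ! 0, J (ws ! 1)]"

definition nijenhuis :: "('a vfield \<Rightarrow> 'a vfield) \<Rightarrow> 'a vfield \<Rightarrow> 'a vfield \<Rightarrow> 'a vfield" where
  "nijenhuis J X Y = lie_bracket (J X) (J Y) - lie_bracket X Y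
     - J (lie_bracket (J X) Y) - J (lie_bracket X (J Y))"

definition nijenhuis_tensor ::
    "('a, real) ctensor \<Rightarrow> ('a vfield \<Rightarrow> 'a vfield) \<Rightarrow> ('a, real) ctensor" where
  "nijenhuis_tensor g J ws = g [nijenhuis J (ws ! 0) (ws ! 1), ws ! 2]"

text \<open>
  Vector fields \<open>E\<^sub>1, \<dots>, E\<^sub>6\<close> whose values at the single point \<open>p\<close> are an orthonormal basis
  of the tangent space at \<open>p\<close>. (Every tangent vector is the value of a global vector field.)
\<close>

definition orthonormal_at ::
    "'a chart set \<Rightarrow> ('a, real) ctensor \<Rightarrow> 'a \<Rightarrow> (nat \<Rightarrow> 'a vfield) \<Rightarrow> bool" where
  "orthonormal_at A g p E \<longleftrightarrow>
     (\<forall>i\<in>{1..6}. E i \<in> vfields A) \<and>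
     (\<forall>i\<in>{1..6}. \<forall>j\<in>{1..6}. g [E i, E j] p = (if i = j then 1 else 0))"

definition nijenhuis_constant_norm ::
    "'a chart set \<Rightarrow> ('a, real) ctensor \<Rightarrow> ('a vfield \<Rightarrow> 'a vfield) \<Rightarrow> bool" where
  "nijenhuis_constant_norm A g J \<longleftrightarrow>
     (\<exists>c. \<forall>p E. orthonormal_at A g p E \<longrightarrow>
        sqrt (\<Sum>i=1..6. \<Sum>j=1..6. \<Sum>k=1..6. (nijenhuis_tensor g J [E i, E j, E k] p)\<^sup>2) = c)"

text \<open>
  Hodge star for the orientation induced by \<open>J\<close>, for which the orthonormal bases
  \<open>E\<^sub>1, J E\<^sub>1, E\<^sub>3, J E\<^sub>3, E\<^sub>5, J E\<^sub>5\<close> are positive: for a \<open>k\<close>-form \<open>\<alpha>\<close>,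
  \<open>(*\<alpha>)(w) = 1/k! \<Sum> \<alpha>(E\<^sub>i\<^sub>1, \<dots>, E\<^sub>i\<^sub>k) vol(E\<^sub>i\<^sub>1, \<dots>, E\<^sub>i\<^sub>k, w)\<close>, with \<open>k = 6 - length w\<close>. The value
  does not depend on the basis chosen. The codifferential does not depend on the orientation.
\<close>

definition positive_basis_at :: "'a chart set \<Rightarrow> ('a, real) ctensor \<Rightarrow> ('a vfield \<Rightarrow> 'a vfield) \<Rightarrow>
    'a \<Rightarrow> (nat \<Rightarrow> 'a vfield) \<Rightarrow> bool" where
  "positive_basis_at A g J p E \<longleftrightarrow> orthonormal_at A g p E \<and>
     (\<forall>i\<in>{1, 3, 5}. E (i + 1) = J (E i))"

definition hodge :: "'a chart set \<Rightarrow> ('a, real) ctensor \<Rightarrow> ('a vfield \<Rightarrow> 'a vfield) \<Rightarrow>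
    ('a, real) ctensor \<Rightarrow> ('a, real) ctensor" where
  "hodge A g J \<alpha> ws p =
     (let E = (SOME E. positive_basis_at A g J p E);
          vol = wedge (map (\<lambda>i w. g (E i # w)) [1..<7]);
          k = 6 - length ws
      in (1 / fact k) * (\<Sum>is | length is = k \<and> set is \<subseteq> {1..6}.
            \<alpha> (map E is) p * vol (map E is @ ws) p))"

definition codiff :: "'a chart set \<Rightarrow> ('a, real) ctensor \<Rightarrow> ('a vfield \<Rightarrow> 'a vfield) \<Rightarrow>
    ('a, real) ctensor \<Rightarrow> ('a, real) ctensor" where
  "codiff A g J \<alpha> = - hodge A g J (ext_d (hodge A g J \<alpha>))"

definition lee_form :: "'a chart set \<Rightarrow> ('a, real) ctensor \<Rightarrow> ('a vfield \<Rightarrow> 'a vfield) \<Rightarrow>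
    ('a, real) ctensor" where
  "lee_form A g J ws = codiff A g J (kaehler_form g J) [J (ws ! 0)]"


section \<open>SU(3)-structures\<close>

text \<open>
  The coframe is orthonormal on \<open>W\<close>: \<open>g = e\<^sub>1 \<otimes> e\<^sub>1 + \<dots> + e\<^sub>6 \<otimes> e\<^sub>6\<close> there.
\<close>

definition orthonormal_coframe_on ::
    "'a chart set \<Rightarrow> ('a, real) ctensor \<Rightarrow> 'a set \<Rightarrow> (nat \<Rightarrow> ('a, real) ctensor) \<Rightarrow> bool" where
  "orthonormal_coframe_on A g W e \<longleftrightarrow>
     (\<forall>i\<in>{1..6}. tensor_on A W 1 (e i)) \<and>
     (\<forall>p\<in>W. \<forall>X\<in>vfields A. \<forall>Y\<in>vfields A. g [X, Y] p = (\<Sum>i=1..6. e i [X] p * e i [Y] p))"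

text \<open>
  Type (3,0): the complex multilinear extension of \<open>\<Psi>\<close> vanishes on the vectors
  \<open>X + \<i> J X\<close> of type (0,1).
\<close>

definition su3_structure :: "'a chart set \<Rightarrow> ('a, real) ctensor \<Rightarrow> ('a vfield \<Rightarrow> 'a vfield) \<Rightarrow>
    ('a::topological_space, complex) ctensor \<Rightarrow> bool" where
  "su3_structure A g J \<Psi> \<longleftrightarrow>
     k_form A 3 (\<lambda>ws p. Re (\<Psi> ws p)) \<and> k_form A 3 (\<lambda>ws p. Im (\<Psi> ws p)) \<and>
     (\<forall>X\<in>vfields A. \<forall>Y\<in>vfields A. \<forall>Z\<in>vfields A. \<forall>p.
        \<Psi> [X, Y, Z] p + \<i> * \<Psi> [J X, Y, Z] p = 0) \<and>
     (\<forall>x. \<exists>W e. open W \<and> x \<in> W \<and> orthonormal_coframe_on A g W e \<and>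
        (\<forall>p\<in>W. \<forall>X\<in>vfields A. \<forall>Y\<in>vfields A. \<forall>Z\<in>vfields A.
           kaehler_form g J [X, Y] p =
             - wedge [e 1, e 2] [X, Y] p - wedge [e 3, e 4] [X, Y] p - wedge [e 5, e 6] [X, Y] p \<and>
           \<Psi> [X, Y, Z] p =
             - wedge [\<lambda>w q. Complex (e 1 w q) (e 2 w q),
                      \<lambda>w q. Complex (e 3 w q) (e 4 w q),
                      \<lambda>w q. Complex (e 5 w q) (e 6 w q)] [X, Y, Z] p))"


section \<open>Connections with skew-symmetric torsion\<close>

type_synonym 'a connection = "'a vfield \<Rightarrow> 'a vfield \<Rightarrow> 'a vfield"

definition linear_connection :: "'a chart set \<Rightarrow> 'a connection \<Rightarrow> bool" where
  "linear_connection A D \<longleftrightarrow>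
     (\<forall>X\<in>vfields A. \<forall>Y\<in>vfields A. D X Y \<in> vfields A) \<and>
     (\<forall>X\<in>vfields A. \<forall>Y\<in>vfields A. \<forall>Z\<in>vfields A. \<forall>f. smooth_fun A f \<longrightarrow>
        D (X + Y) Z = D X Z + D Y Z \<and> D (f \<cdot>\<^sub>v X) Z = f \<cdot>\<^sub>v D X Z \<and>
        D X (Y + Z) = D X Y + D X Z \<and> D X (f \<cdot>\<^sub>v Y) = X f \<cdot>\<^sub>v Y + f \<cdot>\<^sub>v D X Y)"

definition cov_deriv ::
    "'a connection \<Rightarrow> 'a vfield \<Rightarrow> ('a, real) ctensor \<Rightarrow> ('a, real) ctensor" where
  "cov_deriv D X \<alpha> ws = X (\<alpha> ws) - (\<Sum>i<length ws. \<alpha> (ws[i := D X (ws ! i)]))"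

definition parallel ::
    "'a chart set \<Rightarrow> 'a connection \<Rightarrow> nat \<Rightarrow> ('a, real) ctensor \<Rightarrow> bool" where
  "parallel A D k \<alpha> \<longleftrightarrow>
     (\<forall>X\<in>vfields A. \<forall>ws. length ws = k \<longrightarrow> set ws \<subseteq> vfields A \<longrightarrow> cov_deriv D X \<alpha> ws = 0)"

definition torsion :: "('a, real) ctensor \<Rightarrow> 'a connection \<Rightarrow> ('a, real) ctensor" where
  "torsion g D ws =
     g [D (ws ! 0) (ws ! 1) - D (ws ! 1) (ws ! 0) - lie_bracket (ws ! 0) (ws ! 1), ws ! 2]"

definition torsion_connection :: "'a chart set \<Rightarrow> ('a, real) ctensor \<Rightarrow> ('a vfield \<Rightarrow> 'a vfield) \<Rightarrow>
    ('a, complex) ctensor \<Rightarrow> 'a connection \<Rightarrow> bool" where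
  "torsion_connection A g J \<Psi> D \<longleftrightarrow> linear_connection A D \<and>
     parallel A D 2 g \<and>
     (\<forall>X\<in>vfields A. \<forall>Y\<in>vfields A. D X (J Y) - J (D X Y) = 0) \<and>
     parallel A D 3 (\<lambda>ws p. Re (\<Psi> ws p)) \<and>
     parallel A D 3 (\<lambda>ws p. Im (\<Psi> ws p)) \<and>
     k_form A 3 (torsion g D)"

definition ACYT :: "('a::{t2_space, second_countable_topology}) chart set \<Rightarrow> ('a, real) ctensor \<Rightarrow>
    ('a vfield \<Rightarrow> 'a vfield) \<Rightarrow> ('a, complex) ctensor \<Rightarrow> bool" where
  "ACYT A g J \<Psi> \<longleftrightarrow> smooth_manifold6 A \<and> almost_hermitian A g J \<and> su3_structure A g J \<Psi> \<and>
     (\<exists>D. torsion_connection A g J \<Psi> D)"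

definition curvature :: "('a, real) ctensor \<Rightarrow> 'a connection \<Rightarrow> ('a, real) ctensor" where
  "curvature g D ws = (let X = ws ! 0; Y = ws ! 1; Z = ws ! 2; V = ws ! 3 in
     g [D X (D Y Z) - D Y (D X Z) - D (lie_bracket X Y) Z, V])"

definition su3_instanton :: "'a chart set \<Rightarrow> ('a, real) ctensor \<Rightarrow> ('a vfield \<Rightarrow> 'a vfield) \<Rightarrow>
    'a connection \<Rightarrow> bool" where
  "su3_instanton A g J D \<longleftrightarrow>
     (\<forall>Z\<in>vfields A. \<forall>V\<in>vfields A.
        (\<forall>X\<in>vfields A. \<forall>Y\<in>vfields A.
           curvature g D [J X, J Y, Z, V] = curvature g D [X, Y, Z, V]) \<and>
        (\<forall>p E. orthonormal_at A g p E \<longrightarrow>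
           (\<Sum>i=1..6. curvature g D [E i, J (E i), Z, V] p) = 0))"

end

theory Submission
  imports
    Defs
    "HOL-Real_Asymp.Real_Asymp"
    "HOL-Combinatorics.Multiset_Permutations"
    "Jordan_Normal_Form.Determinant"
begin

text \<open>
  Write \<open>B = \<nabla>T\<close>, \<open>C = \<nabla>\<nabla>T\<close> and \<open>R\<close> for the first and second covariant derivatives of the torsion and for
  the curvature. Since \<open>\<nabla>\<close> preserves the metric, \<open>J\<close> and \<open>\<Psi>\<close>, the curvature is \<open>su(3)\<close>-valued in its last two
  arguments (\<open>R_skew34\<close>, \<open>R_J34\<close>, \<open>R_trace34\<close>). Both directions start from the first Bianchi identity for skew
  torsion (\<open>bianchi\<close>): the cyclic sum of \<open>R(X,Y,Z,V)\<close> over \<open>X, Y, Z\<close> is the cyclic sum of \<open>B(X;Y,Z,V)\<close> plus a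
  4-form that is quadratic in \<open>T\<close>. Exchanging \<open>Z\<close> and \<open>V\<close> and adding removes the 4-form. What remains (\<open>star\<close>)
  determines \<open>B\<close> linearly from \<open>R\<close>, up to the totally skew part of \<open>B\<close> (\<open>four_B\<close>).

  If \<open>\<nabla>T = 0\<close>, these linear formulas say that \<open>R\<close> is symmetric under exchange of its two pairs of arguments
  (\<open>pair_difference\<close>), so the first pair inherits the \<open>su(3)\<close>-conditions of the second one.

  Conversely, let \<open>\<nabla>\<close> be an instanton with parallel Lee form. The codifferential of the Kaehler form at \<open>w\<close> is
  \<open>- 1/2 \<Sum> T(w, e\<^sub>i, J e\<^sub>i)\<close> (\<open>codifferential_kaehler\<close>), so a parallel Lee form means that the trace of \<open>B\<close> against
  \<open>J\<close> vanishes. Tracing the formula for \<open>B\<close> in terms of \<open>R\<close> then gives two facts, because one part is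
  skew and the other symmetric: the totally skew part of \<open>B\<close> is trace-free, hence zero in dimension six
  (\<open>al_basis_vanishes\<close>), and the Ricci contraction is symmetric. So \<open>B\<close> is a linear expression in \<open>R\<close> and inherits
  from the instanton condition that it is of type \<open>(2,2)\<close> as a tensor with four arguments (\<open>B_type\<close>).
  Pairing \<open>B\<close> with \<open>T\<close> in two different ways gives two covectors \<open>w\<close> and \<open>w'\<close>. Type considerations give
  \<open>w + w' = 0\<close> (\<open>w_plus_w'\<close>), and the Ricci identity for \<open>C\<close> together with the Bianchi identity contracted with
  \<open>T\<close> gives \<open>w = w'\<close> (\<open>w_eq_w'\<close>). Hence \<open>w = 0\<close>, which says that \<open>T\<close> has constant norm.
  A Bochner argument finishes the proof: by its type, the rough Laplacian of \<open>T\<close> is a trace of \<open>C\<close> against \<open>J\<close>,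
  which the Ricci identity and the instanton condition reduce to a single derivative of \<open>T\<close>, orthogonal to \<open>T\<close>
  (\<open>rough_laplacian\<close>); differentiating \<open>\<langle>\<nabla>T, T\<rangle> = 0\<close> once more yields \<open>\<bar>\<nabla>T\<bar>\<^sup>2 = 0\<close> (\<open>B_vanishes\<close>).

  Vector fields are global derivations and tensors are function-linear maps, so components have to be justified:
  every point has a neighbourhood with a unitary frame of global vector fields (\<open>unitary_frame_exists\<close>, by bump
  functions, coordinate fields and Cramer's rule), and a function-linear map is determined at a point by its
  values on such a frame (\<open>covector_expand\<close>). The algebra at a point is carried out in abstract locales, in which
  \<open>T\<close>, \<open>B\<close>, \<open>R\<close> and \<open>C\<close> are functions on a bare type of vectors.
\<close>

(* Both notations are needed below for other operations: function multiples of vector fields and components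
   of vectors over finite types. *)
no_notation Matrix.smult_vec (infixl "\<cdot>\<^sub>v" 70)
no_notation Matrix.vec_index (infixl "$" 100)
hide_const (open) Determinant.det Matrix.mat

section \<open>Smooth functions on open subsets of a Euclidean space\<close>

lemma Ck_on_subset: "Ck_on k S f \<Longrightarrow> T \<subseteq> S \<Longrightarrow> Ck_on k T f"
  by (induction k arbitrary: f) (auto intro: continuous_on_subset)

lemma Ck_on_cong:
  assumes "open S" "\<And>x. x \<in> S \<Longrightarrow> f x = g x" "Ck_on k S f"
  shows "Ck_on k S g"
  using assms
proof (induction k arbitrary: f g)
  case 0
  then show ?case by (metis Ck_on.simps(1) continuous_on_cong)
next
  case (Suc k)
  have d: "g differentiable (at x)" if "x \<in> S" for x
    using Suc.prems that unfolding differentiable_def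
    by (metis Ck_on.simps(2) differentiable_def has_derivative_transform_within_open)
  have e: "frechet_derivative f (at x) = frechet_derivative g (at x)" if "x \<in> S" for x
    using Suc.prems that by (intro frechet_derivative_transform_within_open[of f x S]) auto
  show ?case
    using Suc.IH[OF \<open>open S\<close>, of "\<lambda>x. frechet_derivative f (at x) v" "\<lambda>x. frechet_derivative g (at x) v" for v]
      Suc.prems(3) d e by auto
qed

lemma Ck_on_Suc_imp: "Ck_on (Suc k) S f \<Longrightarrow> Ck_on k S f"
proof (induction k arbitrary: f)
  case 0
  then show ?case
    by (auto intro!: continuous_at_imp_continuous_on differentiable_imp_continuous_within)
next
  case (Suc k)
  then show ?case by (metis Ck_on.simps(2))
qed

text \<open>Smoothness is checked on the members of an open cover; this is how functions on the manifold are glued.\<close>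

lemma Ck_on_local:
  assumes "\<And>x. x \<in> S \<Longrightarrow> \<exists>U. open U \<and> x \<in> U \<and> Ck_on k U f"
  shows "Ck_on k S f"
  using assms
proof (induction k arbitrary: f)
  case 0
  show ?case
    unfolding Ck_on.simps
  proof (rule continuous_at_imp_continuous_on, rule ballI)
    fix x assume "x \<in> S"
    then obtain U where "open U" "x \<in> U" "Ck_on 0 U f" using 0 by blast
    then show "isCont f x" by (simp add: continuous_on_eq_continuous_at)
  qed
next
  case (Suc k)
  have "f differentiable (at x)" if "x \<in> S" for x
    using Suc.prems[OF that] by auto
  moreover have "Ck_on k S (\<lambda>x. frechet_derivative f (at x) v)" for v
    using Suc.prems by (intro Suc.IH) (metis Ck_on.simps(2))
  ultimately show ?case by simp
qed

lemma Ck_on_SucI: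
  assumes "open S" "\<And>x. x \<in> S \<Longrightarrow> (f has_derivative f' x) (at x)"
    and "\<And>v. Ck_on k S (\<lambda>x. f' x v)"
  shows "Ck_on (Suc k) S f"
proof -
  have eq: "f' x = frechet_derivative f (at x)" if "x \<in> S" for x
    using assms(2)[OF that] by (rule frechet_derivative_at)
  have "Ck_on k S (\<lambda>x. frechet_derivative f (at x) v)" for v
    by (rule Ck_on_cong[OF assms(1) _ assms(3)[of v]]) (simp add: eq)
  then show ?thesis
    using assms(2) by (auto simp: differentiable_def)
qed

lemma Ck_on_Suc_deriv: "Ck_on (Suc k) S f \<Longrightarrow> x \<in> S \<Longrightarrow> (f has_derivative frechet_derivative f (at x)) (at x)"
  by (simp add: frechet_derivative_works)

lemma Ck_on_const: "Ck_on k S (\<lambda>x. c)"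
  by (induction k arbitrary: c) auto

lemma Ck_on_bounded_linear:
  assumes "bounded_linear L"
  shows "Ck_on k UNIV L"
proof (cases k)
  case 0
  then show ?thesis by (simp add: assms linear_continuous_on)
next
  case (Suc n)
  have "Ck_on (Suc n) UNIV L"
    by (rule Ck_on_SucI[of _ _ "\<lambda>x. L"]) (auto simp: Ck_on_const assms bounded_linear_imp_has_derivative)
  then show ?thesis using Suc by simp
qed

lemma Ck_on_linear_image:
  assumes "bounded_linear L" "open S" "Ck_on k S f"
  shows "Ck_on k S (\<lambda>x. L (f x))"
  using assms(3)
proof (induction k arbitrary: f)
  case 0
  then show ?case by (simp add: bounded_linear.continuous_on[OF assms(1)])
next
  case (Suc k)
  show ?case
  proof (rule Ck_on_SucI[OF assms(2), of _ "\<lambda>x v. L (frechet_derivative f (at x) v)"])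
    show "((\<lambda>x. L (f x)) has_derivative (\<lambda>v. L (frechet_derivative f (at x) v))) (at x)" if "x \<in> S" for x
      using bounded_linear.has_derivative[OF assms(1) Ck_on_Suc_deriv[OF Suc.prems that]] .
  qed (use Suc in auto)
qed

lemma Ck_on_add:
  assumes "open S" "Ck_on k S f" "Ck_on k S g"
  shows "Ck_on k S (\<lambda>x. f x + g x)"
  using assms(2,3)
proof (induction k arbitrary: f g)
  case 0
  then show ?case by (simp add: continuous_on_add)
next
  case (Suc k)
  show ?case
    by (rule Ck_on_SucI[OF assms(1), of _ "\<lambda>x v. frechet_derivative f (at x) v + frechet_derivative g (at x) v"])
      (use Suc in \<open>auto intro!: has_derivative_add Ck_on_Suc_deriv simp del: Ck_on.simps simp: Ck_on.simps(2)\<close>)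
qed

lemma Ck_on_scaleR:
  assumes "open S" "Ck_on k S f" "Ck_on k S g"
  shows "Ck_on k S (\<lambda>x. f x *\<^sub>R g x)"
  using assms(2,3)
proof (induction k arbitrary: f g)
  case 0
  then show ?case by (simp add: continuous_on_scaleR)
next
  case (Suc k)
  note f = Ck_on_Suc_imp[OF Suc.prems(1)] and g = Ck_on_Suc_imp[OF Suc.prems(2)]
  show ?case
  proof (rule Ck_on_SucI[OF assms(1), of _ "\<lambda>x v. f x *\<^sub>R frechet_derivative g (at x) v + frechet_derivative f (at x) v *\<^sub>R g x"])
    show "((\<lambda>x. f x *\<^sub>R g x) has_derivative
        (\<lambda>v. f x *\<^sub>R frechet_derivative g (at x) v + frechet_derivative f (at x) v *\<^sub>R g x)) (at x)"
      if "x \<in> S" for x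
      by (intro has_derivative_scaleR Ck_on_Suc_deriv[OF Suc.prems(1) that] Ck_on_Suc_deriv[OF Suc.prems(2) that])
    show "Ck_on k S (\<lambda>x. f x *\<^sub>R frechet_derivative g (at x) v + frechet_derivative f (at x) v *\<^sub>R g x)" for v
      using Suc f g by (intro Ck_on_add assms(1) Suc.IH) auto
  qed
qed

lemma Ck_on_mult:
  fixes f g :: "'e::real_normed_vector \<Rightarrow> real"
  shows "open S \<Longrightarrow> Ck_on k S f \<Longrightarrow> Ck_on k S g \<Longrightarrow> Ck_on k S (\<lambda>x. f x * g x)"
  using Ck_on_scaleR[of S k f g] by simp

lemma Ck_on_sum:
  "open S \<Longrightarrow> (\<And>i. i \<in> I \<Longrightarrow> Ck_on k S (f i)) \<Longrightarrow> Ck_on k S (\<lambda>x. \<Sum>i\<in>I. f i x)"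
  by (induction I rule: infinite_finite_induct) (auto intro: Ck_on_const Ck_on_add)

lemma Ck_on_inverse:
  fixes f :: "'e::real_normed_vector \<Rightarrow> real"
  assumes "open S" "Ck_on k S f" "\<And>x. x \<in> S \<Longrightarrow> f x \<noteq> 0"
  shows "Ck_on k S (\<lambda>x. inverse (f x))"
  using assms(2)
proof (induction k)
  case 0
  then show ?case using assms(3) by (auto intro: continuous_on_inverse)
next
  case (Suc k)
  note i = Suc.IH[OF Ck_on_Suc_imp[OF Suc.prems]]
  show ?case
  proof (rule Ck_on_SucI[OF assms(1), of _ "\<lambda>x v. (-1) * (inverse (f x) * frechet_derivative f (at x) v * inverse (f x))"])
    show "((\<lambda>x. inverse (f x)) has_derivative
        (\<lambda>v. (-1) * (inverse (f x) * frechet_derivative f (at x) v * inverse (f x)))) (at x)" if "x \<in> S" for x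
      using Deriv.has_derivative_inverse[OF assms(3)[OF that] Ck_on_Suc_deriv[OF Suc.prems that]] by simp
    show "Ck_on k S (\<lambda>x. (-1) * (inverse (f x) * frechet_derivative f (at x) v * inverse (f x)))" for v
      using Suc.prems i by (intro Ck_on_mult Ck_on_const assms(1)) auto
  qed
qed

text \<open>In a basis of the intermediate space, the chain rule writes a derivative of the composite as a sum of products
  of a derivative of \<open>h\<close> with a partial derivative of \<open>f\<close> composed with \<open>h\<close>; the induction hypothesis applies
  to the latter.\<close>

lemma Ck_on_compose:
  fixes f :: "'b::euclidean_space \<Rightarrow> 'c::real_normed_vector" and h :: "'e::real_normed_vector \<Rightarrow> 'b"
  assumes "open S" "open T" "h ` S \<subseteq> T" "Ck_on k T f" "Ck_on k S h"
  shows "Ck_on k S (\<lambda>x. f (h x))"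
  using assms(4,5)
proof (induction k arbitrary: f)
  case 0
  then show ?case using assms(3) by (auto intro: continuous_on_compose2)
next
  case (Suc k)
  note h = Ck_on_Suc_imp[OF Suc.prems(2)]
  let ?D = "\<lambda>x v. \<Sum>i\<in>Basis. (frechet_derivative h (at x) v \<bullet> i) *\<^sub>R frechet_derivative f (at (h x)) i"
  show ?case
  proof (rule Ck_on_SucI[OF assms(1), of _ ?D])
    fix x assume x: "x \<in> S"
    then have hx: "h x \<in> T" using assms(3) by auto
    have "((\<lambda>x. f (h x)) has_derivative (\<lambda>v. frechet_derivative f (at (h x)) (frechet_derivative h (at x) v))) (at x)"
      by (rule has_derivative_compose[OF Ck_on_Suc_deriv[OF Suc.prems(2) x] Ck_on_Suc_deriv[OF Suc.prems(1) hx]])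
    moreover have "frechet_derivative f (at (h x)) (frechet_derivative h (at x) v) = ?D x v" for v
    proof -
      have lin: "linear (frechet_derivative f (at (h x)))"
        using Suc.prems(1) hx by (intro linear_frechet_derivative) auto
      show ?thesis
        by (subst euclidean_representation[of "frechet_derivative h (at x) v", symmetric])
          (simp only: linear_sum[OF lin] linear_cmul[OF lin])
    qed
    ultimately show "((\<lambda>x. f (h x)) has_derivative ?D x) (at x)" by simp
  next
    fix v
    show "Ck_on k S (\<lambda>x. ?D x v)"
      using Suc.prems h
      by (intro Ck_on_sum Ck_on_scaleR assms(1) Suc.IH
          Ck_on_linear_image[OF bounded_linear_inner_left]) auto
  qed
qed

lemma Ck_on_real_SucI:
  fixes f :: "real \<Rightarrow> real"
  assumes "open S" "\<And>x. x \<in> S \<Longrightarrow> (f has_real_derivative f' x) (at x)" "Ck_on k S f'"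
  shows "Ck_on (Suc k) S f"
  by (rule Ck_on_SucI[OF assms(1), of _ "\<lambda>x v. f' x * v"])
    (use assms in \<open>auto simp: has_field_derivative_def mult_commute_abs intro: Ck_on_mult Ck_on_const\<close>)

text \<open>All derivatives of \<open>exp (- 1 / t)\<close> are combinations of the functions below, which are
  closed under differentiation; hence the case \<open>n = 0\<close> is a smooth function that is flat at \<open>0\<close>.\<close>

definition flat_exp :: "nat \<Rightarrow> real \<Rightarrow> real" where
  "flat_exp n t = (if t \<le> 0 then 0 else exp (- 1 / t) / t ^ n)"

text \<open>Only \<open>t = 0\<close> needs an argument: \<open>exp (- 1 / t)\<close> decays faster than every power of \<open>t\<close> as \<open>t\<close> decreases to \<open>0\<close>.\<close>

lemma flat_exp_deriv:
  "(flat_exp n has_real_derivative (flat_exp (n + 2) t - real n * flat_exp (Suc n) t)) (at t)"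
proof (cases t "0 :: real" rule: linorder_cases)
  case less
  have "((\<lambda>t. 0) has_real_derivative 0) (at t)" by simp
  then have "(flat_exp n has_real_derivative 0) (at t)"
    by (rule has_field_derivative_transform_within_open[where S = "{..<0}"])
      (use less in \<open>auto simp: flat_exp_def\<close>)
  then show ?thesis using less by (simp add: flat_exp_def)
next
  case greater
  have "((\<lambda>t. exp (- 1 / t) / t ^ n) has_real_derivative
      (exp (- 1 / t) * (1 / t\<^sup>2) * t ^ n - exp (- 1 / t) * (real n * t ^ (n - 1))) / (t ^ n * t ^ n)) (at t)"
    using greater by (auto intro!: derivative_eq_intros simp: power2_eq_square)
  also have "(exp (- 1 / t) * (1 / t\<^sup>2) * t ^ n - exp (- 1 / t) * (real n * t ^ (n - 1))) / (t ^ n * t ^ n)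
      = exp (- 1 / t) / t ^ (n + 2) - real n * (exp (- 1 / t) / t ^ Suc n)"
    using greater by (cases n) (auto simp: field_simps power_add power2_eq_square)
  finally have "((\<lambda>t. exp (- 1 / t) / t ^ n) has_real_derivative
      (exp (- 1 / t) / t ^ (n + 2) - real n * (exp (- 1 / t) / t ^ Suc n))) (at t)" .
  then have "(flat_exp n has_real_derivative
      (exp (- 1 / t) / t ^ (n + 2) - real n * (exp (- 1 / t) / t ^ Suc n))) (at t)"
    by (rule has_field_derivative_transform_within_open[where S = "{0<..}"])
      (use greater in \<open>auto simp: flat_exp_def\<close>)
  then show ?thesis using greater by (simp add: flat_exp_def)
next
  case equal
  have "((\<lambda>y. (flat_exp n y - flat_exp n 0) / (y - 0)) \<longlongrightarrow> 0) (at 0)"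
  proof (rule filterlim_split_at)
    show "((\<lambda>y. (flat_exp n y - flat_exp n 0) / (y - 0)) \<longlongrightarrow> 0) (at_left 0)"
      by (rule tendsto_eventually) (auto simp: flat_exp_def eventually_at_filter)
    have "((\<lambda>y::real. exp (- 1 / y) / y ^ Suc n) \<longlongrightarrow> 0) (at_right 0)"
      by real_asymp
    then show "((\<lambda>y. (flat_exp n y - flat_exp n 0) / (y - 0)) \<longlongrightarrow> 0) (at_right 0)"
      by (rule Lim_transform_eventually)
        (auto simp: flat_exp_def eventually_at_filter field_simps)
  qed
  then show ?thesis using equal by (simp add: has_field_derivative_iff flat_exp_def)
qed

lemma Ck_on_flat_exp: "Ck_on k UNIV (flat_exp n)"
proof (induction k arbitrary: n)
  case 0
  show ?case
    by (auto intro!: continuous_at_imp_continuous_on DERIV_isCont[OF flat_exp_deriv])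
next
  case (Suc k)
  have "Ck_on k UNIV (\<lambda>t. flat_exp (n + 2) t + (- real n) * flat_exp (Suc n) t)"
    by (intro Ck_on_add Ck_on_mult Ck_on_const Suc.IH open_UNIV)
  then show ?case
    by (intro Ck_on_real_SucI[where f' = "\<lambda>t. flat_exp (n + 2) t - real n * flat_exp (Suc n) t"] flat_exp_deriv)
      auto
qed

text \<open>A smooth step from \<open>0\<close> to \<open>1\<close>, which is constant outside the unit interval, is applied to an affine function of the
  squared distance to \<open>c\<close>. The plateau matters: frames built with this function stay orthonormal near a point.\<close>

lemma smooth_bump_exists:
  fixes c :: "'e::euclidean_space"
  assumes "r > 0"
  obtains b :: "'e \<Rightarrow> real" where "\<And>k. Ck_on k UNIV b" "\<And>x. x \<in> cball c r \<Longrightarrow> b x = 1"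
    "\<And>x. x \<notin> cball c (2 * r) \<Longrightarrow> b x = 0"
proof
  define s where "s t = flat_exp 0 t * inverse (flat_exp 0 t + flat_exp 0 (1 - t))" for t
  define b where "b x = s (2 + (- inverse (r\<^sup>2)) * ((x - c) \<bullet> (x - c)))" for x
  have pos: "flat_exp 0 t + flat_exp 0 (1 - t) \<noteq> 0" for t
    by (auto simp: flat_exp_def add_nonneg_eq_0_iff)
  have "Ck_on k UNIV (\<lambda>t::real. 1 + (-1) * t)" for k
    by (intro Ck_on_add Ck_on_mult Ck_on_const Ck_on_bounded_linear bounded_linear_ident open_UNIV)
  then have "Ck_on k UNIV (\<lambda>t. flat_exp 0 (1 - t))" for k
    by (intro Ck_on_compose[of UNIV UNIV "\<lambda>t. 1 - t" k "flat_exp 0"] Ck_on_flat_exp) auto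
  then have s: "Ck_on k UNIV s" for k
    unfolding s_def using pos by (intro Ck_on_mult Ck_on_inverse Ck_on_add Ck_on_flat_exp open_UNIV)
  have sub: "Ck_on k UNIV (\<lambda>x. x + (- c))" for k
    by (intro Ck_on_add Ck_on_const Ck_on_bounded_linear bounded_linear_ident open_UNIV)
  have inn: "Ck_on k UNIV (\<lambda>x. (x - c) \<bullet> (x - c))" for k
  proof -
    have "Ck_on k UNIV (\<lambda>x. \<Sum>i\<in>Basis. ((x + (-c)) \<bullet> i) * ((x + (-c)) \<bullet> i))"
      by (intro Ck_on_sum Ck_on_mult Ck_on_linear_image[OF bounded_linear_inner_left] sub open_UNIV)
    then show ?thesis by (simp add: euclidean_inner[of "x - c" "x - c" for x])
  qed
  show "Ck_on k UNIV b" for k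
    unfolding b_def
    by (rule Ck_on_compose[of UNIV UNIV _ k s, OF open_UNIV open_UNIV subset_UNIV s])
      (intro Ck_on_add Ck_on_mult Ck_on_const inn open_UNIV)
  show "b x = 1" if "x \<in> cball c r" for x
  proof -
    have "(norm (x - c))\<^sup>2 \<le> r\<^sup>2"
      using that by (intro power_mono) (auto simp: dist_norm norm_minus_commute)
    then have "2 + (- inverse (r\<^sup>2)) * ((x - c) \<bullet> (x - c)) \<ge> 1"
      using assms by (simp add: power2_norm_eq_inner[symmetric] field_simps)
    then show ?thesis
      unfolding b_def s_def by (simp add: flat_exp_def)
  qed
  show "b x = 0" if "x \<notin> cball c (2 * r)" for x
  proof -
    have "(2 * r)\<^sup>2 \<le> (norm (x - c))\<^sup>2"
      using that assms by (intro power_mono) (auto simp: dist_norm norm_minus_commute)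
    then have "(x - c) \<bullet> (x - c) \<ge> 2 * r\<^sup>2"
      using assms by (simp add: power2_norm_eq_inner[symmetric] power_mult_distrib)
        (smt (verit) zero_le_power2)
    then have "2 + (- inverse (r\<^sup>2)) * ((x - c) \<bullet> (x - c)) \<le> 0"
      using assms by (simp add: field_simps)
    then show ?thesis
      unfolding b_def s_def by (simp add: flat_exp_def)
  qed
qed

section \<open>Smooth functions and vector fields on a manifold\<close>

locale smooth_mfd =
  fixes A :: "('a::{t2_space, second_countable_topology}) chart set"
  assumes mfd: "smooth_manifold6 A"
begin

lemma chart_at: obtains U \<phi> where "(U, \<phi>) \<in> A" "p \<in> U"
  using mfd unfolding smooth_manifold6_def by fast

lemma
  assumes "(U, \<phi>) \<in> A"
  shows chart_open: "open U" and chart_image_open: "open (\<phi> ` U)"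
    and chart_homeo: "homeomorphism U (\<phi> ` U) \<phi> (inv_into U \<phi>)"
  using mfd assms unfolding smooth_manifold6_def by fast+

lemma chart_transition:
  "(U, \<phi>) \<in> A \<Longrightarrow> (V, \<psi>) \<in> A \<Longrightarrow> Ck_on k (\<phi> ` (U \<inter> V)) (\<lambda>x. \<psi> (inv_into U \<phi> x))"
  using mfd unfolding smooth_manifold6_def smooth_on_def by (fastforce simp: comp_def)

lemma chart_inv: "(U, \<phi>) \<in> A \<Longrightarrow> q \<in> U \<Longrightarrow> inv_into U \<phi> (\<phi> q) = q"
  using chart_homeo unfolding homeomorphism_def by blast

lemma chart_image_open_Int:
  assumes "(U, \<phi>) \<in> A" "open W"
  shows "open (\<phi> ` (U \<inter> W))"
proof -
  have "openin (top_of_set (\<phi> ` U)) (\<phi> ` (U \<inter> W))"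
    by (rule homeomorphism_imp_open_map[OF chart_homeo[OF assms(1)]]) (simp add: assms(2) openin_open_Int)
  then show ?thesis
    using chart_image_open[OF assms(1)] by (auto simp: openin_open_eq)
qed

lemma smooth_fun_on_Ck:
  "smooth_fun_on A W f \<Longrightarrow> (U, \<phi>) \<in> A \<Longrightarrow> Ck_on k (\<phi> ` (U \<inter> W)) (\<lambda>x. f (inv_into U \<phi> x))"
  unfolding smooth_fun_on_def smooth_on_def by (fastforce simp: comp_def)

lemma smooth_fun_onI:
  "(\<And>U \<phi> k. (U, \<phi>) \<in> A \<Longrightarrow> Ck_on k (\<phi> ` (U \<inter> W)) (\<lambda>x. f (inv_into U \<phi> x))) \<Longrightarrow> smooth_fun_on A W f"
  unfolding smooth_fun_on_def smooth_on_def by (auto simp: comp_def)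

lemma smooth_fun_on_subset: "smooth_fun_on A W f \<Longrightarrow> W' \<subseteq> W \<Longrightarrow> smooth_fun_on A W' f"
  by (blast intro: smooth_fun_onI Ck_on_subset smooth_fun_on_Ck)

lemma smooth_fun_on_local:
  assumes "\<And>p. p \<in> W \<Longrightarrow> \<exists>W' h. open W' \<and> p \<in> W' \<and> smooth_fun_on A W' h \<and> (\<forall>q\<in>W'. f q = h q)"
  shows "smooth_fun_on A W f"
proof (rule smooth_fun_onI, rule Ck_on_local)
  fix U \<phi> k x assume U: "(U, \<phi>) \<in> A" and x: "x \<in> \<phi> ` (U \<inter> W)"
  then obtain p where p: "p \<in> U" "p \<in> W" "x = \<phi> p" by auto
  then obtain W' h where W': "open W'" "p \<in> W'" "smooth_fun_on A W' h" "\<forall>q\<in>W'. f q = h q"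
    using assms by blast
  have "Ck_on k (\<phi> ` (U \<inter> W')) (\<lambda>x. f (inv_into U \<phi> x))"
    by (rule Ck_on_cong[OF chart_image_open_Int[OF U W'(1)] _ smooth_fun_on_Ck[OF W'(3) U]])
      (use W'(4) chart_inv[OF U] in auto)
  then show "\<exists>S. open S \<and> x \<in> S \<and> Ck_on k S (\<lambda>x. f (inv_into U \<phi> x))"
    using chart_image_open_Int[OF U W'(1)] p W'(2) by blast
qed

lemma smooth_fun_on_const [intro, simp]: "smooth_fun_on A W (\<lambda>q. c)"
  by (rule smooth_fun_onI) (rule Ck_on_const)

lemma smooth_fun_on_add:
  "open W \<Longrightarrow> smooth_fun_on A W f \<Longrightarrow> smooth_fun_on A W h \<Longrightarrow> smooth_fun_on A W (\<lambda>q. f q + h q)"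
  by (rule smooth_fun_onI, intro Ck_on_add smooth_fun_on_Ck chart_image_open_Int)

lemma smooth_fun_on_mult:
  "open W \<Longrightarrow> smooth_fun_on A W f \<Longrightarrow> smooth_fun_on A W h \<Longrightarrow> smooth_fun_on A W (\<lambda>q. f q * h q)"
  by (rule smooth_fun_onI, intro Ck_on_mult smooth_fun_on_Ck chart_image_open_Int)

lemma smooth_fun_on_inverse:
  "open W \<Longrightarrow> smooth_fun_on A W f \<Longrightarrow> (\<And>q. q \<in> W \<Longrightarrow> f q \<noteq> 0) \<Longrightarrow> smooth_fun_on A W (\<lambda>q. inverse (f q))"
  by (rule smooth_fun_onI, intro Ck_on_inverse smooth_fun_on_Ck chart_image_open_Int) (auto simp: chart_inv)

lemma smooth_fun_on_minus:
  "open W \<Longrightarrow> smooth_fun_on A W f \<Longrightarrow> smooth_fun_on A W (\<lambda>q. - f q)"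
  using smooth_fun_on_mult[of W "\<lambda>q. -1" f] by simp

lemma smooth_fun_on_diff:
  "open W \<Longrightarrow> smooth_fun_on A W f \<Longrightarrow> smooth_fun_on A W h \<Longrightarrow> smooth_fun_on A W (\<lambda>q. f q - h q)"
  using smooth_fun_on_add[of W f "\<lambda>q. - h q"] smooth_fun_on_minus by simp

lemma smooth_fun_on_sum:
  "open W \<Longrightarrow> (\<And>i. i \<in> I \<Longrightarrow> smooth_fun_on A W (f i)) \<Longrightarrow> smooth_fun_on A W (\<lambda>q. \<Sum>i\<in>I. f i q)"
  by (induction I rule: infinite_finite_induct) (auto intro: smooth_fun_on_add)

lemma smooth_fun_on_prod:
  "open W \<Longrightarrow> (\<And>i. i \<in> I \<Longrightarrow> smooth_fun_on A W (f i)) \<Longrightarrow> smooth_fun_on A W (\<lambda>q. \<Prod>i\<in>I. f i q)"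
  by (induction I rule: infinite_finite_induct) (auto intro: smooth_fun_on_mult)

lemma smooth_fun_uminus [intro, simp]: "smooth_fun A f \<Longrightarrow> smooth_fun A (- f)"
  using smooth_fun_on_minus[OF open_UNIV] by (simp add: fun_Compl_def)

lemma smooth_fun_simps [intro, simp]:
  assumes "smooth_fun A f" "smooth_fun A h"
  shows "smooth_fun A (f + h)" "smooth_fun A (f * h)" "smooth_fun A (f - h)"
  using smooth_fun_on_add[OF open_UNIV assms] smooth_fun_on_mult[OF open_UNIV assms]
    smooth_fun_on_diff[OF open_UNIV assms]
  by (simp_all add: plus_fun_def times_fun_def fun_diff_def)

lemma smooth_fun_0 [intro, simp]: "smooth_fun A 0"
  by (simp add: zero_fun_def)

lemma chart_fun_smooth:
  fixes f :: "real ^ 6 \<Rightarrow> real"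
  assumes U: "(U, \<phi>) \<in> A" and f: "\<And>k. Ck_on k (\<phi> ` U) f"
  shows "smooth_fun_on A U (\<lambda>q. f (\<phi> q))"
proof (rule smooth_fun_onI)
  fix V \<psi> k assume V: "(V, \<psi>) \<in> A"
  show "Ck_on k (\<psi> ` (V \<inter> U)) (\<lambda>x. f (\<phi> (inv_into V \<psi> x)))"
    by (rule Ck_on_compose[OF chart_image_open_Int[OF V chart_open[OF U]] chart_image_open[OF U] _ f chart_transition[OF V U]])
      (auto simp: chart_inv[OF V])
qed

lemma smooth_fun_on_continuous:
  assumes "open W" "smooth_fun_on A W f"
  shows "continuous_on W f"
proof (rule continuous_at_imp_continuous_on, rule ballI)
  fix p assume p: "p \<in> W"
  obtain U \<phi> where U: "(U, \<phi>) \<in> A" "p \<in> U" by (rule chart_at)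
  have "continuous_on (\<phi> ` (U \<inter> W)) (\<lambda>x. f (inv_into U \<phi> x))"
    using smooth_fun_on_Ck[OF assms(2) U(1), of 0] by simp
  moreover have "continuous_on (U \<inter> W) \<phi>"
    using chart_homeo[OF U(1)] continuous_on_subset[of U \<phi> "U \<inter> W"] by (simp add: homeomorphism_def)
  ultimately have "continuous_on (U \<inter> W) (\<lambda>q. f (inv_into U \<phi> (\<phi> q)))"
    by (rule continuous_on_compose2) auto
  then have "continuous_on (U \<inter> W) f"
    by (rule continuous_on_eq) (simp add: chart_inv[OF U(1)])
  then show "isCont f p"
    using U p assms(1) chart_open[OF U(1)] by (simp add: continuous_on_eq_continuous_at open_Int)
qed

text \<open>Closedness of the support, which uses that the manifold is Hausdorff, is what makes the
  extension by zero of a cut-off function smooth.\<close>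

lemma bump_exists:
  assumes "open W" "p \<in> W"
  obtains \<beta> W' K where "smooth_fun A \<beta>" "open W'" "p \<in> W'" "W' \<subseteq> W" "\<And>q. q \<in> W' \<Longrightarrow> \<beta> q = 1"
    "closed K" "K \<subseteq> W" "\<And>q. q \<notin> K \<Longrightarrow> \<beta> q = 0"
proof -
  obtain U \<phi> where U: "(U, \<phi>) \<in> A" "p \<in> U" by (rule chart_at)
  note hom = chart_homeo[OF U(1)]
  have "open (\<phi> ` (U \<inter> W))" by (rule chart_image_open_Int[OF U(1) assms(1)])
  then obtain e where e: "e > 0" "cball (\<phi> p) e \<subseteq> \<phi> ` (U \<inter> W)"
    using U assms(2) open_contains_cball by (metis IntI imageI)
  define r where "r = e / 2"
  have r: "r > 0" "cball (\<phi> p) (2 * r) \<subseteq> \<phi> ` (U \<inter> W)"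
    using e by (auto simp: r_def)
  obtain b :: "real ^ 6 \<Rightarrow> real" where b: "\<And>k. Ck_on k UNIV b" "\<And>x. x \<in> cball (\<phi> p) r \<Longrightarrow> b x = 1"
    "\<And>x. x \<notin> cball (\<phi> p) (2 * r) \<Longrightarrow> b x = 0"
    using smooth_bump_exists[OF r(1)] by blast
  define K where "K = inv_into U \<phi> ` cball (\<phi> p) (2 * r)"
  define \<beta> where "\<beta> q = (if q \<in> U then b (\<phi> q) else 0)" for q
  define W' where "W' = U \<inter> \<phi> -` ball (\<phi> p) r"
  have KW: "K \<subseteq> U \<inter> W"
    using r(2) by (auto simp: K_def chart_inv[OF U(1)])
  have "continuous_on (cball (\<phi> p) (2 * r)) (inv_into U \<phi>)"
    by (rule continuous_on_subset[of "\<phi> ` U"]) (use hom r(2) in \<open>auto simp: homeomorphism_def\<close>)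
  then have "closed K"
    unfolding K_def by (intro compact_imp_closed compact_continuous_image compact_cball)
  have \<beta>0: "\<beta> q = 0" if "q \<notin> K" for q
  proof (cases "q \<in> U \<and> \<phi> q \<in> cball (\<phi> p) (2 * r)")
    case True
    then have "q \<in> K" unfolding K_def using chart_inv[OF U(1), of q] by force
    then show ?thesis using that by simp
  qed (auto simp: \<beta>_def intro: b(3))
  have "smooth_fun A \<beta>"
  proof (rule smooth_fun_on_local)
    fix q
    show "\<exists>W' h. open W' \<and> q \<in> W' \<and> smooth_fun_on A W' h \<and> (\<forall>q\<in>W'. \<beta> q = h q)"
    proof (cases "q \<in> U")
      case True
      have "smooth_fun_on A U (\<lambda>q. b (\<phi> q))"
        by (rule chart_fun_smooth[OF U(1)]) (rule Ck_on_subset[OF b(1)], simp)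
      then show ?thesis using True chart_open[OF U(1)] by (intro exI[of _ U] exI[of _ "\<lambda>q. b (\<phi> q)"]) (auto simp: \<beta>_def)
    next
      case False
      then show ?thesis
        using KW \<open>closed K\<close> \<beta>0 by (intro exI[of _ "- K"] exI[of _ "\<lambda>q. 0"]) auto
    qed
  qed
  moreover have "open W'"
    unfolding W'_def using hom chart_open[OF U(1)]
    by (intro continuous_open_preimage) (auto simp: homeomorphism_def)
  moreover have "\<beta> q = 1" if "q \<in> W'" for q
    using that by (auto simp: W'_def \<beta>_def intro!: b(2))
  moreover have "W' \<subseteq> W"
  proof
    fix q assume q: "q \<in> W'"
    then have "q \<in> K"
      using \<beta>0[of q] \<open>\<And>q. q \<in> W' \<Longrightarrow> \<beta> q = 1\<close> by fastforce
    then show "q \<in> W" using KW by auto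
  qed
  ultimately show ?thesis
    using \<open>closed K\<close> KW \<beta>0 U(2) r(1) by (intro that[of \<beta> W' K]) (auto simp: W'_def)
qed

lemma smooth_fun_extend:
  assumes "open W" "smooth_fun_on A W f" "smooth_fun A \<beta>" "closed K" "K \<subseteq> W" "\<And>q. q \<notin> K \<Longrightarrow> \<beta> q = 0"
  shows "smooth_fun A (\<lambda>q. if q \<in> W then \<beta> q * f q else 0)"
proof (rule smooth_fun_on_local)
  fix q
  show "\<exists>W' h. open W' \<and> q \<in> W' \<and> smooth_fun_on A W' h \<and> (\<forall>x\<in>W'. (if x \<in> W then \<beta> x * f x else 0) = h x)"
  proof (cases "q \<in> W")
    case True
    have "smooth_fun_on A W (\<lambda>q. \<beta> q * f q)"
      using assms by (intro smooth_fun_on_mult smooth_fun_on_subset[OF assms(3)]) auto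
    then show ?thesis using True assms(1) by (intro exI[of _ W] exI[of _ "\<lambda>q. \<beta> q * f q"]) auto
  next
    case False
    then show ?thesis
      using assms(4-6) by (intro exI[of _ "- K"] exI[of _ "\<lambda>q. 0"]) auto
  qed
qed

abbreviation (input) "vf \<equiv> vfields A"

lemma
  assumes "X \<in> vf"
  shows vf_smooth [simp, intro]: "smooth_fun A f \<Longrightarrow> smooth_fun A (X f)"
    and vf_nonsmooth: "\<not> smooth_fun A f \<Longrightarrow> X f = 0"
    and vf_add: "smooth_fun A f \<Longrightarrow> smooth_fun A h \<Longrightarrow> X (f + h) = X f + X h"
    and vf_cmult: "smooth_fun A f \<Longrightarrow> X ((\<lambda>p. c) * f) = (\<lambda>p. c) * X f"
    and vf_mult: "smooth_fun A f \<Longrightarrow> smooth_fun A h \<Longrightarrow> X (f * h) = X f * h + f * X h"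
  using assms by (auto simp: vfields_def)

lemma vf_zero: "X \<in> vf \<Longrightarrow> X 0 = 0"
  using vf_cmult[of X 0 0] by (simp add: zero_fun_def times_fun_def)

lemma vf_minus:
  assumes "X \<in> vf" "smooth_fun A f" shows "X (- f) = - X f"
proof -
  have "(\<lambda>p. - 1) * f = - f" for f :: "'a \<Rightarrow> real" by (auto simp: fun_eq_iff)
  then show ?thesis using vf_cmult[OF assms, of "-1"] by metis
qed

lemma vf_diff:
  assumes "X \<in> vf" "smooth_fun A f" "smooth_fun A h" shows "X (f - h) = X f - X h"
  using vf_add[OF assms(1,2), of "- h"] vf_minus[OF assms(1,3)] assms(3) by simp

lemma vf_sum:
  assumes "X \<in> vf" "\<And>i. i \<in> I \<Longrightarrow> smooth_fun A (f i)"
  shows "X (\<Sum>i\<in>I. f i) = (\<Sum>i\<in>I. X (f i))" and "smooth_fun A (\<Sum>i\<in>I. f i)"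
proof -
  have "X (\<Sum>i\<in>I. f i) = (\<Sum>i\<in>I. X (f i)) \<and> smooth_fun A (\<Sum>i\<in>I. f i)"
    using assms(2)
    by (induction I rule: infinite_finite_induct) (auto simp: vf_zero[OF assms(1)] vf_add[OF assms(1)])
  then show "X (\<Sum>i\<in>I. f i) = (\<Sum>i\<in>I. X (f i))" and "smooth_fun A (\<Sum>i\<in>I. f i)" by auto
qed

text \<open>A derivation only sees germs: a bump function times the difference of the two functions is zero, and the
  product rule evaluates the derivative of this product at \<open>p\<close>.\<close>

lemma vf_local:
  assumes X: "X \<in> vf" and f: "smooth_fun A f" and h: "smooth_fun A h"
    and W: "open W" "p \<in> W" "\<And>q. q \<in> W \<Longrightarrow> f q = h q"
  shows "X f p = X h p"
proof -
  obtain \<beta> W' K where \<beta>: "smooth_fun A \<beta>" "p \<in> W'" "\<And>q. q \<in> W' \<Longrightarrow> \<beta> q = 1" "K \<subseteq> W" "\<And>q. q \<notin> K \<Longrightarrow> \<beta> q = 0"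
    using bump_exists[OF W(1,2)] by metis
  have "\<beta> * (f - h) = 0"
    using \<beta>(4,5) W(3) by (auto simp: fun_eq_iff)
  then have "X \<beta> * (f - h) + \<beta> * X (f - h) = 0"
    using vf_mult[OF X \<beta>(1), of "f - h"] f h vf_zero[OF X] by simp
  then have "(X \<beta> * (f - h) + \<beta> * X (f - h)) p = 0" by simp
  then show ?thesis
    using W \<beta>(2,3) by (simp add: vf_diff[OF X f h])
qed

text \<open>Pointwise form of the defining conditions, so that they can be checked by arithmetic in the reals.\<close>

lemma vfieldsI:
  assumes "\<And>f. smooth_fun A f \<Longrightarrow> smooth_fun A (X f)" "\<And>f. \<not> smooth_fun A f \<Longrightarrow> X f = 0"
    and "\<And>f h p. smooth_fun A f \<Longrightarrow> smooth_fun A h \<Longrightarrow> X (f + h) p = X f p + X h p"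
    and "\<And>c f p. smooth_fun A f \<Longrightarrow> X ((\<lambda>p. c) * f) p = c * X f p"
    and "\<And>f h p. smooth_fun A f \<Longrightarrow> smooth_fun A h \<Longrightarrow> X (f * h) p = X f p * h p + f p * X h p"
  shows "X \<in> vf"
  unfolding vfields_def using assms by (auto simp: fun_eq_iff)

lemma vfields_0 [simp, intro]: "0 \<in> vf"
  by (rule vfieldsI) auto

lemma vfields_add [simp, intro]:
  assumes "X \<in> vf" "Y \<in> vf" shows "X + Y \<in> vf"
  using assms[THEN vf_nonsmooth] assms[THEN vf_add] assms[THEN vf_cmult] assms[THEN vf_mult] assms[THEN vf_smooth]
  by (intro vfieldsI) (auto simp: distrib_left distrib_right)

lemma vfields_scale [simp, intro]:
  assumes f: "smooth_fun A f" and X: "X \<in> vf" shows "f \<cdot>\<^sub>v X \<in> vf"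
  unfolding fscale_def
  using X[THEN vf_nonsmooth] X[THEN vf_add] X[THEN vf_cmult] X[THEN vf_mult] X[THEN vf_smooth] f
  by (intro vfieldsI) (auto simp: distrib_left distrib_right)

lemma vfields_minus [simp, intro]:
  assumes X: "X \<in> vf" shows "- X \<in> vf"
  using X[THEN vf_nonsmooth] X[THEN vf_add] X[THEN vf_cmult] X[THEN vf_mult] X[THEN vf_smooth]
  by (intro vfieldsI) auto

lemma minus_eq_fscale: "- X = (\<lambda>p. - 1) \<cdot>\<^sub>v X"
  by (auto simp: fscale_def fun_eq_iff)

lemma vfields_diff [simp, intro]: "X \<in> vf \<Longrightarrow> Y \<in> vf \<Longrightarrow> X - Y \<in> vf"
  using vfields_add[of X "- Y"] by simp

lemma vfields_sum: "(\<And>i. i \<in> I \<Longrightarrow> X i \<in> vf) \<Longrightarrow> (\<Sum>i\<in>I. X i) \<in> vf"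
  by (induction I rule: infinite_finite_induct) auto

lemma vfields_bracket [simp, intro]:
  assumes X: "X \<in> vf" and Y: "Y \<in> vf" shows "lie_bracket X Y \<in> vf"
proof -
  have *: "lie_bracket X Y f = X (Y f) - Y (X f)" for f by (simp add: lie_bracket_def)
  show ?thesis
  proof (rule vfieldsI, unfold *)
    fix f h c p
    show "smooth_fun A (X (Y f) - Y (X f))" if "smooth_fun A f"
      using that X Y by auto
    show "X (Y f) - Y (X f) = 0" if "\<not> smooth_fun A f"
      using that X Y by (simp add: vf_nonsmooth[OF X] vf_nonsmooth[OF Y] vf_zero[OF X] vf_zero[OF Y] del: smooth_fun_simps)
    assume f: "smooth_fun A f"
    note sm = f vf_smooth[OF X f] vf_smooth[OF Y f]
    show "(X (Y ((\<lambda>p. c) * f)) - Y (X ((\<lambda>p. c) * f))) p = c * (X (Y f) - Y (X f)) p"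
      by (simp add: vf_cmult[OF X f] vf_cmult[OF Y f] vf_cmult[OF X sm(3)] vf_cmult[OF Y sm(2)] right_diff_distrib)
    assume h: "smooth_fun A h"
    note sm' = h vf_smooth[OF X h] vf_smooth[OF Y h]
    show "(X (Y (f + h)) - Y (X (f + h))) p = (X (Y f) - Y (X f)) p + (X (Y h) - Y (X h)) p"
      by (simp add: vf_add[OF X f h] vf_add[OF Y f h] vf_add[OF X sm(3) sm'(3)] vf_add[OF Y sm(2) sm'(2)])
    have "X (Y (f * h)) = X (Y f) * h + Y f * X h + (X f * Y h + f * X (Y h))"
      using vf_mult[OF X sm(3) h] vf_mult[OF X f sm'(3)] sm sm' by (simp add: vf_mult[OF Y f h] vf_add[OF X])
    moreover have "Y (X (f * h)) = Y (X f) * h + X f * Y h + (Y f * X h + f * Y (X h))"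
      using vf_mult[OF Y sm(2) h] vf_mult[OF Y f sm'(2)] sm sm' by (simp add: vf_mult[OF X f h] vf_add[OF Y])
    ultimately show "(X (Y (f * h)) - Y (X (f * h))) p = (X (Y f) - Y (X f)) p * h p + f p * (X (Y h) - Y (X h)) p"
      by (simp add: algebra_simps)
  qed
qed

text \<open>Partial derivatives in a chart, multiplied by a bump function so that they act on functions of the whole
  manifold. The functions \<open>h\<close>, the coordinates cut off in the same way, witness that the six fields are
  independent at \<open>p\<close>.\<close>

lemma coordinate_fields:
  fixes p :: 'a
  obtains X :: "6 \<Rightarrow> 'a vfield" and h :: "6 \<Rightarrow> 'a \<Rightarrow> real" where "\<And>k. X k \<in> vf" "\<And>j. smooth_fun A (h j)"
    "\<And>k j. X k (h j) p = (if k = j then 1 else 0)"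
proof -
  obtain U \<phi> where U: "(U, \<phi>) \<in> A" "p \<in> U" by (rule chart_at)
  note oU = chart_open[OF U(1)] and o\<phi> = chart_image_open[OF U(1)]
  obtain \<beta> W K where \<beta>: "smooth_fun A \<beta>" "open W" "p \<in> W" "W \<subseteq> U" "\<And>q. q \<in> W \<Longrightarrow> \<beta> q = 1"
    "closed K" "K \<subseteq> U" "\<And>q. q \<notin> K \<Longrightarrow> \<beta> q = 0"
    using bump_exists[OF oU U(2)] by metis
  let ?loc = "\<lambda>f x. f (inv_into U \<phi> x)"
  define d :: "6 \<Rightarrow> ('a \<Rightarrow> real) \<Rightarrow> 'a \<Rightarrow> real"
    where "d k f q = frechet_derivative (?loc f) (at (\<phi> q)) (axis k 1)" for k f q
  define X where "X k f = (if smooth_fun A f then (\<lambda>q. if q \<in> U then \<beta> q * d k f q else 0) else 0)"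
    for k :: 6 and f
  define h where "h j q = (if q \<in> U then \<beta> q * \<phi> q $ j else 0)" for j :: 6 and q
  have Ck: "Ck_on n (\<phi> ` U) (?loc f)" if "smooth_fun A f" for f n
    using smooth_fun_on_Ck[OF that U(1), of n] by simp
  have der: "(?loc f has_derivative frechet_derivative (?loc f) (at (\<phi> q))) (at (\<phi> q))"
    if "smooth_fun A f" "q \<in> U" for f q
    using Ck_on_Suc_deriv[OF Ck[OF that(1), of "Suc 0"]] that(2) by auto
  have d_eq: "d k f q = D (axis k 1)" if "(?loc f has_derivative D) (at (\<phi> q))" for k f q D
    unfolding d_def using frechet_derivative_at[OF that] by simp
  have "X k \<in> vf" for k
    unfolding vfields_def
  proof (intro CollectI conjI allI impI)
    fix f assume f: "smooth_fun A f"
    have "Ck_on n (\<phi> ` U) (\<lambda>x. frechet_derivative (?loc f) (at x) (axis k 1))" for n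
      using Ck[OF f, of "Suc n"] by simp
    then have "smooth_fun_on A U (d k f)"
      unfolding d_def by (rule chart_fun_smooth[OF U(1)])
    from smooth_fun_extend[OF oU this \<beta>(1,6,7,8)]
    show "smooth_fun A (X k f)" by (simp add: X_def f)
    show "X k ((\<lambda>p. c) * f) = (\<lambda>p. c) * X k f" for c :: real
    proof -
      have "d k ((\<lambda>p. c) * f) q = c * d k f q" if "q \<in> U" for q
        unfolding d_def[of k f] by (rule d_eq) (use has_derivative_mult_right[OF der[OF f that], of c] in \<open>simp add: times_fun_def\<close>)
      then show ?thesis using f by (auto simp: X_def fun_eq_iff)
    qed
    fix g assume g: "smooth_fun A g"
    have "d k (f + g) q = d k f q + d k g q" if "q \<in> U" for q
      unfolding d_def[of k f] d_def[of k g]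
      by (rule d_eq) (use has_derivative_add[OF der[OF f that] der[OF g that]] in \<open>simp add: plus_fun_def\<close>)
    then show "X k (f + g) = X k f + X k g"
      using f g by (auto simp: X_def fun_eq_iff algebra_simps)
    have "d k (f * g) q = f q * d k g q + d k f q * g q" if "q \<in> U" for q
      unfolding d_def[of k f] d_def[of k g]
      by (rule d_eq) (use has_derivative_mult[OF der[OF f that] der[OF g that]] chart_inv[OF U(1) that] in \<open>simp add: times_fun_def\<close>)
    then show "X k (f * g) = X k f * g + f * X k g"
      using f g by (auto simp: X_def fun_eq_iff algebra_simps)
  qed (auto simp: X_def)
  moreover have sh: "smooth_fun A (h j)" for j
  proof -
    have "smooth_fun_on A U (\<lambda>q. \<phi> q $ j)"
      by (rule chart_fun_smooth[OF U(1)])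
        (rule Ck_on_subset[OF Ck_on_bounded_linear[OF bounded_linear_vec_nth] subset_UNIV])
    from smooth_fun_extend[OF oU this \<beta>(1,6,7,8)] show ?thesis unfolding h_def .
  qed
  moreover have "X k (h j) p = (if k = j then 1 else 0)" for k j
  proof -
    have "((\<lambda>x::real^6. x $ j) has_derivative (\<lambda>v. v $ j)) (at (\<phi> p))"
      by (intro bounded_linear_imp_has_derivative bounded_linear_vec_nth)
    then have "(?loc (h j) has_derivative (\<lambda>v. v $ j)) (at (\<phi> p))"
      by (rule has_derivative_transform_within_open[where s = "\<phi> ` (U \<inter> W)"])
        (use chart_image_open_Int[OF U(1) \<beta>(2)] \<beta>(3,5) U chart_inv[OF U(1)] in \<open>auto simp: h_def\<close>)
    from d_eq[OF this, of k] show ?thesis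
      using sh \<beta>(3,5) U(2) by (auto simp: X_def axis_def)
  qed
  ultimately show ?thesis by (intro that[of X h])
qed

end

section \<open>Determinants of one-forms\<close>

lemma wedge_Nil: "wedge [] [] p = 1"
  by (simp add: wedge_def)

text \<open>Makes the Laplace expansions of determinants available for wedge products of 1-forms.\<close>

lemma wedge_eq_det:
  assumes "length \<alpha>s = n"
  shows "wedge \<alpha>s ws p = Determinant.det (Matrix.mat n n (\<lambda>(i, j). (\<alpha>s ! i) [ws ! j] p))"
proof -
  have "(\<Prod>i<n. (\<alpha>s ! i) [ws ! \<pi> i] p) = (\<Prod>i = 0..<n. Matrix.mat n n (\<lambda>(i, j). (\<alpha>s ! i) [ws ! j] p) $$ (i, \<pi> i))"
    if "\<pi> permutes {..<n}" for \<pi>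
    using permutes_in_image[OF that] by (intro prod.cong) (auto simp: atLeast0LessThan)
  then show ?thesis
    unfolding wedge_def Determinant.det_def using assms by (auto simp: atLeast0LessThan intro!: sum.cong)
qed

lemma wedge_Cons:
  assumes "length ws = Suc (length \<alpha>s)"
  shows "wedge (\<alpha> # \<alpha>s) ws p =
    (\<Sum>j<length ws. (-1) ^ j * \<alpha> [ws ! j] p * wedge \<alpha>s (take j ws @ drop (Suc j) ws) p)"
proof -
  let ?n = "length ws"
  let ?M = "Matrix.mat ?n ?n (\<lambda>(i, j). ((\<alpha> # \<alpha>s) ! i) [ws ! j] p)"
  have "Determinant.det ?M = (\<Sum>j<?n. ?M $$ (0, j) * cofactor ?M 0 j)"
    using assms by (intro laplace_expansion_row) auto
  also have "\<dots> = (\<Sum>j<?n. (-1) ^ j * \<alpha> [ws ! j] p * wedge \<alpha>s (take j ws @ drop (Suc j) ws) p)"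
  proof (rule sum.cong[OF refl])
    fix j assume j: "j \<in> {..<?n}"
    have "mat_delete ?M 0 j = Matrix.mat (length \<alpha>s) (length \<alpha>s) (\<lambda>(i, k). (\<alpha>s ! i) [(take j ws @ drop (Suc j) ws) ! k] p)"
      using assms j by (intro eq_matI) (auto simp: mat_delete_def nth_append min_def)
    then show "?M $$ (0, j) * cofactor ?M 0 j =
        (-1) ^ j * \<alpha> [ws ! j] p * wedge \<alpha>s (take j ws @ drop (Suc j) ws) p"
      using assms j by (simp add: cofactor_def wedge_eq_det[OF refl] del: mat_delete_dim)
  qed
  finally show ?thesis using assms by (simp add: wedge_eq_det[of "\<alpha> # \<alpha>s" ?n])
qed

lemma wedge_2:
  "wedge [\<alpha>, \<beta>] [X, Y] p = \<alpha> [X] p * \<beta> [Y] p - \<alpha> [Y] p * \<beta> [X] p"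
  by (simp add: wedge_Cons wedge_Nil lessThan_Suc)

lemma wedge_3:
  "wedge [\<alpha>, \<beta>, \<gamma>] [X, Y, Z] p = \<alpha> [X] p * (\<beta> [Y] p * \<gamma> [Z] p - \<beta> [Z] p * \<gamma> [Y] p)
    - \<alpha> [Y] p * (\<beta> [X] p * \<gamma> [Z] p - \<beta> [Z] p * \<gamma> [X] p)
    + \<alpha> [Z] p * (\<beta> [X] p * \<gamma> [Y] p - \<beta> [Y] p * \<gamma> [X] p)"
  by (simp add: wedge_Cons wedge_Nil lessThan_Suc numeral_2_eq_2 algebra_simps)

section \<open>Unitary frames\<close>

lemma tensor_onD:
  assumes "tensor_on A W k \<alpha>" "length ws = k" "set ws \<subseteq> vfields A"
  shows "smooth_fun_on A W (\<alpha> ws)"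
    and "i < k \<Longrightarrow> p \<in> W \<Longrightarrow> X \<in> vfields A \<Longrightarrow> Y \<in> vfields A \<Longrightarrow>
      \<alpha> (ws[i := X + Y]) p = \<alpha> (ws[i := X]) p + \<alpha> (ws[i := Y]) p"
    and "i < k \<Longrightarrow> p \<in> W \<Longrightarrow> X \<in> vfields A \<Longrightarrow> smooth_fun A f \<Longrightarrow>
      \<alpha> (ws[i := f \<cdot>\<^sub>v X]) p = f p * \<alpha> (ws[i := X]) p"
proof -
  note t = assms(1)[unfolded tensor_on_def, THEN spec, THEN mp, THEN mp, OF assms(2,3)]
  show "smooth_fun_on A W (\<alpha> ws)" using t by blast
  show "\<alpha> (ws[i := X + Y]) p = \<alpha> (ws[i := X]) p + \<alpha> (ws[i := Y]) p"
    if "i < k" "p \<in> W" "X \<in> vfields A" "Y \<in> vfields A"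
  proof -
    have "smooth_fun A (\<lambda>p. 0)" by (auto simp: smooth_fun_on_def smooth_on_def comp_def Ck_on_const)
    then show ?thesis using t that by blast
  qed
  show "\<alpha> (ws[i := f \<cdot>\<^sub>v X]) p = f p * \<alpha> (ws[i := X]) p"
    if "i < k" "p \<in> W" "X \<in> vfields A" "smooth_fun A f"
    using t that by blast
qed

text \<open>A left inverse of a square matrix is a right inverse.\<close>

lemma orthogonal_transpose:
  fixes M :: "nat \<Rightarrow> nat \<Rightarrow> real"
  assumes "\<And>i j. i \<in> {1..6} \<Longrightarrow> j \<in> {1..6} \<Longrightarrow> (\<Sum>k=1..6. M i k * M j k) = (if i = j then 1 else 0)"
    and "i \<in> {1..6}" "j \<in> {1..6}"
  shows "(\<Sum>k=1..6. M k i * M k j) = (if i = j then 1 else 0)"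
proof -
  have "card {1..6::nat} = card (UNIV :: 6 set)" by simp
  then obtain b :: "6 \<Rightarrow> nat" where b: "bij_betw b UNIV {1..6}"
    using finite_same_card_bij[of "UNIV :: 6 set" "{1..6::nat}"] by auto
  define B :: "real ^ 6 ^ 6" where "B = (\<chi> i j. M (b i) (b j))"
  have bi: "b k \<in> {1..6}" for k using b by (auto simp: bij_betw_def)
  have inj: "b k = b l \<longleftrightarrow> k = l" for k l using b by (auto simp: bij_betw_def inj_on_def)
  have s: "(\<Sum>k\<in>UNIV. f (b k)) = (\<Sum>k=1..6. f k)" for f :: "nat \<Rightarrow> real"
    by (rule sum.reindex_bij_betw[OF b])
  have "B ** transpose B = mat 1"
    by (simp add: B_def matrix_matrix_mult_def transpose_def Finite_Cartesian_Product.mat_def vec_eq_iff s[where f = "\<lambda>k. M (b i) k * M (b j) k" for i j]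
        assms(1)[OF bi bi] inj del: One_nat_def)
  then have *: "transpose B ** B = mat 1"
    by (simp add: matrix_left_right_inverse)
  obtain i' j' where "i = b i'" "j = b j'" using assms(2,3) b unfolding bij_betw_def by (metis imageE)
  then show ?thesis
    using arg_cong[OF *, of "\<lambda>C. C $ i' $ j'"]
    by (simp add: B_def matrix_matrix_mult_def transpose_def Finite_Cartesian_Product.mat_def s[where f = "\<lambda>k. M k (b i') * M k (b j')"] inj del: One_nat_def)
qed

text \<open>A covector at \<open>p\<close>, encoded as a functional of global vector fields. Whether its value depends only on the
  vector at \<open>p\<close> is not part of the definition; it is a consequence of function-linearity (\<open>covector_expand\<close>).\<close>

definition covector_at :: "'a chart set \<Rightarrow> 'a \<Rightarrow> ('a vfield \<Rightarrow> real) \<Rightarrow> bool" where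
  "covector_at A p h \<longleftrightarrow>
     (\<forall>X\<in>vfields A. \<forall>Y\<in>vfields A. h (X + Y) = h X + h Y) \<and>
     (\<forall>X\<in>vfields A. \<forall>f. smooth_fun A f \<longrightarrow> h (f \<cdot>\<^sub>v X) = f p * h X)"

context smooth_mfd
begin

lemma covector_atD:
  assumes "covector_at A p h"
  shows "X \<in> vf \<Longrightarrow> Y \<in> vf \<Longrightarrow> h (X + Y) = h X + h Y"
    and "X \<in> vf \<Longrightarrow> smooth_fun A f \<Longrightarrow> h (f \<cdot>\<^sub>v X) = f p * h X"
  using assms by (auto simp: covector_at_def)

lemma covector_minus: "covector_at A p h \<Longrightarrow> X \<in> vf \<Longrightarrow> h (- X) = - h X"
  using covector_atD(2)[of p h X "\<lambda>_. -1"] by (simp add: minus_eq_fscale)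

lemma covector_diff:
  "covector_at A p h \<Longrightarrow> X \<in> vf \<Longrightarrow> Y \<in> vf \<Longrightarrow> h (X - Y) = h X - h Y"
  using covector_atD(1)[of p h X "- Y"] covector_minus[of p h Y] by simp

lemma covector_0: "covector_at A p h \<Longrightarrow> h 0 = 0"
  using covector_atD(1)[of p h 0 0] by simp

lemma covector_sum:
  assumes "covector_at A p h" "\<And>i. i \<in> I \<Longrightarrow> X i \<in> vf"
  shows "h (\<Sum>i\<in>I. X i) = (\<Sum>i\<in>I. h (X i))"
  using assms(2)
  by (induction I rule: infinite_finite_induct)
    (auto simp: covector_0[OF assms(1)] covector_atD(1)[OF assms(1)] vfields_sum)

lemma covector_lincomb:
  assumes "covector_at A p h" "\<And>i. i \<in> I \<Longrightarrow> X i \<in> vf" "\<And>i. i \<in> I \<Longrightarrow> smooth_fun A (f i)"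
  shows "h (\<Sum>i\<in>I. f i \<cdot>\<^sub>v X i) = (\<Sum>i\<in>I. f i p * h (X i))"
  using assms by (subst covector_sum[OF assms(1)]) (auto simp: covector_atD(2)[OF assms(1)])

lemma lincomb_apply: "(\<Sum>i\<in>I. f i \<cdot>\<^sub>v X i) h q = (\<Sum>i\<in>I. f i q * X i h q)"
  by (induction I rule: infinite_finite_induct) (auto simp: fscale_def)

lemma tensor_covector:
  assumes "tensor_on A W k \<alpha>" "length ws = k" "set ws \<subseteq> vf" "i < k" "p \<in> W"
  shows "covector_at A p (\<lambda>X. \<alpha> (ws[i := X]) p)"
  using tensor_onD(2,3)[OF assms] by (auto simp: covector_at_def)

end

locale su3_mfd = smooth_mfd A
  for A :: "('a::{t2_space, second_countable_topology}) chart set" +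
  fixes g :: "('a, real) ctensor"
    and J :: "'a vfield \<Rightarrow> 'a vfield"
    and \<Psi> :: "('a, complex) ctensor"
  assumes hermitian: "almost_hermitian A g J"
    and su3: "su3_structure A g J \<Psi>"
begin

lemma J_vf [simp, intro]: "X \<in> vf \<Longrightarrow> J X \<in> vf"
  and J_J [simp]: "X \<in> vf \<Longrightarrow> J (J X) = - X"
  and J_add: "X \<in> vf \<Longrightarrow> Y \<in> vf \<Longrightarrow> J (X + Y) = J X + J Y"
  and J_scale: "X \<in> vf \<Longrightarrow> smooth_fun A f \<Longrightarrow> J (f \<cdot>\<^sub>v X) = f \<cdot>\<^sub>v J X"
  and g_J [simp]: "X \<in> vf \<Longrightarrow> Y \<in> vf \<Longrightarrow> g [J X, J Y] = g [X, Y]"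
  and g_tensor: "tensor_on A UNIV 2 g"
  and g_sym: "X \<in> vf \<Longrightarrow> Y \<in> vf \<Longrightarrow> g [X, Y] = g [Y, X]"
  using hermitian unfolding almost_hermitian_def almost_complex_def riemannian_metric_def by auto

lemma J_minus: "X \<in> vf \<Longrightarrow> J (- X) = - J X"
  using J_scale[of X "\<lambda>_. -1"] by (simp add: minus_eq_fscale)

lemma J_diff: "X \<in> vf \<Longrightarrow> Y \<in> vf \<Longrightarrow> J (X - Y) = J X - J Y"
  using J_add[of X "- Y"] by (simp add: J_minus)

lemma g_smooth [simp, intro]: "X \<in> vf \<Longrightarrow> Y \<in> vf \<Longrightarrow> smooth_fun A (g [X, Y])"
  using tensor_onD(1)[OF g_tensor, of "[X, Y]"] by simp

lemma g_covector1: "Y \<in> vf \<Longrightarrow> covector_at A p (\<lambda>X. g [X, Y] p)"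
  using tensor_covector[OF g_tensor, of "[Y, Y]" 0 p] by simp

lemma g_covector2: "Y \<in> vf \<Longrightarrow> covector_at A p (\<lambda>X. g [Y, X] p)"
  using tensor_covector[OF g_tensor, of "[Y, Y]" 1 p] by simp

lemma J_covector: "covector_at A p h \<Longrightarrow> covector_at A p (\<lambda>X. h (J X))"
  by (auto simp: covector_at_def J_add J_scale)

lemma g_J_skew:
  assumes "X \<in> vf" "Y \<in> vf" shows "g [J X, Y] = - g [X, J Y]"
proof -
  have "g [J X, J (J Y)] = g [X, J Y]" using assms by (intro g_J) auto
  then show ?thesis
    using assms covector_minus[OF g_covector2[of "J X"], of Y] by (auto simp: fun_eq_iff minus_equation_iff)
qed

text \<open>A field of length \<open>0\<close> at \<open>p\<close> is zero at \<open>p\<close> as a derivation. This turns metric computations into identities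
  between vector fields.\<close>

lemma g_null: "X \<in> vf \<Longrightarrow> g [X, X] p = 0 \<Longrightarrow> X f p = 0"
  using hermitian unfolding almost_hermitian_def riemannian_metric_def by (metis less_irrefl)

lemma coframe_at:
  obtains W and e :: "nat \<Rightarrow> ('a, real) ctensor" where "open W" "p \<in> W"
    "\<And>i X. i \<in> {1..6} \<Longrightarrow> X \<in> vf \<Longrightarrow> smooth_fun_on A W (e i [X])"
    "\<And>i q. i \<in> {1..6} \<Longrightarrow> q \<in> W \<Longrightarrow> covector_at A q (\<lambda>X. e i [X] q)"
    "\<And>q X Y. q \<in> W \<Longrightarrow> X \<in> vf \<Longrightarrow> Y \<in> vf \<Longrightarrow> g [X, Y] q = (\<Sum>i=1..6. e i [X] q * e i [Y] q)"
    "\<And>q X Y. q \<in> W \<Longrightarrow> X \<in> vf \<Longrightarrow> Y \<in> vf \<Longrightarrow> g [X, J Y] q =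
      - wedge [e 1, e 2] [X, Y] q - wedge [e 3, e 4] [X, Y] q - wedge [e 5, e 6] [X, Y] q"
    "\<And>q X Y Z. q \<in> W \<Longrightarrow> X \<in> vf \<Longrightarrow> Y \<in> vf \<Longrightarrow> Z \<in> vf \<Longrightarrow>
      \<Psi> [X, Y, Z] q = - wedge [\<lambda>w q. Complex (e 1 w q) (e 2 w q), \<lambda>w q. Complex (e 3 w q) (e 4 w q),
                      \<lambda>w q. Complex (e 5 w q) (e 6 w q)] [X, Y, Z] q"
proof -
  obtain W and e :: "nat \<Rightarrow> ('a, real) ctensor" where W: "open W" "p \<in> W" "orthonormal_coframe_on A g W e"
    and *: "\<forall>q\<in>W. \<forall>X\<in>vf. \<forall>Y\<in>vf. \<forall>Z\<in>vf.
           kaehler_form g J [X, Y] q =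
             - wedge [e 1, e 2] [X, Y] q - wedge [e 3, e 4] [X, Y] q - wedge [e 5, e 6] [X, Y] q \<and>
           \<Psi> [X, Y, Z] q =
             - wedge [\<lambda>w q. Complex (e 1 w q) (e 2 w q),
                      \<lambda>w q. Complex (e 3 w q) (e 4 w q),
                      \<lambda>w q. Complex (e 5 w q) (e 6 w q)] [X, Y, Z] q"
    using su3[unfolded su3_structure_def, THEN conjunct2, THEN conjunct2, THEN conjunct2, THEN spec, of p]
    by (elim exE conjE) (rule that; assumption)
  have t: "tensor_on A W 1 (e i)" if "i \<in> {1..6}" for i
    using W(3) that by (simp add: orthonormal_coframe_on_def)
  show ?thesis
  proof (rule that[OF W(1,2), of e])
    show "smooth_fun_on A W (e i [X])" if "i \<in> {1..6}" "X \<in> vf" for i X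
      using tensor_onD(1)[OF t[OF that(1)], of "[X]"] that by simp
    show "covector_at A q (\<lambda>X. e i [X] q)" if "i \<in> {1..6}" "q \<in> W" for i q
      using tensor_covector[OF t[OF that(1)], of "[0]" 0 q] that by simp
    show "g [X, Y] q = (\<Sum>i=1..6. e i [X] q * e i [Y] q)"
      if "q \<in> W" "X \<in> vf" "Y \<in> vf" for q X Y
      using W(3) that unfolding orthonormal_coframe_on_def by blast
    show "g [X, J Y] q = - wedge [e 1, e 2] [X, Y] q - wedge [e 3, e 4] [X, Y] q - wedge [e 5, e 6] [X, Y] q"
      if "q \<in> W" "X \<in> vf" "Y \<in> vf" for q X Y
      using *[rule_format, OF that that(2)] by (simp add: kaehler_form_def)
    show "\<Psi> [X, Y, Z] q = - wedge [\<lambda>w q. Complex (e 1 w q) (e 2 w q), \<lambda>w q. Complex (e 3 w q) (e 4 w q),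
                      \<lambda>w q. Complex (e 5 w q) (e 6 w q)] [X, Y, Z] q"
      if "q \<in> W" "X \<in> vf" "Y \<in> vf" "Z \<in> vf" for q X Y Z
      using *[rule_format, OF that] by blast
  qed
qed

lemma orthonormal_atD:
  assumes "orthonormal_at A g p E"
  shows "i \<in> {1..6} \<Longrightarrow> E i \<in> vf"
    and "i \<in> {1..6} \<Longrightarrow> j \<in> {1..6} \<Longrightarrow> g [E i, E j] p = (if i = j then 1 else 0)"
  using assms unfolding orthonormal_at_def by auto

text \<open>The coframe maps tangent vectors at \<open>p\<close> isometrically to \<open>\<real>\<^sup>6\<close>, so the components of an orthonormal basis
  form an orthogonal matrix. Therefore the difference of \<open>X\<close> and its Fourier sum has vanishing components, hence
  length \<open>0\<close>.\<close>

lemma orthonormal_complete: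
  assumes E: "orthonormal_at A g p E" and X: "X \<in> vf"
  shows "X f p = (\<Sum>i=1..6. g [X, E i] p * E i f p)"
    and "Y \<in> vf \<Longrightarrow> g [X, Y] p = (\<Sum>i=1..6. g [X, E i] p * g [E i, Y] p)"
proof -
  obtain W and e :: "nat \<Rightarrow> ('a, real) ctensor" where e: "open W" "p \<in> W"
    "\<And>i X. i \<in> {1..6} \<Longrightarrow> X \<in> vf \<Longrightarrow> smooth_fun_on A W (e i [X])"
    "\<And>i q. i \<in> {1..6} \<Longrightarrow> q \<in> W \<Longrightarrow> covector_at A q (\<lambda>X. e i [X] q)"
    "\<And>q X Y. q \<in> W \<Longrightarrow> X \<in> vf \<Longrightarrow> Y \<in> vf \<Longrightarrow> g [X, Y] q = (\<Sum>i=1..6. e i [X] q * e i [Y] q)"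
    "\<And>q X Y. q \<in> W \<Longrightarrow> X \<in> vf \<Longrightarrow> Y \<in> vf \<Longrightarrow> g [X, J Y] q =
      - wedge [e 1, e 2] [X, Y] q - wedge [e 3, e 4] [X, Y] q - wedge [e 5, e 6] [X, Y] q"
    "\<And>q X Y Z. q \<in> W \<Longrightarrow> X \<in> vf \<Longrightarrow> Y \<in> vf \<Longrightarrow> Z \<in> vf \<Longrightarrow>
      \<Psi> [X, Y, Z] q = - wedge [\<lambda>w q. Complex (e 1 w q) (e 2 w q), \<lambda>w q. Complex (e 3 w q) (e 4 w q),
                      \<lambda>w q. Complex (e 5 w q) (e 6 w q)] [X, Y, Z] q"
    by (rule coframe_at[of p]) (rule that; assumption)
  note E1 = orthonormal_atD[OF E]
  define c where "c i = g [X, E i] p" for i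
  define Y' where "Y' = X - (\<Sum>i=1..6. (\<lambda>_. c i) \<cdot>\<^sub>v E i)"
  have S: "(\<Sum>i=1..6. (\<lambda>_. c i) \<cdot>\<^sub>v E i) \<in> vf"
    using E1 by (intro vfields_sum vfields_scale) auto
  have orth: "(\<Sum>i=1..6. e j [E i] p * e k [E i] p) = (if j = k then 1 else 0)"
    if "j \<in> {1..6}" "k \<in> {1..6}" for j k
    by (rule orthogonal_transpose[where M = "\<lambda>i j. e j [E i] p", OF _ that])
      (use E1 e(2,5) in auto)
  have z: "e k [Y'] p = 0" if k: "k \<in> {1..6}" for k
  proof -
    have "e k [Y'] p = e k [X] p - (\<Sum>i=1..6. c i * e k [E i] p)"
      unfolding Y'_def covector_diff[OF e(4)[OF k e(2)] X S]
      by (subst covector_lincomb[OF e(4)[OF k e(2)]]) (use E1 in auto)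
    also have "(\<Sum>i=1..6. c i * e k [E i] p) = (\<Sum>i=1..6. \<Sum>j=1..6. e j [X] p * (e j [E i] p * e k [E i] p))"
      using X E1 e(2,5) by (auto simp: c_def sum_distrib_left sum_distrib_right mult_ac intro!: sum.cong)
    also have "\<dots> = (\<Sum>j=1..6. e j [X] p * (\<Sum>i=1..6. e j [E i] p * e k [E i] p))"
      by (subst sum.swap) (simp add: sum_distrib_left)
    also have "\<dots> = e k [X] p"
      using k orth by (simp add: if_distrib[of "\<lambda>x. _ * x"] cong: if_cong)
    finally show ?thesis by simp
  qed
  have Y'vf: "Y' \<in> vf" unfolding Y'_def using X S by auto
  have "g [Y', Y'] p = 0" using e(5)[OF e(2) Y'vf Y'vf] z by simp
  from g_null[OF Y'vf this, of f]
  show "X f p = (\<Sum>i=1..6. g [X, E i] p * E i f p)"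
    by (simp add: Y'_def lincomb_apply c_def)
  assume Y: "Y \<in> vf"
  have "g [Y', Y] p = 0" using e(5)[OF e(2) Y'vf Y] z by simp
  moreover have "g [Y', Y] p = g [X, Y] p - (\<Sum>i=1..6. c i * g [E i, Y] p)"
    unfolding Y'_def covector_diff[OF g_covector1[OF Y] X S]
    by (subst covector_lincomb[OF g_covector1[OF Y]]) (use E1 in auto)
  ultimately show "g [X, Y] p = (\<Sum>i=1..6. g [X, E i] p * g [E i, Y] p)"
    by (simp add: c_def)
qed

definition unitary_frame :: "'a set \<Rightarrow> (nat \<Rightarrow> 'a vfield) \<Rightarrow> bool" where
  "unitary_frame W E \<longleftrightarrow> open W \<and> (\<forall>q\<in>W. positive_basis_at A g J q E)"

text \<open>The components of the coordinate fields in the coframe form an invertible matrix at \<open>p\<close>: a kernel vector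
  would be a combination of coordinate fields of length \<open>0\<close>, which does not differentiate any coordinate.
  Cramer's rule solves for the dual frame with coefficients that are smooth near \<open>p\<close>, and a bump function
  makes them global.\<close>

lemma dual_frame_exists:
  fixes e :: "nat \<Rightarrow> ('a, real) ctensor"
  assumes "open W" "p \<in> W"
    and smooth: "\<And>i X. i \<in> {1..6} \<Longrightarrow> X \<in> vf \<Longrightarrow> smooth_fun_on A W (e i [X])"
    and cov: "\<And>i q. i \<in> {1..6} \<Longrightarrow> q \<in> W \<Longrightarrow> covector_at A q (\<lambda>X. e i [X] q)"
    and ge: "\<And>q X Y. q \<in> W \<Longrightarrow> X \<in> vf \<Longrightarrow> Y \<in> vf \<Longrightarrow> g [X, Y] q = (\<Sum>i=1..6. e i [X] q * e i [Y] q)"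
  obtains W' E where "open W'" "p \<in> W'" "W' \<subseteq> W" "\<And>i. i \<in> {1..6} \<Longrightarrow> E i \<in> vf"
    "\<And>q i j. q \<in> W' \<Longrightarrow> i \<in> {1..6} \<Longrightarrow> j \<in> {1..6} \<Longrightarrow> e j [E i] q = (if i = j then 1 else 0)"
proof -
  obtain X :: "6 \<Rightarrow> 'a vfield" and h :: "6 \<Rightarrow> 'a \<Rightarrow> real" where X: "\<And>k. X k \<in> vf" and h: "\<And>j. smooth_fun A (h j)"
    "\<And>k j. X k (h j) p = (if k = j then 1 else 0)"
    by (rule coordinate_fields[of p]) (rule that; assumption)
  have "card {1..6::nat} = card (UNIV :: 6 set)" by simp
  then obtain b :: "6 \<Rightarrow> nat" where b: "bij_betw b UNIV {1..6}"
    using finite_same_card_bij[of "UNIV :: 6 set" "{1..6::nat}"] by auto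
  have bi: "b k \<in> {1..6}" for k using b by (auto simp: bij_betw_def)
  have inj: "b k = b l \<longleftrightarrow> k = l" for k l using b by (auto simp: bij_betw_def inj_on_def)
  define M :: "'a \<Rightarrow> real ^ 6 ^ 6" where "M q = (\<chi> j k. e (b j) [X k] q)" for q
  define c where "c m k q = det (\<chi> i j. if j = k then axis m 1 $ i else M q $ i $ j) * inverse (det (M q))"
    for m k :: 6 and q
  have d0: "det (M p) \<noteq> 0"
  proof
    assume "det (M p) = 0"
    then have "\<not> invertible (M p)" by (simp add: invertible_det_nz)
    then obtain v where v: "v \<noteq> 0" "M p *v v = 0"
      by (metis invertible_left_inverse matrix_left_invertible_ker)
    define Y where "Y = (\<Sum>k\<in>UNIV. (\<lambda>_. v $ k) \<cdot>\<^sub>v X k)"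
    have Y: "Y \<in> vf" unfolding Y_def using X by (intro vfields_sum) auto
    have "e j [Y] p = 0" if "j \<in> {1..6}" for j
    proof -
      obtain j' where j': "j = b j'" using \<open>j \<in> {1..6}\<close> b unfolding bij_betw_def by (metis imageE)
      have "e j [Y] p = (\<Sum>k\<in>UNIV. v $ k * e j [X k] p)"
        unfolding Y_def using X by (intro covector_lincomb[OF cov[OF that assms(2)]]) auto
      also have "\<dots> = (M p *v v) $ j'"
        by (simp add: matrix_vector_mult_def M_def j' mult.commute)
      finally show ?thesis using v by simp
    qed
    then have "g [Y, Y] p = 0" using ge[OF assms(2) Y Y] by simp
    then have "Y (h j) p = 0" for j by (rule g_null[OF Y])
    moreover have "Y (h j) p = v $ j" for j
      by (simp add: Y_def lincomb_apply h(2) if_distrib cong: if_cong)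
    ultimately show False using v(1) by (simp add: Finite_Cartesian_Product.vec_eq_iff)
  qed
  have sM: "smooth_fun_on A W (\<lambda>q. M q $ j $ k)" for j k
    using smooth[OF bi X] by (simp add: M_def)
  have sdet: "smooth_fun_on A W (\<lambda>q. det (N q))"
    if "\<And>j k. smooth_fun_on A W (\<lambda>q. N q $ j $ k)" for N :: "'a \<Rightarrow> real ^ 6 ^ 6"
    unfolding Determinants.det_def using assms(1) that
    by (intro smooth_fun_on_sum smooth_fun_on_mult smooth_fun_on_prod smooth_fun_on_const) auto
  define W1 where "W1 = W \<inter> (\<lambda>q. det (M q)) -` (- {0})"
  have "open W1"
    unfolding W1_def using assms(1)
    by (intro continuous_open_preimage smooth_fun_on_continuous sdet sM) auto
  have "p \<in> W1" using d0 assms(2) by (simp add: W1_def)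
  obtain \<beta> W' K where \<beta>: "smooth_fun A \<beta>" "open W'" "p \<in> W'" "W' \<subseteq> W1" "\<And>q. q \<in> W' \<Longrightarrow> \<beta> q = 1"
    "closed K" "K \<subseteq> W1" "\<And>q. q \<notin> K \<Longrightarrow> \<beta> q = 0"
    using bump_exists[OF \<open>open W1\<close> \<open>p \<in> W1\<close>] by metis
  have "smooth_fun_on A W (\<lambda>q. if k = l then axis m 1 $ j else M q $ j $ k)" for j k l m
    using sM by (cases "k = l") auto
  then have "smooth_fun_on A W (\<lambda>q. det (\<chi> i j. if j = k then axis m 1 $ i else M q $ i $ j))" for m k
    by (intro sdet) simp
  then have "smooth_fun_on A W1 (\<lambda>q. det (\<chi> i j. if j = k then axis m 1 $ i else M q $ i $ j))" for m k
    by (rule smooth_fun_on_subset) (auto simp: W1_def)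
  then have "smooth_fun_on A W1 (c m k)" for m k
    unfolding c_def using \<open>open W1\<close> smooth_fun_on_subset[OF sdet[OF sM], of W1]
    by (intro smooth_fun_on_mult smooth_fun_on_inverse) (auto simp: W1_def)
  from smooth_fun_extend[OF \<open>open W1\<close> this \<beta>(1,6,7,8)]
  have sC: "smooth_fun A (\<lambda>q. if q \<in> W1 then \<beta> q * c m k q else 0)" for m k .
  define E0 where "E0 m = (\<Sum>k\<in>UNIV. (\<lambda>q. if q \<in> W1 then \<beta> q * c m k q else 0) \<cdot>\<^sub>v X k)" for m
  have E0: "E0 m \<in> vf" for m unfolding E0_def using X sC by (intro vfields_sum) auto
  have dual: "e (b j) [E0 m] q = (if m = j then 1 else 0)" if q: "q \<in> W'" for q j m
  proof -
    have qW: "q \<in> W1" "q \<in> W" "det (M q) \<noteq> 0" "\<beta> q = 1" using q \<beta>(4,5) by (auto simp: W1_def)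
    have "e (b j) [E0 m] q = (\<Sum>k\<in>UNIV. c m k q * e (b j) [X k] q)"
      unfolding E0_def using X sC qW by (subst covector_lincomb[OF cov[OF bi qW(2)]]) auto
    also have "\<dots> = (M q *v (\<chi> k. c m k q)) $ j"
      by (simp add: matrix_vector_mult_def M_def mult.commute)
    also have "M q *v (\<chi> k. c m k q) = axis m 1"
      unfolding cramer[OF qW(3)] c_def by (simp add: divide_inverse)
    finally show ?thesis by (simp add: axis_def eq_commute)
  qed
  define E where "E n = E0 (inv_into UNIV b n)" for n
  have "e j [E i] q = (if i = j then 1 else 0)" if "q \<in> W'" "i \<in> {1..6}" "j \<in> {1..6}" for q i j
  proof -
    have "i \<in> range b" "j \<in> range b" using that b by (auto simp: bij_betw_def)
    then obtain i' j' where ij: "i = b i'" "j = b j'" by blast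
    have "inj b" using b by (simp add: bij_betw_def)
    then show ?thesis unfolding E_def ij using dual[OF that(1)] inj by simp
  qed
  then show ?thesis using E0 \<beta>(2,3,4)
    by (intro that[of W' E]) (auto simp: E_def W1_def)
qed

text \<open>The fields with even index are replaced by \<open>J\<close>-images, so that \<open>E (i + 1) = J (E i)\<close> holds on the whole
  manifold and not only near \<open>p\<close>; by the normal form of the Kaehler form this does not change them near \<open>p\<close>.\<close>

lemma unitary_frame_exists:
  obtains W E where "p \<in> W" "unitary_frame W E" "\<Psi> [E 1, E 3, E 5] p = - 1"
proof -
  obtain W and e :: "nat \<Rightarrow> ('a, real) ctensor" where e: "open W" "p \<in> W"
    "\<And>i X. i \<in> {1..6} \<Longrightarrow> X \<in> vf \<Longrightarrow> smooth_fun_on A W (e i [X])"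
    "\<And>i q. i \<in> {1..6} \<Longrightarrow> q \<in> W \<Longrightarrow> covector_at A q (\<lambda>X. e i [X] q)"
    "\<And>q X Y. q \<in> W \<Longrightarrow> X \<in> vf \<Longrightarrow> Y \<in> vf \<Longrightarrow> g [X, Y] q = (\<Sum>i=1..6. e i [X] q * e i [Y] q)"
    "\<And>q X Y. q \<in> W \<Longrightarrow> X \<in> vf \<Longrightarrow> Y \<in> vf \<Longrightarrow> g [X, J Y] q =
      - wedge [e 1, e 2] [X, Y] q - wedge [e 3, e 4] [X, Y] q - wedge [e 5, e 6] [X, Y] q"
    "\<And>q X Y Z. q \<in> W \<Longrightarrow> X \<in> vf \<Longrightarrow> Y \<in> vf \<Longrightarrow> Z \<in> vf \<Longrightarrow>
      \<Psi> [X, Y, Z] q = - wedge [\<lambda>w q. Complex (e 1 w q) (e 2 w q), \<lambda>w q. Complex (e 3 w q) (e 4 w q),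
                      \<lambda>w q. Complex (e 5 w q) (e 6 w q)] [X, Y, Z] q"
    by (rule coframe_at[of p]) (rule that; assumption)
  obtain W' F where F: "open W'" "p \<in> W'" "W' \<subseteq> W" "\<And>i. i \<in> {1..6} \<Longrightarrow> F i \<in> vf"
    "\<And>q i j. q \<in> W' \<Longrightarrow> i \<in> {1..6} \<Longrightarrow> j \<in> {1..6} \<Longrightarrow> e j [F i] q = (if i = j then 1 else 0)"
    by (rule dual_frame_exists[OF e(1-5)]) (assumption | rule that)+
  define E where "E n = (if even n then J (F (n - 1)) else F n)" for n
  have six: "{1..6::nat} = {1, 2, 3, 4, 5, 6}" by auto
  have E: "E i \<in> vf" if "i \<in> {1..6}" for i
  proof (cases "even i")
    case True
    then have "i - 1 \<in> {1..6}" using that by (auto elim!: evenE)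
    then show ?thesis using True F(4) by (simp add: E_def)
  qed (use that F(4) in \<open>simp add: E_def\<close>)
  have ei: "e j [Y] q = g [F j, Y] q" if "q \<in> W'" "j \<in> {1..6}" "Y \<in> vf" for q j Y
    using e(5)[of q "F j" Y] F(3) F(4)[OF that(2)] F(5)[OF that(1,2)] that
    by (subst e(5)) (auto simp: if_distrib[of "\<lambda>x. x * _"] cong: if_cong)
  have dual: "e j [E i] q = (if i = j then 1 else 0)" if q: "q \<in> W'" and ij: "i \<in> {1..6}" "j \<in> {1..6}" for q i j
  proof (cases "even i")
    case False
    then show ?thesis using F(5) that by (simp add: E_def)
  next
    case True
    then have i: "i \<in> {2, 4, 6}" using ij(1) by (auto simp: six)
    have "e j [E i] q = g [F j, J (F (i - 1))] q"
      using ei[OF q ij(2) E[OF ij(1)]] True by (simp add: E_def)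
    also have "\<dots> = (if i = j then 1 else 0)"
      using i ij(2) F(3,4) q by (subst e(6)) (auto simp: wedge_2 F(5) six)
    finally show ?thesis .
  qed
  have "g [E i, E j] q = (if i = j then 1 else 0)" if q: "q \<in> W'" and ij: "i \<in> {1..6}" "j \<in> {1..6}" for q i j
    using e(5)[of q "E i" "E j"] F(3) E ij dual[OF q ij(1)] dual[OF q ij(2)] q
    by (auto simp: if_distrib[of "\<lambda>x. x * _"] cong: if_cong)
  then have "unitary_frame W' E"
    using F(1) E by (auto simp: unitary_frame_def positive_basis_at_def orthonormal_at_def E_def)
  moreover have "\<Psi> [E 1, E 3, E 5] p = - 1"
    using e(7)[of p "E 1" "E 3" "E 5"] e(2) E F(2)
    by (simp add: wedge_3 dual complex_eq_iff)
  ultimately show ?thesis using that F(2) by blast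
qed

lemma unitary_frameD:
  assumes "unitary_frame W E"
  shows "q \<in> W \<Longrightarrow> orthonormal_at A g q E" and "open W"
    and "q \<in> W \<Longrightarrow> i \<in> {1..6} \<Longrightarrow> E i \<in> vf"
    and "q \<in> W \<Longrightarrow> E 2 = J (E 1)" "q \<in> W \<Longrightarrow> E 4 = J (E 3)" "q \<in> W \<Longrightarrow> E 6 = J (E 5)"
    and "q \<in> W \<Longrightarrow> i \<in> {1..6} \<Longrightarrow> j \<in> {1..6} \<Longrightarrow> g [E i, E j] q = (if i = j then 1 else 0)"
proof -
  show "q \<in> W \<Longrightarrow> orthonormal_at A g q E" "open W"
    using assms by (auto simp: unitary_frame_def positive_basis_at_def)
  then show "q \<in> W \<Longrightarrow> i \<in> {1..6} \<Longrightarrow> E i \<in> vf"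
    "q \<in> W \<Longrightarrow> i \<in> {1..6} \<Longrightarrow> j \<in> {1..6} \<Longrightarrow> g [E i, E j] q = (if i = j then 1 else 0)"
    using orthonormal_atD by blast+
  have "i \<in> {1, 3, 5} \<Longrightarrow> q \<in> W \<Longrightarrow> E (i + 1) = J (E i)" for i
    using assms unfolding unitary_frame_def positive_basis_at_def by blast
  from this[of 1] this[of 3] this[of 5]
  show "q \<in> W \<Longrightarrow> E 2 = J (E 1)" "q \<in> W \<Longrightarrow> E 4 = J (E 3)" "q \<in> W \<Longrightarrow> E 6 = J (E 5)"
    by (auto simp: numeral_eq_Suc)
qed

text \<open>Near \<open>p\<close> every field is a combination of a local frame with smooth coefficients. Multiplying by a bump function
  gives an identity between global fields, to which function-linearity applies. A basis that is only orthonormal at \<open>p\<close>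
  is reduced to this case, because what remains after subtracting the Fourier sum is orthogonal to the frame.\<close>

lemma covector_expand:
  assumes h: "covector_at A p h" and E: "orthonormal_at A g p E" and X: "X \<in> vf"
  shows "h X = (\<Sum>i=1..6. g [X, E i] p * h (E i))"
proof -
  obtain W F where F: "p \<in> W" "unitary_frame W F" by (rule unitary_frame_exists[of p])
  note F1 = unitary_frameD[OF F(2)]
  note Fvf = F1(3)[OF F(1)]
  obtain \<beta> K where \<beta>: "smooth_fun A \<beta>" "\<beta> p = 1" "K \<subseteq> W" "\<And>q. q \<notin> K \<Longrightarrow> \<beta> q = 0"
    using bump_exists[OF F1(2) F(1)] by metis
  have exF: "h Y = (\<Sum>i=1..6. g [Y, F i] p * h (F i))" if Y: "Y \<in> vf" for Y
  proof -
    have "\<beta> \<cdot>\<^sub>v Y = (\<Sum>i=1..6. (\<beta> * g [Y, F i]) \<cdot>\<^sub>v F i)"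
    proof (intro ext)
      fix f q
      show "(\<beta> \<cdot>\<^sub>v Y) f q = (\<Sum>i=1..6. (\<beta> * g [Y, F i]) \<cdot>\<^sub>v F i) f q"
      proof (cases "q \<in> W")
        case True
        show ?thesis
          using orthonormal_complete(1)[OF F1(1)[OF True] Y, of f]
          by (simp add: lincomb_apply) (simp add: fscale_def sum_distrib_left mult.assoc)
      next
        case False
        then have "\<beta> q = 0" using \<beta> by blast
        then show ?thesis by (simp add: lincomb_apply) (simp add: fscale_def)
      qed
    qed
    then have "h (\<beta> \<cdot>\<^sub>v Y) = h (\<Sum>i=1..6. (\<beta> * g [Y, F i]) \<cdot>\<^sub>v F i)" by simp
    also have "\<dots> = (\<Sum>i=1..6. g [Y, F i] p * h (F i))"
      using Y Fvf \<beta> by (subst covector_lincomb[OF h]) auto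
    finally show ?thesis using covector_atD(2)[OF h Y \<beta>(1)] \<beta>(2) by simp
  qed
  note Evf = orthonormal_atD(1)[OF E]
  have S: "(\<Sum>i=1..6. (\<lambda>_. g [X, E i] p) \<cdot>\<^sub>v E i) \<in> vf"
    using Evf by (intro vfields_sum vfields_scale) auto
  define Y where "Y = X - (\<Sum>i=1..6. (\<lambda>_. g [X, E i] p) \<cdot>\<^sub>v E i)"
  have "g [Y, F j] p = 0" if j: "j \<in> {1..6}" for j
    unfolding Y_def covector_diff[OF g_covector1[OF Fvf[OF j]] X S] orthonormal_complete(2)[OF E X Fvf[OF j]]
    by (subst covector_lincomb[OF g_covector1[OF Fvf[OF j]]]) (use Evf in auto)
  moreover have Y: "Y \<in> vf" unfolding Y_def using X S by auto
  ultimately have "h Y = 0" using exF[OF Y] by simp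
  then show ?thesis
    unfolding Y_def covector_diff[OF h X S]
    by (subst (asm) covector_lincomb[OF h]) (use Evf in auto)
qed

lemma trace_indep:
  assumes h: "\<And>Y. Y \<in> vf \<Longrightarrow> covector_at A p (\<lambda>X. h X Y)"
      "\<And>X. X \<in> vf \<Longrightarrow> covector_at A p (h X)"
    and E: "orthonormal_at A g p E" and F: "orthonormal_at A g p F"
  shows "(\<Sum>i=1..6. h (F i) (F i)) = (\<Sum>i=1..6. h (E i) (E i))"
proof -
  note Evf = orthonormal_atD(1)[OF E] and Fvf = orthonormal_atD(1)[OF F]
  have "(\<Sum>i=1..6. h (F i) (F i)) = (\<Sum>i=1..6. \<Sum>j=1..6. \<Sum>k=1..6. (g [E j, F i] p * g [F i, E k] p) * h (E j) (E k))"
  proof (rule sum.cong[OF refl])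
    fix i :: nat assume i: "i \<in> {1..6}"
    have "h (F i) (F i) = (\<Sum>j=1..6. g [F i, E j] p * h (E j) (F i))"
      by (rule covector_expand[OF h(1) E Fvf]) (use i Fvf in auto)
    also have "\<dots> = (\<Sum>j=1..6. g [F i, E j] p * (\<Sum>k=1..6. g [F i, E k] p * h (E j) (E k)))"
      using Evf Fvf i covector_expand[OF h(2) E] by (intro sum.cong) auto
    finally show "h (F i) (F i) = (\<Sum>j=1..6. \<Sum>k=1..6. (g [E j, F i] p * g [F i, E k] p) * h (E j) (E k))"
      using g_sym[OF Fvf[OF i] Evf] by (simp add: sum_distrib_left mult.assoc)
  qed
  also have "\<dots> = (\<Sum>j=1..6. \<Sum>k=1..6. (\<Sum>i=1..6. g [E j, F i] p * g [F i, E k] p) * h (E j) (E k))"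
    by (subst sum.swap, rule sum.cong[OF refl], subst sum.swap) (simp add: sum_distrib_right)
  also have "\<dots> = (\<Sum>j=1..6. \<Sum>k=1..6. g [E j, E k] p * h (E j) (E k))"
    using orthonormal_complete(2)[OF F] Evf by (intro sum.cong) auto
  also have "\<dots> = (\<Sum>j=1..6. h (E j) (E j))"
    using orthonormal_atD(2)[OF E] by (intro sum.cong) (auto simp: if_distrib[of "\<lambda>x. x * _"] cong: if_cong)
  finally show ?thesis .
qed

end

section \<open>Connections with skew-symmetric torsion\<close>

context smooth_mfd
begin

lemma vf_const:
  assumes "X \<in> vf" shows "X (\<lambda>_. c) = 0"
proof -
  have sm: "smooth_fun A 1" by (simp add: one_fun_def)
  have "X 1 q = 0" for q
    using fun_cong[OF vf_mult[OF assms sm sm], of q] by simp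
  moreover have "(\<lambda>_. c) = (\<lambda>_. c) * (1 :: 'a \<Rightarrow> real)" by (simp add: fun_eq_iff)
  ultimately show ?thesis
    using vf_cmult[OF assms sm, of c] by (simp add: fun_eq_iff)
qed

lemma bracket_add1: "X \<in> vf \<Longrightarrow> Y \<in> vf \<Longrightarrow> Z \<in> vf \<Longrightarrow>
    lie_bracket (X + Y) Z = lie_bracket X Z + lie_bracket Y Z"
proof
  fix f assume *: "X \<in> vf" "Y \<in> vf" "Z \<in> vf"
  show "lie_bracket (X + Y) Z f = (lie_bracket X Z + lie_bracket Y Z) f"
  proof (cases "smooth_fun A f")
    case True
    then show ?thesis using * by (simp add: lie_bracket_def vf_add[OF *(3)])
  next
    case False
    then show ?thesis using vf_nonsmooth[OF *(1)] vf_nonsmooth[OF *(2)] vf_nonsmooth[OF *(3)] vf_zero[OF *(3)]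
        vf_zero[OF *(1)] vf_zero[OF *(2)] by (simp add: lie_bracket_def)
  qed
qed

lemma bracket_anti: "lie_bracket Y X = - lie_bracket X Y"
  by (auto simp: lie_bracket_def fun_eq_iff)

lemma bracket_minus1:
  assumes "X \<in> vf" "Z \<in> vf" shows "lie_bracket (- X) Z = - lie_bracket X Z"
  using bracket_add1[of X "- X" Z] assms vf_zero[OF assms(2)]
  by (simp add: eq_neg_iff_add_eq_0 add.commute) (simp add: lie_bracket_def zero_fun_def)

lemma bracket_diff1: "X \<in> vf \<Longrightarrow> Y \<in> vf \<Longrightarrow> Z \<in> vf \<Longrightarrow>
    lie_bracket (X - Y) Z = lie_bracket X Z - lie_bracket Y Z"
  using bracket_add1[of X "- Y" Z] bracket_minus1[of Y Z] by simp

lemma jacobi: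
  assumes X: "X \<in> vf" and Y: "Y \<in> vf" and Z: "Z \<in> vf"
  shows "lie_bracket (lie_bracket X Y) Z + lie_bracket (lie_bracket Y Z) X + lie_bracket (lie_bracket Z X) Y = 0"
proof
  fix f
  show "(lie_bracket (lie_bracket X Y) Z + lie_bracket (lie_bracket Y Z) X + lie_bracket (lie_bracket Z X) Y) f = 0 f"
  proof (cases "smooth_fun A f")
    case True
    then show ?thesis using assms
      by (simp add: lie_bracket_def vf_diff[OF X] vf_diff[OF Y] vf_diff[OF Z])
  next
    case False
    then show ?thesis
      using vf_nonsmooth[OF X] vf_nonsmooth[OF Y] vf_nonsmooth[OF Z] vf_zero[OF X] vf_zero[OF Y] vf_zero[OF Z]
      by (simp add: lie_bracket_def)
  qed
qed

end

locale acyt = su3_mfd A g J \<Psi>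
  for A :: "('a::{t2_space, second_countable_topology}) chart set"
    and g :: "('a, real) ctensor"
    and J :: "'a vfield \<Rightarrow> 'a vfield"
    and \<Psi> :: "('a, complex) ctensor" +
  fixes D :: "'a connection"
  assumes torsion_conn: "torsion_connection A g J \<Psi> D"
begin

lemma D_vf [simp, intro]: "X \<in> vf \<Longrightarrow> Y \<in> vf \<Longrightarrow> D X Y \<in> vf"
  using torsion_conn unfolding torsion_connection_def linear_connection_def by blast

lemma D_rules:
  assumes "X \<in> vf" "Y \<in> vf" "Z \<in> vf" "smooth_fun A f"
  shows "D (X + Y) Z = D X Z + D Y Z \<and> D (f \<cdot>\<^sub>v X) Z = f \<cdot>\<^sub>v D X Z \<and>
        D X (Y + Z) = D X Y + D X Z \<and> D X (f \<cdot>\<^sub>v Y) = X f \<cdot>\<^sub>v Y + f \<cdot>\<^sub>v D X Y"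
  using torsion_conn assms unfolding torsion_connection_def linear_connection_def by blast

lemma
  assumes "X \<in> vf" "Y \<in> vf"
  shows D_add1: "Z \<in> vf \<Longrightarrow> D (X + Y) Z = D X Z + D Y Z"
    and D_scale1: "smooth_fun A f \<Longrightarrow> D (f \<cdot>\<^sub>v X) Y = f \<cdot>\<^sub>v D X Y"
    and D_add2: "Z \<in> vf \<Longrightarrow> D X (Y + Z) = D X Y + D X Z"
    and D_scale2: "smooth_fun A f \<Longrightarrow> D X (f \<cdot>\<^sub>v Y) = X f \<cdot>\<^sub>v Y + f \<cdot>\<^sub>v D X Y"
  using D_rules[OF assms, of Z 0] D_rules[OF assms(1) assms(2) assms(2), of f] by auto

lemma D_minus1: "X \<in> vf \<Longrightarrow> Y \<in> vf \<Longrightarrow> D (- X) Y = - D X Y"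
  using D_scale1[of X Y "\<lambda>_. -1"] by (simp add: minus_eq_fscale)

lemma D_minus2: "X \<in> vf \<Longrightarrow> Y \<in> vf \<Longrightarrow> D X (- Y) = - D X Y"
  using D_scale2[of X Y "\<lambda>_. -1"] vf_const[of X "-1"] by (simp add: minus_eq_fscale) (simp add: fscale_def fun_eq_iff)

lemma D_diff1: "X \<in> vf \<Longrightarrow> Y \<in> vf \<Longrightarrow> Z \<in> vf \<Longrightarrow> D (X - Y) Z = D X Z - D Y Z"
  using D_add1[of X "- Y" Z] D_minus1[of Y Z] by simp

lemma D_diff2: "X \<in> vf \<Longrightarrow> Y \<in> vf \<Longrightarrow> Z \<in> vf \<Longrightarrow> D X (Y - Z) = D X Y - D X Z"
  using D_add2[of X Y "- Z"] D_minus2[of X Z] by simp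

lemma D_J:
  assumes "X \<in> vf" "Y \<in> vf" shows "D X (J Y) = J (D X Y)"
proof -
  have "D X (J Y) - J (D X Y) = 0"
    using torsion_conn assms unfolding torsion_connection_def by blast
  then show ?thesis by simp
qed

lemma D_g:
  assumes "X \<in> vf" "Y \<in> vf" "Z \<in> vf"
  shows "X (g [Y, Z]) = g [D X Y, Z] + g [Y, D X Z]"
proof -
  have "cov_deriv D X g [Y, Z] = 0"
    using torsion_conn assms unfolding torsion_connection_def parallel_def by simp
  then show ?thesis by (simp add: cov_deriv_def lessThan_Suc eval_nat_numeral algebra_simps)
qed

lemma D_form3:
  assumes "parallel A D 3 \<alpha>" "X \<in> vf" "Y \<in> vf" "Z \<in> vf" "V \<in> vf"
  shows "X (\<alpha> [Y, Z, V]) = \<alpha> [D X Y, Z, V] + \<alpha> [Y, D X Z, V] + \<alpha> [Y, Z, D X V]"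
proof -
  have "cov_deriv D X \<alpha> [Y, Z, V] = 0"
    using assms unfolding parallel_def by simp
  then show ?thesis by (simp add: cov_deriv_def lessThan_Suc eval_nat_numeral algebra_simps)
qed

subsection \<open>Torsion and curvature\<close>

definition tor :: "'a vfield \<Rightarrow> 'a vfield \<Rightarrow> 'a vfield" where
  "tor X Y = D X Y - D Y X - lie_bracket X Y"

definition Rv :: "'a vfield \<Rightarrow> 'a vfield \<Rightarrow> 'a vfield \<Rightarrow> 'a vfield" where
  "Rv X Y Z = D X (D Y Z) - D Y (D X Z) - D (lie_bracket X Y) Z"

abbreviation T :: "'a vfield \<Rightarrow> 'a vfield \<Rightarrow> 'a vfield \<Rightarrow> 'a \<Rightarrow> real" where
  "T X Y Z \<equiv> torsion g D [X, Y, Z]"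

abbreviation R :: "'a vfield \<Rightarrow> 'a vfield \<Rightarrow> 'a vfield \<Rightarrow> 'a vfield \<Rightarrow> 'a \<Rightarrow> real" where
  "R X Y Z V \<equiv> curvature g D [X, Y, Z, V]"

abbreviation B :: "'a vfield \<Rightarrow> 'a vfield \<Rightarrow> 'a vfield \<Rightarrow> 'a vfield \<Rightarrow> 'a \<Rightarrow> real" where
  "B X Y Z V \<equiv> cov_deriv D X (torsion g D) [Y, Z, V]"

lemma tor_vf [simp, intro]: "X \<in> vf \<Longrightarrow> Y \<in> vf \<Longrightarrow> tor X Y \<in> vf"
  by (simp add: tor_def)

lemma Rv_vf [simp, intro]: "X \<in> vf \<Longrightarrow> Y \<in> vf \<Longrightarrow> Z \<in> vf \<Longrightarrow> Rv X Y Z \<in> vf"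
  by (simp add: Rv_def)

lemma T_eq: "T X Y Z = g [tor X Y, Z]"
  by (simp add: torsion_def tor_def)

lemma R_eq: "R X Y Z V = g [Rv X Y Z, V]"
  by (simp add: curvature_def Rv_def)

lemma B_eq: "B X Y Z V = X (T Y Z V) - T (D X Y) Z V - T Y (D X Z) V - T Y Z (D X V)"
  by (simp add: cov_deriv_def lessThan_Suc eval_nat_numeral algebra_simps)

lemma T_kform: "k_form A 3 (torsion g D)"
  using torsion_conn unfolding torsion_connection_def by blast

lemma T_tensor: "tensor_on A UNIV 3 (torsion g D)"
  using T_kform unfolding k_form_def by blast

lemma T_smooth [simp, intro]:
  "X \<in> vf \<Longrightarrow> Y \<in> vf \<Longrightarrow> Z \<in> vf \<Longrightarrow> smooth_fun A (T X Y Z)"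
  using tensor_onD(1)[OF T_tensor, of "[X, Y, Z]"] by simp

lemma k_form3_skew:
  assumes "k_form A 3 \<alpha>" "X \<in> vf" "Y \<in> vf" "Z \<in> vf"
  shows "\<alpha> [Y, X, Z] = - \<alpha> [X, Y, Z]" "\<alpha> [X, Z, Y] = - \<alpha> [X, Y, Z]"
proof -
  have *: "\<alpha> ([X, Y, Z][i := [X, Y, Z] ! j, j := [X, Y, Z] ! i]) = - \<alpha> [X, Y, Z]"
    if "i < 3" "j < 3" "i \<noteq> j" for i j
    using assms(1)[unfolded k_form_def, THEN conjunct2, THEN spec[of _ "[X, Y, Z]"], THEN spec[of _ i], THEN spec[of _ j]]
      assms(2-4) that by simp
  show "\<alpha> [Y, X, Z] = - \<alpha> [X, Y, Z]" using *[of 0 1] by simp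
  show "\<alpha> [X, Z, Y] = - \<alpha> [X, Y, Z]" using *[of 1 2] by (simp add: numeral_2_eq_2)
qed

lemmas T_skew = k_form3_skew[OF T_kform]

lemma T_covector:
  assumes "X \<in> vf" "Y \<in> vf"
  shows "covector_at A p (\<lambda>Z. T Z X Y p)" "covector_at A p (\<lambda>Z. T X Z Y p)" "covector_at A p (\<lambda>Z. T X Y Z p)"
proof -
  have *: "covector_at A p (\<lambda>Z. torsion g D ([X1, X2, X3][i := Z]) p)"
    if "X1 \<in> vf" "X2 \<in> vf" "X3 \<in> vf" "i < 3" for i X1 X2 X3
    using tensor_covector[OF T_tensor, of "[X1, X2, X3]" i p] that by simp
  show "covector_at A p (\<lambda>Z. T Z X Y p)" "covector_at A p (\<lambda>Z. T X Z Y p)" "covector_at A p (\<lambda>Z. T X Y Z p)"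
    using *[of 0 X Y 0] *[of X 0 Y 1] *[of X Y 0 2] assms by (simp_all add: numeral_2_eq_2)
qed

lemma
  assumes "X \<in> vf" "Y \<in> vf" "Z \<in> vf" "V \<in> vf"
  shows T_add: "T (X + Y) Z V = T X Z V + T Y Z V" "T Z (X + Y) V = T Z X V + T Z Y V" "T Z V (X + Y) = T Z V X + T Z V Y"
    and T_diff: "T (X - Y) Z V = T X Z V - T Y Z V" "T Z (X - Y) V = T Z X V - T Z Y V" "T Z V (X - Y) = T Z V X - T Z V Y"
    and g_add: "g [X + Y, Z] = g [X, Z] + g [Y, Z]" "g [Z, X + Y] = g [Z, X] + g [Z, Y]"
    and g_diff: "g [X - Y, Z] = g [X, Z] - g [Y, Z]" "g [Z, X - Y] = g [Z, X] - g [Z, Y]"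
  using T_covector[OF assms(3,4), THEN covector_atD(1), OF assms(1,2)]
    T_covector[OF assms(3,4), THEN covector_diff, OF assms(1,2)]
    g_covector1[OF assms(3), THEN covector_atD(1), OF assms(1,2)] g_covector2[OF assms(3), THEN covector_atD(1), OF assms(1,2)]
    g_covector1[OF assms(3), THEN covector_diff, OF assms(1,2)] g_covector2[OF assms(3), THEN covector_diff, OF assms(1,2)]
  by (auto simp: fun_eq_iff)

lemma
  assumes "X \<in> vf" "Y \<in> vf" "Z \<in> vf" "smooth_fun A f"
  shows T_scale: "T (f \<cdot>\<^sub>v X) Y Z = f * T X Y Z" "T Y (f \<cdot>\<^sub>v X) Z = f * T Y X Z" "T Y Z (f \<cdot>\<^sub>v X) = f * T Y Z X"
    and g_scale: "g [f \<cdot>\<^sub>v X, Y] = f * g [X, Y]" "g [Y, f \<cdot>\<^sub>v X] = f * g [Y, X]"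
  using T_covector[OF assms(2,3), THEN covector_atD(2), OF assms(1,4)]
    g_covector1[OF assms(2), THEN covector_atD(2), OF assms(1,4)] g_covector2[OF assms(2), THEN covector_atD(2), OF assms(1,4)]
  by (auto simp: fun_eq_iff)

lemma T_minus:
  assumes "X \<in> vf" "Y \<in> vf" "Z \<in> vf"
  shows "T (- X) Y Z = - T X Y Z" "T Y (- X) Z = - T Y X Z" "T Y Z (- X) = - T Y Z X"
  using T_covector[OF assms(2,3), THEN covector_minus, OF assms(1)] by (auto simp: fun_eq_iff)

lemma g_minus:
  assumes "X \<in> vf" "Y \<in> vf"
  shows "g [- X, Y] = - g [X, Y]" "g [Y, - X] = - g [Y, X]"
  using g_covector1[OF assms(2), THEN covector_minus, OF assms(1)] g_covector2[OF assms(2), THEN covector_minus, OF assms(1)]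
  by (auto simp: fun_eq_iff)

lemma T_cyc: "X \<in> vf \<Longrightarrow> Y \<in> vf \<Longrightarrow> Z \<in> vf \<Longrightarrow> T X Y Z = T Y Z X"
  using T_skew(1)[of Y X Z] T_skew(2)[of Y Z X] by simp

lemma B_smooth [simp, intro]:
  "X \<in> vf \<Longrightarrow> Y \<in> vf \<Longrightarrow> Z \<in> vf \<Longrightarrow> V \<in> vf \<Longrightarrow> smooth_fun A (B X Y Z V)"
  by (simp add: B_eq)

lemma B_skew:
  assumes "X \<in> vf" "Y \<in> vf" "Z \<in> vf" "V \<in> vf"
  shows "B X Z Y V = - B X Y Z V" "B X Y V Z = - B X Y Z V"
proof -
  show "B X Z Y V = - B X Y Z V"
    using assms vf_minus[OF assms(1)] T_skew(1)[of Y Z V] T_skew(1)[of "D X Y" Z V]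
      T_skew(1)[of Y "D X Z" V] T_skew(1)[of Y Z "D X V"] by (simp add: B_eq)
  show "B X Y V Z = - B X Y Z V"
    using assms vf_minus[OF assms(1)] T_skew(2)[of Y Z V] T_skew(2)[of "D X Y" Z V]
      T_skew(2)[of Y "D X Z" V] T_skew(2)[of Y Z "D X V"] by (simp add: B_eq)
qed

lemma B_covector1:
  assumes "Y \<in> vf" "Z \<in> vf" "V \<in> vf"
  shows "covector_at A p (\<lambda>X. B X Y Z V p)"
  unfolding covector_at_def
proof (intro conjI ballI allI impI)
  fix X W assume "X \<in> vf" "W \<in> vf"
  with assms show "B (X + W) Y Z V p = B X Y Z V p + B W Y Z V p"
    by (simp add: B_eq D_add1 T_add)
next
  fix X f assume "X \<in> vf" "smooth_fun A f"
  with assms show "B (f \<cdot>\<^sub>v X) Y Z V p = f p * B X Y Z V p"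
    by (simp add: B_eq D_scale1 T_scale) (simp add: fscale_def algebra_simps)
qed

lemma B_covector2:
  assumes "X \<in> vf" "Z \<in> vf" "V \<in> vf"
  shows "covector_at A p (\<lambda>Y. B X Y Z V p)"
  unfolding covector_at_def
proof (intro conjI ballI allI impI)
  fix Y W assume "Y \<in> vf" "W \<in> vf"
  with assms show "B X (Y + W) Z V p = B X Y Z V p + B X W Z V p"
    by (simp add: B_eq D_add2 T_add vf_add[OF assms(1)])
next
  fix Y f assume "Y \<in> vf" "smooth_fun A f"
  with assms show "B X (f \<cdot>\<^sub>v Y) Z V p = f p * B X Y Z V p"
    by (simp add: B_eq D_scale2 T_add T_scale vf_mult[OF assms(1)]) (simp add: algebra_simps)
qed

lemma B_covector3:
  assumes "X \<in> vf" "Y \<in> vf" "V \<in> vf"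
  shows "covector_at A p (\<lambda>Z. B X Y Z V p)"
proof -
  have *: "B X Y Z V p = - B X Z Y V p" if "Z \<in> vf" for Z
    using B_skew(1)[OF assms(1,2) that assms(3)] by simp
  show ?thesis
    using B_covector2[OF assms, of p] by (simp add: covector_at_def *)
qed

lemma B_covector4:
  assumes "X \<in> vf" "Y \<in> vf" "Z \<in> vf"
  shows "covector_at A p (\<lambda>V. B X Y Z V p)"
proof -
  have *: "B X Y Z V p = - B X Y V Z p" if "V \<in> vf" for V
    using B_skew(2)[OF assms that] by simp
  show ?thesis
    using B_covector3[OF assms, of p] by (simp add: covector_at_def *)
qed

lemma Rv_skew: "X \<in> vf \<Longrightarrow> Y \<in> vf \<Longrightarrow> Z \<in> vf \<Longrightarrow> Rv Y X Z = - Rv X Y Z"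
  using D_minus1[of "lie_bracket X Y" Z] by (simp add: Rv_def bracket_anti[of Y X])

lemma R_skew12: "X \<in> vf \<Longrightarrow> Y \<in> vf \<Longrightarrow> Z \<in> vf \<Longrightarrow> V \<in> vf \<Longrightarrow> R Y X Z V = - R X Y Z V"
  using g_minus(1)[of "Rv X Y Z" V] by (simp add: R_eq Rv_skew[of X Y Z])

text \<open>The commutator of derivations applied to \<open>g(Z,V)\<close> vanishes, and metric compatibility rewrites it as the
  action of the curvature on \<open>Z\<close> and \<open>V\<close>.\<close>

lemma R_skew34:
  assumes "X \<in> vf" "Y \<in> vf" "Z \<in> vf" "V \<in> vf"
  shows "R X Y V Z = - R X Y Z V"
proof -
  have "X (Y (g [Z, V])) - Y (X (g [Z, V])) - lie_bracket X Y (g [Z, V]) = R X Y Z V + g [Z, Rv X Y V]"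
    using assms by (simp add: D_g[OF assms(1)] D_g[OF assms(2)] D_g[OF vfields_bracket[OF assms(1,2)]] R_eq Rv_def g_diff vf_add[OF assms(1)] vf_add[OF assms(2)])
  then have "R X Y Z V + g [Z, Rv X Y V] = 0" by (simp add: lie_bracket_def)
  then show ?thesis
    using assms g_sym[of Z "Rv X Y V"] by (simp add: R_eq add_eq_0_iff)
qed

lemma Rv_J: "X \<in> vf \<Longrightarrow> Y \<in> vf \<Longrightarrow> Z \<in> vf \<Longrightarrow> Rv X Y (J Z) = J (Rv X Y Z)"
  by (simp add: Rv_def D_J J_diff)

lemma R_J34: "X \<in> vf \<Longrightarrow> Y \<in> vf \<Longrightarrow> Z \<in> vf \<Longrightarrow> V \<in> vf \<Longrightarrow>
    R X Y (J Z) V = - R X Y Z (J V)"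
  by (simp add: R_eq Rv_J g_J_skew)

lemma R_covector3:
  assumes "X \<in> vf" "Y \<in> vf" "V \<in> vf"
  shows "covector_at A p (\<lambda>Z. R X Y Z V p)"
  unfolding covector_at_def
proof (intro conjI ballI allI impI)
  fix Z W assume "Z \<in> vf" "W \<in> vf"
  with assms show "R X Y (Z + W) V p = R X Y Z V p + R X Y W V p"
    by (simp add: R_eq Rv_def D_add2 g_diff g_add)
next
  fix Z f assume "Z \<in> vf" "smooth_fun A f"
  with assms show "R X Y (f \<cdot>\<^sub>v Z) V p = f p * R X Y Z V p"
    by (simp add: R_eq Rv_def D_scale2 D_add2 g_diff g_add g_scale g_minus) (simp add: lie_bracket_def algebra_simps)
qed

lemma R_covector4:
  assumes "X \<in> vf" "Y \<in> vf" "Z \<in> vf"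
  shows "covector_at A p (\<lambda>V. R X Y Z V p)"
  using g_covector2[of "Rv X Y Z" p] assms by (simp add: R_eq)

lemma R_minus1:
  assumes "X \<in> vf" "Y \<in> vf" "Z \<in> vf" "V \<in> vf"
  shows "R (- X) Y Z V = - R X Y Z V"
proof -
  have "Rv (- X) Y Z = - Rv X Y Z"
    using assms by (simp add: Rv_def D_minus1 D_minus2 bracket_minus1)
  then show ?thesis using g_minus(1)[of "Rv X Y Z" V] assms by (simp add: R_eq)
qed

lemma tor_diff1: "X \<in> vf \<Longrightarrow> Y \<in> vf \<Longrightarrow> Z \<in> vf \<Longrightarrow> tor (X - Y) Z = tor X Z - tor Y Z"
  by (simp add: tor_def D_diff1 D_diff2 bracket_diff1)

lemma tor_anti: "tor Y X = - tor X Y"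
  by (simp add: tor_def bracket_anti[of Y X])

text \<open>The first Bianchi identity for a connection with torsion. After expanding the torsion, the terms without
  curvature cancel by the Jacobi identity.\<close>

lemma bianchi_vector:
  assumes "X \<in> vf" "Y \<in> vf" "Z \<in> vf"
  defines "DT \<equiv> \<lambda>X Y Z. D X (tor Y Z) - tor (D X Y) Z - tor Y (D X Z)"
  shows "Rv X Y Z + Rv Y Z X + Rv Z X Y =
    DT X Y Z + DT Y Z X + DT Z X Y + (tor (tor X Y) Z + tor (tor Y Z) X + tor (tor Z X) Y)"
proof -
  have t: "tor (tor X Y) Z = tor (D X Y) Z - tor (D Y X) Z - tor (lie_bracket X Y) Z"
    if "X \<in> vf" "Y \<in> vf" "Z \<in> vf" for X Y Z
    unfolding tor_def[of X Y] using that by (simp add: tor_diff1)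
  have u: "tor (lie_bracket X Y) Z = D (lie_bracket X Y) Z - D Z (lie_bracket X Y) - lie_bracket (lie_bracket X Y) Z"
    for X Y Z by (simp add: tor_def)
  have v: "D X (tor Y Z) = D X (D Y Z) - D X (D Z Y) - D X (lie_bracket Y Z)"
    if "X \<in> vf" "Y \<in> vf" "Z \<in> vf" for X Y Z
    using that by (simp add: tor_def D_diff2)
  note j = jacobi[OF assms(1-3)]
  show ?thesis
    unfolding DT_def t[OF assms(1-3)] t[OF assms(2,3,1)] t[OF assms(3,1,2)] u
      v[OF assms(1-3)] v[OF assms(2,3,1)] v[OF assms(3,1,2)] Rv_def
      tor_anti[of Y "D X Z"] tor_anti[of Z "D Y X"] tor_anti[of X "D Z Y"]
    using j by (simp add: algebra_simps)
qed

lemma B_eq_g: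
  assumes "X \<in> vf" "Y \<in> vf" "Z \<in> vf" "V \<in> vf"
  shows "B X Y Z V = g [D X (tor Y Z) - tor (D X Y) Z - tor Y (D X Z), V]"
  using assms by (simp add: B_eq T_eq D_g[OF assms(1)] g_diff)

lemma bianchi:
  assumes "X \<in> vf" "Y \<in> vf" "Z \<in> vf" "V \<in> vf"
  shows "R X Y Z V + R Y Z X V + R Z X Y V = B X Y Z V + B Y Z X V + B Z X Y V
    + (T (tor X Y) Z V + T (tor Y Z) X V + T (tor Z X) Y V)"
  using arg_cong[OF bianchi_vector[OF assms(1-3)], of "\<lambda>X. g [X, V]"] assms
  by (simp add: B_eq_g R_eq T_eq g_add g_diff)

lemma T_tor_expand:
  assumes "X \<in> vf" "Y \<in> vf" "Z \<in> vf" "V \<in> vf" "orthonormal_at A g p E"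
  shows "T (tor X Y) Z V p = (\<Sum>f=1..6. T X Y (E f) p * T (E f) Z V p)"
  using covector_expand[OF T_covector(1)[OF assms(3,4)] assms(5), of "tor X Y"] assms(1,2)
  by (simp add: T_eq[of X Y])

definition C :: "'a vfield \<Rightarrow> 'a vfield \<Rightarrow> 'a vfield \<Rightarrow> 'a vfield \<Rightarrow> 'a vfield \<Rightarrow> 'a \<Rightarrow> real" where
  "C W X Y Z V = W (B X Y Z V) - B (D W X) Y Z V - B X (D W Y) Z V - B X Y (D W Z) V - B X Y Z (D W V)"

text \<open>The commutator of second covariant derivatives is the action of the curvature; the last term appears because
  the connection has torsion.\<close>

lemma ricci_identity:
  assumes X: "X \<in> vf" and Y: "Y \<in> vf" and KLM: "K \<in> vf" "L \<in> vf" "M \<in> vf"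
  shows "C X Y K L M - C Y X K L M =
    - (T (Rv X Y K) L M + T K (Rv X Y L) M + T K L (Rv X Y M)) - B (tor X Y) K L M"
proof -
  have b: "B (tor X Y) K L M = B (D X Y) K L M - B (D Y X) K L M - B (lie_bracket X Y) K L M"
    unfolding tor_def using covector_diff[OF B_covector1[OF KLM]] assms by (auto simp: fun_eq_iff)
  show ?thesis
    unfolding b C_def using assms
    by (simp add: B_eq Rv_def T_diff vf_diff[OF X] vf_diff[OF Y]) (simp add: lie_bracket_def algebra_simps)
qed

subsection \<open>Traces in a moving frame\<close>

text \<open>The derivative of an orthonormal frame is a skew matrix in terms of the frame, so it cancels in a trace.
  This is why contractions can be differentiated as if the frame were parallel.\<close>

lemma frame_rotation:
  assumes E: "unitary_frame W E" and p: "p \<in> W" and X: "X \<in> vf"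
    and h: "\<And>Y. Y \<in> vf \<Longrightarrow> covector_at A p (\<lambda>X. h X Y)"
      "\<And>X. X \<in> vf \<Longrightarrow> covector_at A p (h X)"
  shows "(\<Sum>i=1..6. h (D X (E i)) (E i) + h (E i) (D X (E i))) = 0"
proof -
  note E1 = unitary_frameD[OF E]
  note Evf = E1(3)[OF p]
  define \<omega> where "\<omega> i j = g [D X (E i), E j] p" for i j
  have skew: "\<omega> i j = - \<omega> j i" if ij: "i \<in> {1..6}" "j \<in> {1..6}" for i j
  proof -
    have "X (g [E i, E j]) p = X (\<lambda>_. if i = j then 1 else 0) p"
      by (rule vf_local[OF X _ _ E1(2) p]) (use Evf E1(7) ij in auto)
    then have "X (g [E i, E j]) p = 0" by (simp add: vf_const[OF X])
    then show ?thesis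
      using D_g[OF X Evf[OF ij(1)] Evf[OF ij(2)]] g_sym[OF Evf[OF ij(1)] D_vf[OF X Evf[OF ij(2)]]]
      by (simp add: \<omega>_def add_eq_0_iff)
  qed
  have "(\<Sum>i=1..6. h (D X (E i)) (E i)) = (\<Sum>i=1..6. \<Sum>j=1..6. \<omega> i j * h (E j) (E i))"
    unfolding \<omega>_def using Evf X by (intro sum.cong covector_expand[OF h(1) E1(1)[OF p]]) auto
  also have "\<dots> = (\<Sum>j=1..6. \<Sum>i=1..6. - \<omega> j i * h (E j) (E i))"
    by (subst sum.swap, rule sum.cong[OF refl], rule sum.cong[OF refl], subst skew) auto
  also have "\<dots> = - (\<Sum>j=1..6. h (E j) (D X (E j)))"
    unfolding \<omega>_def sum_negf[symmetric]
    by (rule sum.cong[OF refl], subst covector_expand[OF h(2) E1(1)[OF p]]) (use Evf X in \<open>auto simp: sum_negf\<close>)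
  finally show ?thesis by (simp add: sum.distrib)
qed

text \<open>The curvature annihilates the parallel form \<open>\<Psi>\<close>, and an element of \<open>u(3)\<close> acts on a form of type \<open>(3,0)\<close> as
  multiplication by its complex trace.\<close>

lemma R_trace34:
  assumes X: "X \<in> vf" and Y: "Y \<in> vf" and E: "orthonormal_at A g p E"
  shows "(\<Sum>i=1..6. R X Y (E i) (J (E i)) p) = 0"
proof -
  obtain W F where F: "p \<in> W" "unitary_frame W F" "\<Psi> [F 1, F 3, F 5] p = - 1"
    by (rule unitary_frame_exists[of p]) (rule that; assumption)
  note F1 = unitary_frameD[OF F(2)]
  note Fvf = F1(3)[OF F(1)]
  have six: "{1..6::nat} = {1, 2, 3, 4, 5, 6}" by auto
  define a where "a i j = R X Y (F i) (F j) p" for i j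
  have aux: "(\<Psi> [F 1, F 3, F 5] p) * (a 1 2 + a 3 4 + a 5 6) = 0"
  proof -
    have su: "k_form A 3 (\<lambda>ws p. Re (\<Psi> ws p))" "k_form A 3 (\<lambda>ws p. Im (\<Psi> ws p))"
      and holo: "\<And>X Y Z. X \<in> vf \<Longrightarrow> Y \<in> vf \<Longrightarrow> Z \<in> vf \<Longrightarrow> \<Psi> [J X, Y, Z] p = \<i> * \<Psi> [X, Y, Z] p"
    proof -
      show "k_form A 3 (\<lambda>ws p. Re (\<Psi> ws p))" "k_form A 3 (\<lambda>ws p. Im (\<Psi> ws p))"
        using su3 unfolding su3_structure_def by blast+
      fix X Y Z assume "X \<in> vf" "Y \<in> vf" "Z \<in> vf"
      then have "\<Psi> [X, Y, Z] p + \<i> * \<Psi> [J X, Y, Z] p = 0"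
        using su3 unfolding su3_structure_def by blast
      then have "\<i> * (\<Psi> [X, Y, Z] p + \<i> * \<Psi> [J X, Y, Z] p) = 0" by simp
      then show "\<Psi> [J X, Y, Z] p = \<i> * \<Psi> [X, Y, Z] p" by (simp add: algebra_simps)
    qed
    have par: "parallel A D 3 (\<lambda>ws p. Re (\<Psi> ws p))" "parallel A D 3 (\<lambda>ws p. Im (\<Psi> ws p))"
      using torsion_conn unfolding torsion_connection_def by blast+
    have real: "\<alpha> [Rv X Y K, L, M] p + \<alpha> [K, Rv X Y L, M] p + \<alpha> [K, L, Rv X Y M] p = 0"
      if a: "k_form A 3 \<alpha>" "parallel A D 3 \<alpha>" and KLM: "K \<in> vf" "L \<in> vf" "M \<in> vf" for \<alpha> K L M
    proof -
      have t: "tensor_on A UNIV 3 \<alpha>" using a(1) by (simp add: k_form_def)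
      have sm: "smooth_fun A (\<alpha> [U, V, W])" if "U \<in> vf" "V \<in> vf" "W \<in> vf" for U V W
        using tensor_onD(1)[OF t, of "[U, V, W]"] that by simp
      have cov: "covector_at A p (\<lambda>Z. \<alpha> ([X1, X2, X3][i := Z]) p)"
        if "X1 \<in> vf" "X2 \<in> vf" "X3 \<in> vf" "i < 3" for i X1 X2 X3
        using tensor_covector[OF t, of "[X1, X2, X3]" i p] that by simp
      have cov': "covector_at A p (\<lambda>Z. \<alpha> [Z, U, V] p)" "covector_at A p (\<lambda>Z. \<alpha> [U, Z, V] p)"
        "covector_at A p (\<lambda>Z. \<alpha> [U, V, Z] p)" if "U \<in> vf" "V \<in> vf" for U V
        using cov[of 0 U V 0] cov[of U 0 V 1] cov[of U V 0 2] that by (simp_all add: numeral_2_eq_2)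
      have "(X (Y (\<alpha> [K, L, M])) - Y (X (\<alpha> [K, L, M])) - lie_bracket X Y (\<alpha> [K, L, M])) p
        = \<alpha> [Rv X Y K, L, M] p + \<alpha> [K, Rv X Y L, M] p + \<alpha> [K, L, Rv X Y M] p"
        using X Y KLM
        by (simp add: D_form3[OF a(2) X] D_form3[OF a(2) Y] D_form3[OF a(2) vfields_bracket[OF X Y]] sm vf_add[OF X] vf_add[OF Y] Rv_def cov'[THEN covector_diff])
      then show ?thesis by (simp add: lie_bracket_def)
    qed
    have cplx: "\<Psi> [Rv X Y K, L, M] p + \<Psi> [K, Rv X Y L, M] p + \<Psi> [K, L, Rv X Y M] p = 0"
      if "K \<in> vf" "L \<in> vf" "M \<in> vf" for K L M
      using real[OF su(1) par(1) that] real[OF su(2) par(2) that] by (simp add: complex_eq_iff)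
    have sk: "\<Psi> [L, K, M] p = - \<Psi> [K, L, M] p" "\<Psi> [K, M, L] p = - \<Psi> [K, L, M] p"
      if "K \<in> vf" "L \<in> vf" "M \<in> vf" for K L M
      using k_form3_skew[OF su(1) that] k_form3_skew[OF su(2) that] by (auto simp: complex_eq_iff fun_eq_iff)
    have neg0: "x = - x \<Longrightarrow> x = 0" for x :: complex by (simp add: complex_eq_iff)
    \<comment> \<open>The two remaining legs kill every component of the curvature except the one along the \<open>J\<close>-image.\<close>
    have one: "\<Psi> [Rv X Y K, L, M] p = g [Rv X Y K, J K] p * \<i> * \<Psi> [K, L, M] p"
      if "K = F k" "L = F l" "M = F m" "(k, l, m) \<in> {(1, 3, 5), (3, 1, 5), (5, 1, 3)}" "F (k+1) = J K" "F (l+1) = J L" "F (m+1) = J M" for K L M k l m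
    proof -
      have klm: "k \<in> {1..6}" "l \<in> {1..6}" "m \<in> {1..6}" "k \<noteq> l" "l \<noteq> m" "k \<noteq> m"
        and set: "{1..6} = {k, l, m, k+1, l+1, m+1}" "distinct [k, l, m, k+1, l+1, m+1]"
        using that(4) by (auto simp: six)
      have vf: "K \<in> vf" "L \<in> vf" "M \<in> vf" using Fvf klm that by auto
      have ex: "\<alpha> [Rv X Y K, L, M] p = (\<Sum>i=1..6. g [Rv X Y K, F i] p * \<alpha> [F i, L, M] p)"
        if "k_form A 3 \<alpha>" for \<alpha>
      proof -
        have "covector_at A p (\<lambda>Z. \<alpha> [Z, L, M] p)"
          using tensor_covector[of UNIV 3 \<alpha> "[L, L, M]" 0 p] that vf by (simp add: k_form_def)
        from covector_expand[OF this F1(1)[OF F(1)]] show ?thesis using X Y vf by simp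
      qed
      have "\<Psi> [Rv X Y K, L, M] p = (\<Sum>i=1..6. of_real (g [Rv X Y K, F i] p) * \<Psi> [F i, L, M] p)"
        using ex[OF su(1)] ex[OF su(2)] by (simp add: complex_eq_iff)
      moreover have z: "\<Psi> [L, L, M] p = 0" "\<Psi> [M, L, M] p = 0"
        using neg0[OF sk(1)[OF vf(2,2,3)]] neg0[OF sk(2)[OF vf(2,3,3)]] sk(1)[OF vf(2,3,3)] by auto
      moreover have "\<Psi> [J L, L, M] p = 0" "\<Psi> [J M, L, M] p = 0"
        using z holo[OF vf(2,2,3)] holo[OF vf(3,2,3)] by auto
      moreover have "g [Rv X Y K, K] p = 0"
        using fun_cong[OF R_skew34[OF X Y vf(1,1)], of p] by (simp add: R_eq)
      ultimately show ?thesis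
        unfolding set(1) using set(2) that(1-3,5-7) holo[OF vf] by auto
    qed
    have J1: "F 2 = J (F 1)" "F 4 = J (F 3)" "F 6 = J (F 5)" using F1(4-6)[OF F(1)] .
    have v: "F 1 \<in> vf" "F 3 \<in> vf" "F 5 \<in> vf" using Fvf by auto
    have t1: "\<Psi> [Rv X Y (F 1), F 3, F 5] p = a 1 2 * \<i> * \<Psi> [F 1, F 3, F 5] p"
      using one[of "F 1" 1 "F 3" 3 "F 5" 5] J1 by (auto simp: a_def R_eq numeral_2_eq_2)
    have t2: "\<Psi> [F 1, Rv X Y (F 3), F 5] p = a 3 4 * \<i> * \<Psi> [F 1, F 3, F 5] p"
      using one[of "F 3" 3 "F 1" 1 "F 5" 5] J1 v X Y sk[of "F 1" "Rv X Y (F 3)" "F 5"] sk[of "F 1" "F 3" "F 5"]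
      by (auto simp: a_def R_eq numeral_2_eq_2)
    have t3: "\<Psi> [F 1, F 3, Rv X Y (F 5)] p = a 5 6 * \<i> * \<Psi> [F 1, F 3, F 5] p"
      using one[of "F 5" 5 "F 1" 1 "F 3" 3] J1 v X Y sk[of "F 1" "Rv X Y (F 5)" "F 3"]
        sk[of "F 1" "F 3" "Rv X Y (F 5)"] sk[of "F 1" "F 3" "F 5"] sk[of "F 1" "F 5" "F 3"]
      by (auto simp: a_def R_eq numeral_2_eq_2)
    have "\<i> * ((\<Psi> [F 1, F 3, F 5] p) * (a 1 2 + a 3 4 + a 5 6)) = 0"
      using cplx[OF v] unfolding t1 t2 t3 by (simp add: algebra_simps)
    then show ?thesis by simp
  qed
  have J1: "F 2 = J (F 1)" "F 4 = J (F 3)" "F 6 = J (F 5)" using F1(4-6)[OF F(1)] .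
  have "(\<Sum>i=1..6. R X Y (F i) (J (F i)) p) = 2 * (a 1 2 + a 3 4 + a 5 6)"
  proof -
    have *: "R X Y (J (F i)) (J (J (F i))) p = R X Y (F i) (J (F i)) p" if "i \<in> {1..6}" for i
      using R_J34[OF X Y, of "F i" "J (J (F i))"] Fvf[OF that] covector_minus[OF R_covector4[OF X Y], of "F i" "J (F i)" p]
      by (simp add: J_minus)
    show ?thesis
      using *[of 1] *[of 3] *[of 5] unfolding six by (simp add: a_def J1)
  qed
  also have "\<dots> = 0"
    using aux F(3) by (simp add: complex_eq_iff)
  finally have "(\<Sum>i=1..6. R X Y (F i) (J (F i)) p) = 0" .
  moreover have "(\<Sum>i=1..6. R X Y (E i) (J (E i)) p) = (\<Sum>i=1..6. R X Y (F i) (J (F i)) p)"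
    using trace_indep[where h = "\<lambda>U V. R X Y U (J V) p", OF _ _ F1(1)[OF F(1)] E]
      R_covector3[OF X Y] R_covector4[OF X Y, THEN J_covector] by simp
  ultimately show ?thesis by simp
qed

end

section \<open>The Lee form as a trace of the torsion\<close>

text \<open>Exchanges of neighbours generate all permutations. This reduces the sums over index lists in the Hodge star, and
  the components of a 4-form, to increasing lists.\<close>

lemma adjacent_swap_invariant:
  assumes swap: "\<And>xs x y ys. length xs + length ys + 2 = n \<Longrightarrow> f (xs @ y # x # ys) = f (xs @ x # y # ys)"
    and "mset xs = mset ys" "length xs = n"
  shows "f xs = f ys"
proof -
  have front: "f (zs @ us @ x # vs) = f (zs @ x # us @ vs)"
    if "length zs + length us + length vs + 1 = n" for zs us x vs
    using that
  proof (induction us arbitrary: vs rule: rev_induct)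
    case (snoc u us)
    have "f (zs @ (us @ [u]) @ x # vs) = f ((zs @ us) @ x # u # vs)"
      using swap[of "zs @ us" vs x u] snoc.prems by simp
    also have "\<dots> = f (zs @ x # us @ u # vs)"
      using snoc.IH[of "u # vs"] snoc.prems by simp
    finally show ?case by simp
  qed simp
  have "f (zs @ xs) = f (zs @ ys)" if "mset xs = mset ys" "length zs + length xs = n" for zs
    using that
  proof (induction xs arbitrary: zs ys)
    case (Cons x xs)
    have "x \<in> set ys" using Cons.prems(1) by (metis list.set_intros(1) mset_eq_setD)
    then obtain us vs where ys: "ys = us @ x # vs" by (meson split_list)
    have m: "mset xs = mset (us @ vs)" using Cons.prems(1) by (simp add: ys)
    have "length xs = length us + length vs" using mset_eq_length[OF m] by simp
    then have "f (zs @ ys) = f ((zs @ [x]) @ us @ vs)"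
      using front[of zs us vs x] Cons.prems(2) by (simp add: ys)
    also have "\<dots> = f ((zs @ [x]) @ xs)"
      using Cons.IH[of "us @ vs" "zs @ [x]"] m Cons.prems(2) by simp
    finally show ?case by simp
  qed simp
  from this[of "[]"] assms(2,3) show ?thesis by simp
qed

lemma wedge_adjacent_swap:
  assumes "length xs + length ys + 2 = length \<alpha>s"
  shows "wedge \<alpha>s (xs @ y # x # ys) p = - wedge \<alpha>s (xs @ x # y # ys) p"
proof -
  let ?n = "length \<alpha>s" and ?k = "length xs"
  let ?\<tau> = "Transposition.transpose ?k (Suc ?k)"
  have \<tau>: "?\<tau> permutes {..<?n}" using assms by (intro permutes_swap_id) auto
  have nth: "(xs @ y # x # ys) ! ?\<tau> m = (xs @ x # y # ys) ! m" for m
    by (auto simp: nth_append Transposition.transpose_def nth_Cons split: nat.splits)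
  have "wedge \<alpha>s (xs @ y # x # ys) p = (\<Sum>\<pi> | \<pi> permutes {..<?n}.
      of_int (sign (?\<tau> \<circ> \<pi>)) * (\<Prod>i<?n. (\<alpha>s ! i) [(xs @ y # x # ys) ! (?\<tau> \<circ> \<pi>) i] p))"
    unfolding wedge_def by (rule setum_permutations_compose_left[OF \<tau>])
  also have "\<dots> = - wedge \<alpha>s (xs @ x # y # ys) p"
    unfolding wedge_def sum_negf[symmetric]
  proof (rule sum.cong[OF refl])
    fix \<pi> assume "\<pi> \<in> {\<pi>. \<pi> permutes {..<?n}}"
    then have "permutation \<pi>" by (auto intro: permutation_permutes[THEN iffD2])
    then have "sign (?\<tau> \<circ> \<pi>) = - sign \<pi>"
      by (simp add: sign_compose permutation_swap_id sign_swap_id)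
    then show "of_int (sign (?\<tau> \<circ> \<pi>)) * (\<Prod>i<?n. (\<alpha>s ! i) [(xs @ y # x # ys) ! (?\<tau> \<circ> \<pi>) i] p)
      = - (of_int (sign \<pi>) * (\<Prod>i<?n. (\<alpha>s ! i) [(xs @ x # y # ys) ! \<pi> i] p))"
      by (simp add: nth)
  qed
  finally show ?thesis .
qed

lemma wedge_repeated:
  fixes \<alpha>s :: "('a, real) ctensor list"
  assumes "length xs + length ys + 2 = length \<alpha>s"
  shows "wedge \<alpha>s (xs @ x # x # ys) p = 0"
  using wedge_adjacent_swap[OF assms, of x x p] by simp

lemma wedge_Cons_column:
  assumes "length \<alpha>s = Suc (length ws)"
  shows "wedge \<alpha>s (x # ws) p =
    (\<Sum>i<length \<alpha>s. (-1) ^ i * (\<alpha>s ! i) [x] p * wedge (take i \<alpha>s @ drop (Suc i) \<alpha>s) ws p)"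
proof -
  let ?n = "length \<alpha>s"
  let ?M = "Matrix.mat ?n ?n (\<lambda>(i, j). (\<alpha>s ! i) [(x # ws) ! j] p)"
  have "Determinant.det ?M = (\<Sum>i<?n. ?M $$ (i, 0) * cofactor ?M i 0)"
    using assms by (intro laplace_expansion_column) auto
  also have "\<dots> = (\<Sum>i<?n. (-1) ^ i * (\<alpha>s ! i) [x] p * wedge (take i \<alpha>s @ drop (Suc i) \<alpha>s) ws p)"
  proof (rule sum.cong[OF refl])
    fix i assume i: "i \<in> {..<?n}"
    have "mat_delete ?M i 0 = Matrix.mat (length ws) (length ws) (\<lambda>(k, j). ((take i \<alpha>s @ drop (Suc i) \<alpha>s) ! k) [ws ! j] p)"
      using assms i by (intro eq_matI) (auto simp: mat_delete_def nth_append min_def)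
    moreover have "length (take i \<alpha>s @ drop (Suc i) \<alpha>s) = length ws"
      using assms i by auto
    ultimately show "?M $$ (i, 0) * cofactor ?M i 0 =
        (-1) ^ i * (\<alpha>s ! i) [x] p * wedge (take i \<alpha>s @ drop (Suc i) \<alpha>s) ws p"
      using assms i by (simp add: cofactor_def wedge_eq_det del: mat_delete_dim)
  qed
  finally show ?thesis using assms by (simp add: wedge_eq_det[of \<alpha>s ?n])
qed

lemma wedge_4:
  "wedge [\<alpha>, \<beta>, \<gamma>, \<delta>] [X, Y, Z, V] p = \<alpha> [X] p * wedge [\<beta>, \<gamma>, \<delta>] [Y, Z, V] p
    - \<alpha> [Y] p * wedge [\<beta>, \<gamma>, \<delta>] [X, Z, V] p + \<alpha> [Z] p * wedge [\<beta>, \<gamma>, \<delta>] [X, Y, V] p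
    - \<alpha> [V] p * wedge [\<beta>, \<gamma>, \<delta>] [X, Y, Z] p"
  by (subst wedge_Cons) (simp_all add: lessThan_Suc eval_nat_numeral)

definition det4 :: "(nat \<Rightarrow> real) \<Rightarrow> (nat \<Rightarrow> real) \<Rightarrow> (nat \<Rightarrow> real) \<Rightarrow> (nat \<Rightarrow> real) \<Rightarrow> nat \<Rightarrow> nat \<Rightarrow> nat \<Rightarrow> nat \<Rightarrow> real" where
  "det4 a b c d i j k l = (let e = (\<lambda>x y z. x j * (y k * z l - z k * y l) - y j * (x k * z l - z k * x l) + z j * (x k * y l - y k * x l))
    in a i * e b c d - b i * e a c d + c i * e a b d - d i * e a b c)"

text \<open>The formula \<open>*F = - 1/2 F \<and> F\<close> in components: each summand is the minor of the \<open>4 \<times> 6\<close> matrix of components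
  that omits one complex line, and the right-hand side is \<open>1/2 F \<and> F\<close>.\<close>

lemma sum_det4_eq_pfaffian:
  fixes a b c d :: "nat \<Rightarrow> real"
  defines "F \<equiv> \<lambda>x y. - (x 1 * y 2 - x 2 * y 1 + x 3 * y 4 - x 4 * y 3 + x 5 * y 6 - x 6 * (y 5 :: real))"
  shows "det4 a b c d 3 4 5 6 + det4 a b c d 1 2 5 6 + det4 a b c d 1 2 3 4 = F a b * F c d - F a c * F b d + F a d * F b c"
  unfolding det4_def F_def Let_def by (simp add: algebra_simps)

text \<open>This is \<open>d(*F)\<close> for a parallel 2-form \<open>F\<close> with \<open>*F = - 1/2 F \<and> F\<close>: \<open>t x y z\<close> stands for \<open>F\<close> evaluated on the
  torsion vector of \<open>x, y\<close> and on \<open>z\<close>.\<close>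

definition torsion_wedge :: "('b \<Rightarrow> 'b \<Rightarrow> real) \<Rightarrow> ('b \<Rightarrow> 'b \<Rightarrow> 'b \<Rightarrow> real) \<Rightarrow> 'b \<Rightarrow> 'b \<Rightarrow> 'b \<Rightarrow> 'b \<Rightarrow> 'b \<Rightarrow> real" where
  "torsion_wedge F t a b c d e =
    (let q = (\<lambda>x y u v w. t x y u * F v w - t x y v * F u w + t x y w * F u v) in
     - q a b c d e + q a c b d e - q a d b c e + q a e b c d - q b c a d e
     + q b d a c e - q b e a c d - q c d a b e + q c e a b d - q d e a b c)"

lemma torsion_wedge_swap:
  assumes F: "\<And>x y. F y x = - F x y" and t: "\<And>x y z. t y x z = - t x y z"
  shows "torsion_wedge F t b a c d e = - torsion_wedge F t a b c d e"
    "torsion_wedge F t a c b d e = - torsion_wedge F t a b c d e"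
    "torsion_wedge F t a b d c e = - torsion_wedge F t a b c d e"
    "torsion_wedge F t a b c e d = - torsion_wedge F t a b c d e"
  unfolding torsion_wedge_def Let_def
  by (simp_all add: F[of a b] F[of b c] F[of c d] F[of d e] t[of a b] t[of b c] t[of c d] t[of d e] algebra_simps)

context acyt
begin

lemma positive_basisD:
  assumes "positive_basis_at A g J q E"
  shows "orthonormal_at A g q E" "E 2 = J (E 1)" "E 4 = J (E 3)" "E 6 = J (E 5)"
proof -
  have "\<forall>i\<in>{1, 3, 5}. E (i + 1) = J (E i)" "orthonormal_at A g q E"
    using assms by (auto simp: positive_basis_at_def)
  then show "orthonormal_at A g q E" "E 2 = J (E 1)" "E 4 = J (E 3)" "E 6 = J (E 5)"
    by (auto simp: numeral_eq_Suc)
qed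

text \<open>For \<open>ks = [1, 2, 3, 4, 5, 6]\<close> this is the volume form; shorter lists are its minors.\<close>

definition frame_vol :: "(nat \<Rightarrow> 'a vfield) \<Rightarrow> nat list \<Rightarrow> 'a vfield list \<Rightarrow> 'a \<Rightarrow> real" where
  "frame_vol E ks = wedge (map (\<lambda>k w. g (E k # w)) ks)"

lemma frame_vol_column:
  assumes E: "orthonormal_at A g q E" and ks: "distinct ks" "set ks \<subseteq> {1..6}" and j: "j \<in> set ks"
    and len: "length ks = Suc (length ws)"
  shows "frame_vol E ks (E j # ws) q = (-1) ^ length (takeWhile (\<lambda>k. k \<noteq> j) ks) * frame_vol E (remove1 j ks) ws q"
proof -
  obtain us vs where uv: "ks = us @ j # vs" "j \<notin> set us" "j \<notin> set vs"
    using ks(1) j by (auto simp: in_set_conv_decomp)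
  let ?\<alpha> = "\<lambda>k w. g (E k # w)"
  have d: "g [E (ks ! i), E j] q = (if i = length us then 1 else 0)" if "i < length ks" for i
  proof -
    have "ks ! i = j \<longleftrightarrow> i = length us"
      using that nth_eq_iff_index_eq[OF ks(1) that, of "length us"] by (simp add: uv(1))
    moreover have "ks ! i \<in> {1..6}" "j \<in> {1..6}" using ks(2) that j nth_mem by blast+
    ultimately show ?thesis using orthonormal_atD(2)[OF E] by simp
  qed
  have "frame_vol E ks (E j # ws) q = (\<Sum>i<length ks. (-1) ^ i * (if i = length us then 1 else 0) *
      wedge (take i (map ?\<alpha> ks) @ drop (Suc i) (map ?\<alpha> ks)) ws q)"
    unfolding frame_vol_def using len by (subst wedge_Cons_column) (auto simp: d intro!: sum.cong)
  also have "\<dots> = (\<Sum>i<length ks. if i = length us then (-1) ^ i * wedge (take i (map ?\<alpha> ks) @ drop (Suc i) (map ?\<alpha> ks)) ws q else 0)"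
    by (intro sum.cong) auto
  finally have "frame_vol E ks (E j # ws) q = (-1) ^ length us * wedge (map ?\<alpha> us @ map ?\<alpha> vs) ws q"
    by (simp add: uv(1))
  moreover have "takeWhile (\<lambda>k. k \<noteq> j) ks = us"
    unfolding uv(1) using uv(2) by (subst takeWhile_append2) auto
  moreover have "remove1 j ks = us @ vs"
    using uv by (auto simp: remove1_append)
  ultimately show ?thesis by (simp add: frame_vol_def)
qed

lemma hodge_basis:
  obtains E where "positive_basis_at A g J q E" "\<And>k. E k \<in> vf"
    "\<And>\<alpha> ws. hodge A g J \<alpha> ws q = (1 / fact (6 - length ws)) *
      (\<Sum>is | length is = 6 - length ws \<and> set is \<subseteq> {1..6}. \<alpha> (map E is) q * frame_vol E [1, 2, 3, 4, 5, 6] (map E is @ ws) q)"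
proof -
  obtain W F where "q \<in> W" "unitary_frame W F"
    by (rule unitary_frame_exists[of q]) (rule that; assumption)
  then have "\<exists>E. positive_basis_at A g J q E" unfolding unitary_frame_def by blast
  define E0 where "E0 = (SOME E. positive_basis_at A g J q E)"
  have pb: "positive_basis_at A g J q E0"
    unfolding E0_def by (rule someI_ex[OF \<open>\<exists>E. positive_basis_at A g J q E\<close>])
  \<comment> \<open>With the value \<open>0\<close> outside the index set, every \<open>E k\<close> is a vector field.\<close>
  define E where "E k = (if k \<in> {1..6} then E0 k else 0)" for k
  have eq: "E k = E0 k" if "k \<in> {1..6}" for k using that by (simp add: E_def)
  have "positive_basis_at A g J q E"
    using pb by (auto simp: positive_basis_at_def orthonormal_at_def E_def)
  moreover have "E k \<in> vf" for k
    using orthonormal_atD(1)[OF positive_basisD(1)[OF pb]] by (simp add: E_def)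
  moreover have u: "[1..<7] = [1, 2, 3, 4, 5, 6 :: nat]" by (simp add: upt_conv_Cons)
  have "frame_vol E [1, 2, 3, 4, 5, 6] = frame_vol E0 [1, 2, 3, 4, 5, 6]"
    by (simp add: frame_vol_def E_def)
  then have "hodge A g J \<alpha> ws q = (1 / fact (6 - length ws)) *
      (\<Sum>is | length is = 6 - length ws \<and> set is \<subseteq> {1..6}. \<alpha> (map E is) q * frame_vol E [1, 2, 3, 4, 5, 6] (map E is @ ws) q)" for \<alpha> ws
  proof -
    have m: "map E is = map E0 is" if "set is \<subseteq> {1..6}" for "is"
      using that eq by (intro map_cong) auto
    have "hodge A g J \<alpha> ws q = (1 / fact (6 - length ws)) *
      (\<Sum>is | length is = 6 - length ws \<and> set is \<subseteq> {1..6}. \<alpha> (map E0 is) q * frame_vol E0 [1, 2, 3, 4, 5, 6] (map E0 is @ ws) q)"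
      by (simp only: hodge_def Let_def frame_vol_def u E0_def)
    also have "\<dots> = (1 / fact (6 - length ws)) *
      (\<Sum>is | length is = 6 - length ws \<and> set is \<subseteq> {1..6}. \<alpha> (map E is) q * frame_vol E [1, 2, 3, 4, 5, 6] (map E is @ ws) q)"
      unfolding \<open>frame_vol E [1, 2, 3, 4, 5, 6] = frame_vol E0 [1, 2, 3, 4, 5, 6]\<close>
      by (intro arg_cong[of _ _ "\<lambda>x. _ * x"] sum.cong refl) (simp add: m)
    finally show ?thesis .
  qed
  ultimately show ?thesis by (rule that)
qed

definition Fo :: "'a vfield \<Rightarrow> 'a vfield \<Rightarrow> 'a \<Rightarrow> real" where "Fo X Y = g [X, J Y]"

lemma Fo_skew: "X \<in> vf \<Longrightarrow> Y \<in> vf \<Longrightarrow> Fo Y X = - Fo X Y"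
  using g_J_skew[of X Y] g_sym[of "J X" Y] by (simp add: Fo_def)

lemma Fo_smooth [simp, intro]: "X \<in> vf \<Longrightarrow> Y \<in> vf \<Longrightarrow> smooth_fun A (Fo X Y)"
  by (simp add: Fo_def)

lemma D_Fo: "X \<in> vf \<Longrightarrow> Y \<in> vf \<Longrightarrow> Z \<in> vf \<Longrightarrow>
    X (Fo Y Z) = Fo (D X Y) Z + Fo Y (D X Z)"
  using D_g[of X Y "J Z"] by (simp add: Fo_def D_J)

lemma Fo_diff1: "X \<in> vf \<Longrightarrow> Y \<in> vf \<Longrightarrow> Z \<in> vf \<Longrightarrow> Fo (X - Y) Z = Fo X Z - Fo Y Z"
  by (simp add: Fo_def g_diff)

lemma Fo_basis:
  assumes "positive_basis_at A g J q E" and X: "X \<in> vf" and Y: "Y \<in> vf"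
  shows "Fo X Y q = - (g [E 1, X] q * g [E 2, Y] q - g [E 2, X] q * g [E 1, Y] q
    + g [E 3, X] q * g [E 4, Y] q - g [E 4, X] q * g [E 3, Y] q
    + g [E 5, X] q * g [E 6, Y] q - g [E 6, X] q * g [E 5, Y] q)"
proof -
  note E = positive_basisD[OF assms(1)]
  have six: "{1..6::nat} = {1, 2, 3, 4, 5, 6}" by auto
  note vf = orthonormal_atD(1)[OF E(1)]
  have v: "E 1 \<in> vf" "E 3 \<in> vf" "E 5 \<in> vf" using vf by auto
  have a: "g [J Z, J Y] = g [Z, Y]" "g [Z, J Y] = - g [J Z, Y]" if "Z \<in> vf" for Z
    using that Y g_J_skew[of Z Y] by auto
  have "g [X, J Y] q = (\<Sum>i=1..6. g [X, E i] q * g [E i, J Y] q)"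
    using orthonormal_complete(2)[OF E(1) X, of "J Y"] Y by simp
  also have "\<dots> = (\<Sum>i=1..6. g [E i, X] q * g [E i, J Y] q)"
    using g_sym[OF X vf] by (intro sum.cong) auto
  finally show ?thesis
    unfolding six using a(1)[OF v(1)] a(1)[OF v(2)] a(1)[OF v(3)] a(2)[OF v(1)] a(2)[OF v(2)] a(2)[OF v(3)]
    by (simp add: Fo_def E(2-4))
qed

lemma basis_table:
  assumes "positive_basis_at A g J q E" and "i \<in> {1..6}" "j \<in> {1..6}"
  shows "Fo (E i) (E j) q = (if (i, j) \<in> {(2, 1), (4, 3), (6, 5)} then 1 else if (i, j) \<in> {(1, 2), (3, 4), (5, 6)} then -1 else 0)"
proof -
  note E = positive_basisD[OF assms(1)]
  have six: "{1..6::nat} = {1, 2, 3, 4, 5, 6}" by auto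
  have "g [E k, E l] q = (if k = l then 1 else 0)" if "k \<in> {1..6}" "l \<in> {1..6}" for k l
    using orthonormal_atD(2)[OF E(1)] that by blast
  moreover have "Fo (E i) (E j) q = - (g [E 1, E i] q * g [E 2, E j] q - g [E 2, E i] q * g [E 1, E j] q
    + g [E 3, E i] q * g [E 4, E j] q - g [E 4, E i] q * g [E 3, E j] q
    + g [E 5, E i] q * g [E 6, E j] q - g [E 6, E i] q * g [E 5, E j] q)"
    using Fo_basis[OF assms(1)] orthonormal_atD(1)[OF E(1)] assms by blast
  ultimately show ?thesis using assms(2,3) unfolding six by auto
qed

lemma J_table_sum:
  fixes V :: "nat \<Rightarrow> nat \<Rightarrow> real"
  shows "(\<Sum>i=1..6. \<Sum>j=1..6. (if (i, j) \<in> {(2, 1), (4, 3), (6, 5)} then 1 else if (i, j) \<in> {(1, 2), (3, 4), (5, 6)} then -1 else 0) * V i j)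
    = V 2 1 + V 4 3 + V 6 5 - V 1 2 - V 3 4 - V 5 6"
proof -
  have six: "{1..6::nat} = {1, 2, 3, 4, 5, 6}" by auto
  show ?thesis unfolding six by simp
qed

text \<open>In a unitary basis \<open>F\<close> only pairs a vector with its \<open>J\<close>-image, so three minors of the volume form remain.\<close>

lemma hodge_kaehler:
  assumes w: "a \<in> vf" "b \<in> vf" "c \<in> vf" "d \<in> vf"
  shows "hodge A g J (kaehler_form g J) [a, b, c, d] = - (Fo a b * Fo c d - Fo a c * Fo b d + Fo a d * Fo b c)"
proof
  fix q
  obtain E where E: "positive_basis_at A g J q E" and vf: "\<And>k. E k \<in> vf"
    and hodge: "\<And>\<alpha> ws. hodge A g J \<alpha> ws q = (1 / fact (6 - length ws)) *
      (\<Sum>is | length is = 6 - length ws \<and> set is \<subseteq> {1..6}. \<alpha> (map E is) q * frame_vol E [1, 2, 3, 4, 5, 6] (map E is @ ws) q)"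
    by (rule hodge_basis[of q]) (rule that; assumption)
  define V where "V i j = frame_vol E [1, 2, 3, 4, 5, 6] [E i, E j, a, b, c, d] q" for i j
  note on = positive_basisD(1)[OF E]
  have lists: "{is. length is = 2 \<and> set is \<subseteq> {1..6}} = (\<lambda>(i, j). [i, j]) ` ({1..6} \<times> {1..6::nat})"
    by (auto simp: length_Suc_conv numeral_2_eq_2 image_iff)
  have "hodge A g J (kaehler_form g J) [a, b, c, d] q = 1 / 2 * (\<Sum>i=1..6. \<Sum>j=1..6. Fo (E i) (E j) q * V i j)"
  proof -
    have "hodge A g J (kaehler_form g J) [a, b, c, d] q =
      1 / 2 * (\<Sum>is\<in>(\<lambda>(i, j). [i, j]) ` ({1..6} \<times> {1..6::nat}). kaehler_form g J (map E is) q *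
        frame_vol E [1, 2, 3, 4, 5, 6] (map E is @ [a, b, c, d]) q)"
      unfolding hodge lists[symmetric] by simp
    also have "\<dots> = 1 / 2 * (\<Sum>(i, j)\<in>{1..6} \<times> {1..6::nat}. Fo (E i) (E j) q * V i j)"
      by (subst sum.reindex) (auto simp: inj_on_def kaehler_form_def Fo_def V_def intro!: sum.cong)
    finally show ?thesis by (simp add: sum.cartesian_product)
  qed
  also have "(\<Sum>i=1..6. \<Sum>j=1..6. Fo (E i) (E j) q * V i j) =
      (\<Sum>i=1..6. \<Sum>j=1..6. (if (i, j) \<in> {(2, 1), (4, 3), (6, 5)} then 1 else if (i, j) \<in> {(1, 2), (3, 4), (5, 6)} then -1 else 0) * V i j)"
    using basis_table[OF E] by (intro sum.cong refl) simp
  also have "\<dots> = V 2 1 + V 4 3 + V 6 5 - V 1 2 - V 3 4 - V 5 6"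
    by (rule J_table_sum)
  also have "V 2 1 + V 4 3 + V 6 5 - V 1 2 - V 3 4 - V 5 6 = - 2 * (V 1 2 + V 3 4 + V 5 6)"
  proof -
    have "V j i = - V i j" for i j
      using wedge_adjacent_swap[of "[]" "[a, b, c, d]" "map (\<lambda>k w. g (E k # w)) [1, 2, 3, 4, 5, 6]" "E j" "E i" q]
      by (simp add: V_def frame_vol_def)
    from this[of 2 1] this[of 4 3] this[of 6 5] show ?thesis by simp
  qed
  finally have h: "hodge A g J (kaehler_form g J) [a, b, c, d] q = - (V 1 2 + V 3 4 + V 5 6)" by simp
  define m where "m x k = g [E k, x] q" for x k
  have v4: "frame_vol E [i, j, k, l] [a, b, c, d] q = det4 (m a) (m b) (m c) (m d) i j k l" for i j k l
    by (simp add: frame_vol_def wedge_4 wedge_3 det4_def m_def Let_def)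
  have V: "V 1 2 = frame_vol E [3, 4, 5, 6] [a, b, c, d] q" "V 3 4 = frame_vol E [1, 2, 5, 6] [a, b, c, d] q"
    "V 5 6 = frame_vol E [1, 2, 3, 4] [a, b, c, d] q"
    unfolding V_def by (simp_all add: frame_vol_column[OF on])
  have F: "Fo x y q = - (m x 1 * m y 2 - m x 2 * m y 1 + m x 3 * m y 4 - m x 4 * m y 3 + m x 5 * m y 6 - m x 6 * m y 5)"
    if "x \<in> vf" "y \<in> vf" for x y
    using Fo_basis[OF E that] by (simp add: m_def)
  show "hodge A g J (kaehler_form g J) [a, b, c, d] q = (- (Fo a b * Fo c d - Fo a c * Fo b d + Fo a d * Fo b c)) q"
    unfolding h V v4 sum_det4_eq_pfaffian by (simp add: F w)
qed

abbreviation (input) "\<eta> \<equiv> hodge A g J (kaehler_form g J)"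

text \<open>Since \<open>F\<close> is parallel, the derivatives in the invariant formula for \<open>d\<close> only differentiate the arguments,
  and they combine with the brackets to torsion vectors.\<close>

lemma d_hodge_kaehler:
  assumes w: "a \<in> vf" "b \<in> vf" "c \<in> vf" "d \<in> vf" "e \<in> vf"
  shows "ext_d (hodge A g J (kaehler_form g J)) [a, b, c, d, e] q =
    torsion_wedge (\<lambda>x y. Fo x y q) (\<lambda>x y z. Fo (tor x y) z q) a b c d e"
proof -
  have der: "X (\<eta> [x, y, z, v]) q = \<eta> [D X x, y, z, v] q - \<eta> [D X y, x, z, v] q + \<eta> [D X z, x, y, v] q - \<eta> [D X v, x, y, z] q"
    if X: "X \<in> vf" and v: "x \<in> vf" "y \<in> vf" "z \<in> vf" "v \<in> vf" for X x y z v
    using v X Fo_skew[of x "D X y"] Fo_skew[of x "D X z"] Fo_skew[of y "D X z"] Fo_skew[of x "D X v"] Fo_skew[of y "D X v"] Fo_skew[of z "D X v"]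
    by (simp add: hodge_kaehler vf_minus[OF X] vf_add[OF X] vf_diff[OF X] vf_mult[OF X] D_Fo[OF X] algebra_simps)
  have tor: "\<eta> [tor x y, u, v, z] q = \<eta> [D x y, u, v, z] q - \<eta> [D y x, u, v, z] q - \<eta> [lie_bracket x y, u, v, z] q"
    if "x \<in> vf" "y \<in> vf" "z \<in> vf" "u \<in> vf" "v \<in> vf" for x y u v z
    using that by (simp add: hodge_kaehler tor_def Fo_diff1) (simp add: algebra_simps)
  have "ext_d \<eta> [a, b, c, d, e] q =
      \<eta> [tor a b, c, d, e] q - \<eta> [tor a c, b, d, e] q + \<eta> [tor a d, b, c, e] q - \<eta> [tor a e, b, c, d] q
    + \<eta> [tor b c, a, d, e] q - \<eta> [tor b d, a, c, e] q + \<eta> [tor b e, a, c, d] q + \<eta> [tor c d, a, b, e] q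
    - \<eta> [tor c e, a, b, d] q + \<eta> [tor d e, a, b, c] q"
    using w unfolding ext_d_def
    by (simp add: nths_Cons lessThan_Suc eval_nat_numeral) (simp add: der tor)
  then show ?thesis
    using w by (simp add: hodge_kaehler torsion_wedge_def Let_def)
qed

text \<open>The summands of the outer Hodge star are invariant under permutations of the index list and vanish on lists with a
  repetition. So \<open>1/5!\<close> times the sum over all lists of length five is the sum over the six increasing ones,
  where \<open>d(*F)\<close> is read off from the table of \<open>F\<close> on the basis.\<close>

lemma codifferential_kaehler:
  assumes w: "w \<in> vf" and F: "orthonormal_at A g q F"
  shows "codiff A g J (kaehler_form g J) [w] q = - 1 / 2 * (\<Sum>i=1..6. T w (F i) (J (F i)) q)"
proof -
  obtain E where E: "positive_basis_at A g J q E" and vf: "\<And>k. E k \<in> vf"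
    and hodge: "\<And>\<alpha> ws. hodge A g J \<alpha> ws q = (1 / fact (6 - length ws)) *
      (\<Sum>is | length is = 6 - length ws \<and> set is \<subseteq> {1..6}. \<alpha> (map E is) q * frame_vol E [1, 2, 3, 4, 5, 6] (map E is @ ws) q)"
    by (rule hodge_basis[of q]) (rule that; assumption)
  note on = positive_basisD(1)[OF E]
  define t where "t i j k = T (E i) (E j) (E k) q" for i j k
  define tw where "tw = torsion_wedge (\<lambda>x y. Fo (E x) (E y) q) (\<lambda>x y z. Fo (tor (E x) (E y)) (E z) q)"
  have tw: "ext_d \<eta> (map E [i, j, k, l, n]) q = tw i j k l n" for i j k l n
    using vf by (simp add: d_hodge_kaehler tw_def torsion_wedge_def Let_def)
  have tw_swap: "tw b a c d e = - tw a b c d e" "tw a c b d e = - tw a b c d e"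
    "tw a b d c e = - tw a b c d e" "tw a b c e d = - tw a b c d e" for a b c d e
  proof -
    have 1: "Fo (E y) (E x) q = - Fo (E x) (E y) q" for x y using Fo_skew[OF vf vf, of x y] by simp
    have "Fo (tor (E y) (E x)) (E z) q = - Fo (tor (E x) (E y)) (E z) q" for x y z
      using g_minus(1)[of "tor (E x) (E y)" "J (E z)"] vf by (simp add: Fo_def tor_anti[of "E y" "E x"])
    from torsion_wedge_swap[of "\<lambda>x y. Fo (E x) (E y) q", OF 1, of "\<lambda>x y z. Fo (tor (E x) (E y)) (E z) q", OF this]
    show "tw b a c d e = - tw a b c d e" "tw a c b d e = - tw a b c d e"
      "tw a b d c e = - tw a b c d e" "tw a b c e d = - tw a b c d e"
      unfolding tw_def by blast+
  qed
  define f where "f is = ext_d \<eta> (map E is) q * frame_vol E [1, 2, 3, 4, 5, 6] (map E is @ [w]) q" for "is"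
  have f_swap: "f (xs @ y # x # ys) = f (xs @ x # y # ys)" if len: "length xs + length ys + 2 = 5" for xs x y ys
  proof -
    have v: "frame_vol E [1, 2, 3, 4, 5, 6] (map E (xs @ y # x # ys) @ [w]) q =
        - frame_vol E [1, 2, 3, 4, 5, 6] (map E (xs @ x # y # ys) @ [w]) q"
      using wedge_adjacent_swap[of "map E xs" "map E ys @ [w]" "map (\<lambda>k w. g (E k # w)) [1, 2, 3, 4, 5, 6]" "E y" "E x" q] len
      by (simp add: frame_vol_def)
    have three: "\<exists>c d e. zs = [c, d, e]" if "length zs = 3" for zs :: "nat list"
      using that by (auto simp: length_Suc_conv numeral_3_eq_3)
    have "length (xs @ ys) = 3" using len by simp
    then obtain c d e where "xs @ ys = [c, d, e]" using three by blast
    then consider "xs = []" "ys = [c, d, e]" | "xs = [c]" "ys = [d, e]" | "xs = [c, d]" "ys = [e]" | "xs = [c, d, e]" "ys = []"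
      by (auto simp: append_eq_Cons_conv)
    then have "ext_d \<eta> (map E (xs @ y # x # ys)) q = - ext_d \<eta> (map E (xs @ x # y # ys)) q"
    proof cases
      case 1 then show ?thesis using tw[of y x c d e] tw[of x y c d e] tw_swap(1)[of y x c d e] by simp
    next
      case 2 then show ?thesis using tw[of c y x d e] tw[of c x y d e] tw_swap(2)[of c y x d e] by simp
    next
      case 3 then show ?thesis using tw[of c d y x e] tw[of c d x y e] tw_swap(3)[of c d y x e] by simp
    next
      case 4 then show ?thesis using tw[of c d e y x] tw[of c d e x y] tw_swap(4)[of c d e y x] by simp
    qed
    then show ?thesis unfolding f_def v by simp
  qed
  note f_mset = adjacent_swap_invariant[where f = f and n = 5, OF f_swap]
  define L where "L = {is. length is = 5 \<and> set is \<subseteq> {1..6::nat}}"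
  have finL: "finite L" unfolding L_def using finite_lists_length_eq[of "{1..6::nat}" 5] by (simp add: conj_commute)
  have "hodge A g J (ext_d \<eta>) [w] q = 1 / 120 * (\<Sum>is\<in>L. f is)"
    unfolding hodge f_def L_def by (simp add: fact_numeral)
  also have "(\<Sum>is\<in>L. f is) = (\<Sum>is\<in>(\<Union>k\<in>{1..6}. permutations_of_set ({1..6} - {k})). f is)"
  proof (rule sum.mono_neutral_right[OF finL])
    show "(\<Union>k\<in>{1..6}. permutations_of_set ({1..6} - {k})) \<subseteq> L"
      by (auto simp: L_def dest: permutations_of_setD length_finite_permutations_of_set)
    show "\<forall>is\<in>L - (\<Union>k\<in>{1..6}. permutations_of_set ({1..6} - {k})). f is = 0"
    proof
      fix "is" assume i: "is \<in> L - (\<Union>k\<in>{1..6}. permutations_of_set ({1..6::nat} - {k}))"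
      have "\<not> distinct is"
      proof
        assume d: "distinct is"
        then have "card ({1..6} - set is) = 1" "set is \<subseteq> {1..6}"
          using i by (auto simp: L_def card_Diff_subset distinct_card)
        then obtain k where "{1..6} - set is = {k}" by (auto simp: card_1_singleton_iff)
        then have k: "k \<in> {1..6}" "set is = {1..6} - {k}"
          using double_diff[OF \<open>set is \<subseteq> {1..6}\<close> order_refl] by (blast, simp)
        have "is \<in> permutations_of_set ({1..6} - {k})"
          unfolding permutations_of_set_def using k(2) d by simp
        then show False using i k(1) by blast
      qed
      then obtain xs ys zs y where is_eq: "is = xs @ [y] @ ys @ [y] @ zs"
        using not_distinct_decomp by blast
      have "f is = f (y # y # xs @ ys @ zs)"
        by (rule f_mset) (use i in \<open>auto simp: is_eq L_def\<close>)
      also have "\<dots> = 0"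
        using wedge_repeated[of "[]" "map E (xs @ ys @ zs) @ [w]" "map (\<lambda>k w. g (E k # w)) [1, 2, 3, 4, 5, 6]" "E y" q] i
        by (simp add: f_def frame_vol_def is_eq L_def)
      finally show "f is = 0" .
    qed
  qed
  also have "\<dots> = (\<Sum>k=1..6. \<Sum>is\<in>permutations_of_set ({1..6} - {k}). f is)"
  proof (rule sum.UNION_disjoint)
    show "\<forall>i\<in>{1..6}. \<forall>j\<in>{1..6}. i \<noteq> j \<longrightarrow>
      permutations_of_set ({1..6::nat} - {i}) \<inter> permutations_of_set ({1..6} - {j}) = {}"
    proof (intro ballI impI)
      fix i j :: nat assume "i \<in> {1..6}" "j \<in> {1..6}" "i \<noteq> j"
      then have "{1..6} - {i} \<noteq> {1..6} - {j}" by blast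
      then show "permutations_of_set ({1..6} - {i}) \<inter> permutations_of_set ({1..6} - {j}) = {}"
        unfolding permutations_of_set_def by blast
    qed
  qed auto
  also have "\<dots> = (\<Sum>k=1..6. 120 * f (remove1 k [1, 2, 3, 4, 5, 6]))"
  proof (rule sum.cong[OF refl])
    fix k :: nat assume k: "k \<in> {1..6}"
    have six: "{1..6::nat} = {1, 2, 3, 4, 5, 6}" by auto
    have "f is = f (remove1 k [1, 2, 3, 4, 5, 6])" if i: "is \<in> permutations_of_set ({1..6} - {k})" for "is"
    proof (rule f_mset)
      have "set is = set (remove1 k [1, 2, 3, 4, 5, 6])" "distinct (remove1 k [1, 2, 3, 4, 5, 6 :: nat])"
        using permutations_of_setD(1)[OF i] k unfolding six by (subst set_remove1_eq) auto
      then show "mset is = mset (remove1 k [1, 2, 3, 4, 5, 6])"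
        using permutations_of_setD(2)[OF i] set_eq_iff_mset_eq_distinct by blast
      show "length is = 5"
        using length_finite_permutations_of_set[OF i] k by simp
    qed
    then show "(\<Sum>is\<in>permutations_of_set ({1..6} - {k}). f is) = 120 * f (remove1 k [1, 2, 3, 4, 5, 6])"
      using k by (simp add: fact_numeral)
  qed
  finally have h: "hodge A g J (ext_d \<eta>) [w] q = (\<Sum>k=1..6. f (remove1 k [1, 2, 3, 4, 5, 6]))"
    by (simp add: sum_distrib_left[symmetric])
  have six: "{1..6::nat} = {1, 2, 3, 4, 5, 6}" by auto
  have one: "frame_vol E [k] [w] q = g [E k, w] q" for k
    by (simp add: frame_vol_def wedge_Cons wedge_Nil)
  have Ft: "Fo (tor (E i) (E j)) (E 1) q = t i j 2" "Fo (tor (E i) (E j)) (E 2) q = - t i j 1"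
    "Fo (tor (E i) (E j)) (E 3) q = t i j 4" "Fo (tor (E i) (E j)) (E 4) q = - t i j 3"
    "Fo (tor (E i) (E j)) (E 5) q = t i j 6" "Fo (tor (E i) (E j)) (E 6) q = - t i j 5" for i j
    using vf positive_basisD(2-4)[OF E] by (simp_all add: Fo_def t_def T_eq g_minus)
  have ts: "j < i \<Longrightarrow> t i j k = - t j i k" "k < j \<Longrightarrow> t i j k = - t i k j" "t i i k = 0" "t i k k = 0" for i j k
    using T_skew(1)[OF vf vf vf, of j i k] T_skew(2)[OF vf vf vf, of i k j] T_skew(1)[OF vf vf vf, of i i k] T_skew(2)[OF vf vf vf, of i k k]
    by (auto simp: t_def fun_eq_iff)
  have f: "f [2, 3, 4, 5, 6] = - tw 2 3 4 5 6 * g [E 1, w] q" "f [1, 3, 4, 5, 6] = tw 1 3 4 5 6 * g [E 2, w] q"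
    "f [1, 2, 4, 5, 6] = - tw 1 2 4 5 6 * g [E 3, w] q" "f [1, 2, 3, 5, 6] = tw 1 2 3 5 6 * g [E 4, w] q"
    "f [1, 2, 3, 4, 6] = - tw 1 2 3 4 6 * g [E 5, w] q" "f [1, 2, 3, 4, 5] = tw 1 2 3 4 5 * g [E 6, w] q"
    unfolding f_def tw by (simp_all add: frame_vol_column[OF on] one)
  have tab: "Fo (E i) (E j) q = (if (i, j) \<in> {(2, 1), (4, 3), (6, 5)} then 1 else if (i, j) \<in> {(1, 2), (3, 4), (5, 6)} then -1 else 0)"
    if "i \<in> set [1, 2, 3, 4, 5, 6]" "j \<in> set [1, 2, 3, 4, 5, 6]" for i j
    by (rule basis_table[OF E]) (use that in auto)
  have tws: "tw 2 3 4 5 6 = - t 1 3 4 - t 1 5 6" "tw 1 3 4 5 6 = t 2 3 4 + t 2 5 6"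
    "tw 1 2 4 5 6 = - t 1 2 3 - t 3 5 6" "tw 1 2 3 5 6 = t 1 2 4 + t 4 5 6"
    "tw 1 2 3 4 6 = - t 1 2 5 - t 3 4 5" "tw 1 2 3 4 5 = t 1 2 6 + t 3 4 6"
    unfolding tw_def torsion_wedge_def Let_def by (simp_all add: tab Ft Ft(1)[unfolded One_nat_def] ts)
  have "hodge A g J (ext_d \<eta>) [w] q = g [E 1, w] q * (t 1 3 4 + t 1 5 6) + g [E 2, w] q * (t 2 3 4 + t 2 5 6)
    + g [E 3, w] q * (t 1 2 3 + t 3 5 6) + g [E 4, w] q * (t 1 2 4 + t 4 5 6)
    + g [E 5, w] q * (t 1 2 5 + t 3 4 5) + g [E 6, w] q * (t 1 2 6 + t 3 4 6)"
    unfolding h six using f[unfolded tws] by (simp add: algebra_simps)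
  also have "\<dots> = T w (E 1) (E 2) q + T w (E 3) (E 4) q + T w (E 5) (E 6) q"
  proof -
    have ex: "T w (E i) (E j) q = (\<Sum>k=1..6. g [E k, w] q * t k i j)" for i j
      using covector_expand[OF T_covector(1)[OF vf vf] on w, of i j] g_sym[OF w vf] by (simp add: t_def)
    have ex2: "T w (E i) (E j) q = g [E 1, w] q * t 1 i j + g [E 2, w] q * t 2 i j + g [E 3, w] q * t 3 i j
        + g [E 4, w] q * t 4 i j + g [E 5, w] q * t 5 i j + g [E 6, w] q * t 6 i j" for i j
      unfolding ex six by simp
    have "t 1 1 2 = 0" "t 2 1 2 = 0" "t 3 1 2 = t 1 2 3" "t 4 1 2 = t 1 2 4" "t 5 1 2 = t 1 2 5" "t 6 1 2 = t 1 2 6"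
      "t 3 3 4 = 0" "t 4 3 4 = 0" "t 5 3 4 = t 3 4 5" "t 6 3 4 = t 3 4 6"
      "t 5 5 6 = 0" "t 6 5 6 = 0"
      by (simp_all add: ts)
    then show ?thesis unfolding ex2 by (simp only:) (simp add: algebra_simps)
  qed
  also have "\<dots> = 1 / 2 * (\<Sum>i=1..6. T w (E i) (J (E i)) q)"
  proof -
    have "T w (J (E i)) (J (J (E i))) = T w (E i) (J (E i))" for i
      using T_minus(3)[of "E i" w "J (E i)"] T_skew(2)[of w "E i" "J (E i)"] vf w by simp
    from this[of 1] this[of 3] this[of 5] show ?thesis
      unfolding six by (simp add: positive_basisD(2-4)[OF E])
  qed
  also have "(\<Sum>i=1..6. T w (E i) (J (E i)) q) = (\<Sum>i=1..6. T w (F i) (J (F i)) q)"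
    using trace_indep[where h = "\<lambda>X Y. T w X (J Y) q", OF _ _ F on] w
      T_covector(2)[OF w] T_covector(3)[OF w, THEN J_covector] by simp
  finally show ?thesis by (simp add: codiff_def)
qed

end

section \<open>Algebra at a point\<close>

text \<open>The algebraic identities at one point. The rules with \<open>J (J x)\<close> replace \<open>J\<^sup>2 = -1\<close> and linearity in \<open>x\<close>: only
  these consequences enter, so \<open>'v\<close> need not be a vector space.\<close>

locale torsion_point =
  fixes J :: "'v \<Rightarrow> 'v" and E :: "nat \<Rightarrow> 'v"
    and T :: "'v \<Rightarrow> 'v \<Rightarrow> 'v \<Rightarrow> real" and B R :: "'v \<Rightarrow> 'v \<Rightarrow> 'v \<Rightarrow> 'v \<Rightarrow> real"
  assumes E_J: "E 2 = J (E 1)" "E 4 = J (E 3)" "E 6 = J (E 5)"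
    and T_skew: "T y x z = - T x y z" "T x z y = - T x y z"
    and T_JJ: "T (J (J x)) y z = - T x y z"
    and B_skew: "B x z y v = - B x y z v" "B x y v z = - B x y z v"
    and B_JJ: "B (J (J x)) y z v = - B x y z v" "B x (J (J y)) z v = - B x y z v"
    and R_skew: "R y x z v = - R x y z v" "R x y v z = - R x y z v"
    and R_JJ: "R (J (J x)) y z v = - R x y z v" "R x y (J (J z)) v = - R x y z v"
    and bianchi: "R x y z v + R y z x v + R z x y v = B x y z v + B y z x v + B z x y v
      + (\<Sum>f=1..6. T x y (E f) * T (E f) z v + T y z (E f) * T (E f) x v + T z x (E f) * T (E f) y v)"
begin

definition S :: "('v \<Rightarrow> real) \<Rightarrow> real" where "S h = (\<Sum>i=1..6. h (E i))"

lemma S_add: "S (\<lambda>x. f x + h x) = S f + S h"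
  and S_diff: "S (\<lambda>x. f x - h x) = S f - S h"
  and S_minus: "S (\<lambda>x. - f x) = - S f"
  and S_cmult: "S (\<lambda>x. c * f x) = c * S f"
  and S_multc: "S (\<lambda>x. f x * c) = S f * c"
  by (simp_all add: S_def sum.distrib sum_subtractf sum_negf sum_distrib_left sum_distrib_right)

lemma S_0: "S (\<lambda>x. 0) = 0"
  by (simp add: S_def)

lemma S_swap: "S (\<lambda>x. S (\<lambda>y. f x y)) = S (\<lambda>y. S (\<lambda>x. f x y))"
  unfolding S_def by (rule sum.swap)

lemma S_JJ:
  assumes "\<And>x y. h (J (J x)) y = - h x y" "\<And>x y. h x (J (J y)) = - h x y"
  shows "S (\<lambda>x. h (J x) (J x)) = S (\<lambda>x. h x x)"
proof -
  have six: "{1..6::nat} = {1, 2, 3, 4, 5, 6}" by auto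
  show ?thesis unfolding S_def six by (simp add: E_J[simplified] assms)
qed

lemma S_J1:
  assumes "\<And>x y. h (J (J x)) y = - h x y" "\<And>x y. h x (J (J y)) = - h x y"
  shows "S (\<lambda>x. h (J x) x) = - S (\<lambda>x. h x (J x))"
  using S_JJ[of "\<lambda>x y. h x (J y)"] assms by (simp add: S_minus)

lemma T_JJ': "T x (J (J y)) z = - T x y z" "T x y (J (J z)) = - T x y z"
  using T_skew T_JJ by metis+

lemma B_JJ': "B x y (J (J z)) v = - B x y z v" "B x y z (J (J v)) = - B x y z v"
  using B_skew B_JJ by metis+

lemma R_JJ': "R x (J (J y)) z v = - R x y z v" "R x y z (J (J v)) = - R x y z v"
  using R_skew R_JJ by metis+

lemma T_cyc: "T x y z = T y z x"
  using T_skew by metis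

lemma B_cyc: "B u x y z = B u y z x"
  using B_skew by metis

text \<open>Four times the totally skew part of \<open>B\<close>.\<close>

definition al :: "'v \<Rightarrow> 'v \<Rightarrow> 'v \<Rightarrow> 'v \<Rightarrow> real" where
  "al z x y v = B z x y v - B x z y v - B y x z v - B v x y z"

text \<open>The right-hand side of \<open>star\<close>: the curvature as a source of the part of \<open>B z x y v\<close> symmetric in \<open>z, v\<close>.\<close>

definition G :: "'v \<Rightarrow> 'v \<Rightarrow> 'v \<Rightarrow> 'v \<Rightarrow> real" where
  "G z v x y = R y z x v - R x z y v + R y v x z - R x v y z"

text \<open>The 4-form of the Bianchi identity changes sign under the exchange of \<open>z\<close> and \<open>v\<close>, so it cancels in the sum
  of the two instances.\<close>

lemma star: "B z x y v + B v x y z = G z v x y"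
proof -
  have q: "(\<Sum>f=1..6. T x y (E f) * T (E f) z v + T y z (E f) * T (E f) x v + T z x (E f) * T (E f) y v)
     + (\<Sum>f=1..6. T x y (E f) * T (E f) v z + T y v (E f) * T (E f) x z + T v x (E f) * T (E f) y z) = 0"
  proof -
    have "T (E f) v z = - T (E f) z v" "T (E f) x v = - T v x (E f)"
      "T (E f) y v = T y v (E f)" "T (E f) x z = - T z x (E f)" "T (E f) y z = T y z (E f)" for f
      using T_skew by metis+
    then show ?thesis by (simp add: sum.distrib[symmetric] algebra_simps)
  qed
  show ?thesis
    using bianchi[of x y z v] bianchi[of x y v z] q
      R_skew(2)[of x y z v] R_skew(2)[of z x y v] R_skew(1)[of z x y v]
      R_skew(2)[of y z x v] R_skew(1)[of v x y z] B_skew(2)[of x y z v]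
      B_skew(2)[of y z x v] B_skew(1)[of y z x v] B_skew(1)[of y x v z] B_skew(2)[of y x z v]
      R_skew(2)[of y v x z]  R_skew(1)[of x z y v] R_skew(1)[of x v y z]
    unfolding G_def by linarith
qed

lemma al_skew: "al x z y v = - al z x y v" "al z y x v = - al z x y v" "al z x v y = - al z x y v"
  using B_skew(1)[of y x z v] B_skew(1)[of v z y x] B_skew(2)[of v y z x] B_skew(1)[of v y x z]
    B_skew(1)[of z x y v] B_skew(1)[of x y z v] B_skew(1)[of x z y v] B_skew(2)[of z x y v] B_skew(1)[of v x y z]
    B_skew(2)[of x z y v] B_skew(2)[of y x z v] B_skew(2)[of v x y z] B_cyc[of v x y z] B_cyc[of v z y x]
  unfolding al_def by linarith+

text \<open>A tensor that is skew in its last three arguments is the sum of its totally skew part and of a part that is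
  determined by symmetrizing the first argument with each of the others.\<close>

lemma four_B: "4 * B z x y v = al z x y v + G z x y v + G z y v x + G z v x y"
  using star[of z x y v] star[of z y v x] star[of z v x y]
    B_cyc[of z x y v] B_cyc[of z y v x] B_cyc[of x z y v]
    B_skew(1)[of x z y v] B_skew(2)[of x y z v]  B_skew(1)[of y v x z] B_cyc[of y v x z] B_skew(2)[of y x z v]
  unfolding al_def by linarith

text \<open>For vanishing \<open>B\<close> this is the symmetry of \<open>R\<close> under exchange of the pairs. In general, the left-hand side
  inherits the invariance under \<open>J\<close> in \<open>x, y\<close> from the right-hand side.\<close>

lemma pair_difference:
  assumes "\<And>z x y v. al z x y v = 0"
  shows "B x z v y - B y z v x = R x y z v - R z v x y"
proof -
  have r: "R b a c d = - R a b c d" "R a b d c = - R a b c d" "R b a d c = R a b c d" for a b c d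
    using R_skew[of b a c d] R_skew[of a b c d] R_skew[of a b d c] by auto
  note e = r(3)[of y x v z] r(1)[of v x y z] r(2)[of y z v x] r(3)[of v z y x] r(1)[of z x y v] r(1)[of y x z v]
    r(2)[of z v y x] r(2)[of y v z x] r(3)[of v x z y] r(3)[of z x v y] r(3)[of v y z x] r(3)[of z y v x]
    r(2)[of x y v z] r(1)[of v y x z] r(2)[of x z v y] r(1)[of v z x y] r(1)[of z y x v] r(2)[of x v z y]
  have "4 * B x z v y = G x z v y + G x v y z + G x y z v"
       "4 * B y z v x = G y z v x + G y v x z + G y x z v"
    using four_B assms by auto
  then show ?thesis
    unfolding G_def e by linarith
qed

text \<open>The scalar product of a 3-tensor with \<open>T\<close>, and its behaviour under permutations of the three arguments.\<close>

definition Ct :: "('v \<Rightarrow> 'v \<Rightarrow> 'v \<Rightarrow> real) \<Rightarrow> real" where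
  "Ct \<phi> = S (\<lambda>i. S (\<lambda>j. S (\<lambda>k. T i j k * \<phi> i j k)))"

lemma Ct_add: "Ct (\<lambda>i j k. \<phi> i j k + \<psi> i j k) = Ct \<phi> + Ct \<psi>"
  and Ct_minus: "Ct (\<lambda>i j k. - \<phi> i j k) = - Ct \<phi>"
  and Ct_cmult: "Ct (\<lambda>i j k. c * \<phi> i j k) = c * Ct \<phi>"
proof -
  show "Ct (\<lambda>i j k. \<phi> i j k + \<psi> i j k) = Ct \<phi> + Ct \<psi>"
    "Ct (\<lambda>i j k. - \<phi> i j k) = - Ct \<phi>"
    unfolding Ct_def by (simp_all add: distrib_left right_diff_distrib S_add S_diff S_minus)
  show "Ct (\<lambda>i j k. c * \<phi> i j k) = c * Ct \<phi>"
    unfolding Ct_def by (simp add: mult.left_commute[of _ c] S_cmult)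
qed

lemma Ct_cyc: "Ct (\<lambda>i j k. \<phi> j k i) = Ct \<phi>"
proof -
  have "Ct (\<lambda>i j k. \<phi> j k i) = S (\<lambda>i. S (\<lambda>j. S (\<lambda>k. T j k i * \<phi> j k i)))"
    unfolding Ct_def by (subst T_cyc) simp
  also have "\<dots> = Ct \<phi>"
    unfolding Ct_def by (subst S_swap, subst (2) S_swap) simp
  finally show ?thesis .
qed

lemma Ct_swap12: "Ct (\<lambda>i j k. \<phi> j i k) = - Ct \<phi>"
proof -
  have "Ct (\<lambda>i j k. \<phi> j i k) = S (\<lambda>i. S (\<lambda>j. S (\<lambda>k. - (T j i k * \<phi> j i k))))"
    unfolding Ct_def by (subst T_skew(1)) simp
  also have "\<dots> = - Ct \<phi>"
    unfolding Ct_def by (subst S_swap) (simp add: S_minus)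
  finally show ?thesis .
qed

lemma Ct_swap23: "Ct (\<lambda>i j k. \<phi> i k j) = - Ct \<phi>"
  using Ct_swap12[of \<phi>] Ct_cyc[of "\<lambda>i j k. \<phi> k j i"] Ct_cyc[of "\<lambda>i j k. \<phi> j i k"] by linarith

lemma Ct_S: "Ct (\<lambda>i j k. S (\<lambda>f. \<phi> i j k f)) = S (\<lambda>f. Ct (\<lambda>i j k. \<phi> i j k f))"
proof -
  have "Ct (\<lambda>i j k. S (\<lambda>f. \<phi> i j k f)) = S (\<lambda>i. S (\<lambda>j. S (\<lambda>k. S (\<lambda>f. T i j k * \<phi> i j k f))))"
    by (simp add: Ct_def S_cmult)
  also have "\<dots> = S (\<lambda>i. S (\<lambda>j. S (\<lambda>f. S (\<lambda>k. T i j k * \<phi> i j k f))))"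
    by (subst (3) S_swap) simp
  also have "\<dots> = S (\<lambda>i. S (\<lambda>f. S (\<lambda>j. S (\<lambda>k. T i j k * \<phi> i j k f))))"
    by (subst (2) S_swap) simp
  also have "\<dots> = S (\<lambda>f. Ct (\<lambda>i j k. \<phi> i j k f))"
    unfolding Ct_def by (subst S_swap) simp
  finally show ?thesis .
qed

lemma S_skew_sym: "(\<And>x y. a y x = - a x y) \<Longrightarrow> (\<And>x y. b y x = b x y) \<Longrightarrow> S (\<lambda>x. S (\<lambda>y. b x y * a x y)) = 0"
proof -
  assume a: "\<And>x y. a y x = - a x y" and b: "\<And>x y. b y x = b x y"
  have "S (\<lambda>x. S (\<lambda>y. b x y * a x y)) = S (\<lambda>x. S (\<lambda>y. b y x * a y x))" by (rule S_swap)
  also have "\<dots> = S (\<lambda>x. S (\<lambda>y. - (b x y * a x y)))" by (subst a, subst b) simp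
  also have "\<dots> = - S (\<lambda>x. S (\<lambda>y. b x y * a x y))" by (simp add: S_minus)
  finally show ?thesis by simp
qed

text \<open>The contraction of \<open>T\<close> with itself over two arguments is symmetric, while \<open>T\<close> is skew; so the 4-form of the Bianchi
  identity disappears when it is contracted with \<open>T\<close>.\<close>

lemma Ct_quadratic: "Ct (\<lambda>i j k. S (\<lambda>f. T i j f * T f k v)) = 0"
proof -
  have "Ct (\<lambda>i j k. S (\<lambda>f. T i j f * T f k v)) =
      S (\<lambda>i. S (\<lambda>j. S (\<lambda>k. S (\<lambda>f. (T i j k * T i j f) * T f k v))))"
    unfolding Ct_def S_cmult[symmetric] by (simp only: mult.assoc)
  moreover have "S (\<lambda>k. S (\<lambda>f. (T i j k * T i j f) * T f k v)) = 0" for i j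
    by (rule S_skew_sym) (rule T_skew(1), rule mult.commute)
  ultimately show ?thesis by (simp add: S_0)
qed

text \<open>A third of the derivative of \<open>\<bar>T\<bar>\<^sup>2 / 2\<close> once \<open>B\<close> has no totally skew part (\<open>B_contraction\<close>).\<close>

definition w :: "'v \<Rightarrow> real" where "w v = Ct (\<lambda>i j k. B k v i j)"

lemma curvature_contraction: "Ct (\<lambda>i j k. R i j v k) = - w v"
proof -
  have q: "(\<Sum>f=1..6. T x y (E f) * T (E f) z v + T y z (E f) * T (E f) x v + T z x (E f) * T (E f) y v)
    = S (\<lambda>f. T x y f * T f z v) + S (\<lambda>f. T y z f * T f x v) + S (\<lambda>f. T z x f * T f y v)" for x y z v
    by (simp add: S_def sum.distrib)
  have "Ct (\<lambda>i j k. R i j k v + R j k i v + R k i j v) = Ct (\<lambda>i j k. B i j k v + B j k i v + B k i j v +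
     (S (\<lambda>f. T i j f * T f k v) + S (\<lambda>f. T j k f * T f i v) + S (\<lambda>f. T k i f * T f j v)))"
    unfolding bianchi q ..
  moreover have c3: "Ct (\<lambda>i j k. \<phi> i j k + \<phi> j k i + \<phi> k i j) = 3 * Ct \<phi>" for \<phi>
    using Ct_cyc[of \<phi>] Ct_cyc[of "\<lambda>i j k. \<phi> j k i"] by (simp add: Ct_add)
  ultimately have "3 * Ct (\<lambda>i j k. R i j k v) = 3 * Ct (\<lambda>i j k. B i j k v) + 3 * Ct (\<lambda>i j k. S (\<lambda>f. T i j f * T f k v))"
    using c3[of "\<lambda>i j k. R i j k v"] c3[of "\<lambda>i j k. B i j k v"] c3[of "\<lambda>i j k. S (\<lambda>f. T i j f * T f k v)"]
    by (simp add: Ct_add)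
  moreover have "Ct (\<lambda>i j k. B i j k v) = w v"
    unfolding w_def using Ct_cyc[of "\<lambda>i j k. B k i j v"] Ct_cyc[of "\<lambda>i j k. B i j k v"]
    by (simp add: B_cyc[of _ v])
  moreover have "Ct (\<lambda>i j k. R i j k v) = - Ct (\<lambda>i j k. R i j v k)"
    unfolding Ct_minus[symmetric] using R_skew(2) by (intro arg_cong[of _ _ Ct] ext) blast
  ultimately show ?thesis by (simp add: Ct_quadratic)
qed

end

text \<open>The assumption \<open>B_tr\<close> is what a parallel Lee form contributes; the others say that both pairs of
  arguments of \<open>R\<close> lie in \<open>su(3)\<close>.\<close>

locale instanton_point = torsion_point J E T B R
  for J :: "'v \<Rightarrow> 'v" and E :: "nat \<Rightarrow> 'v"
    and T :: "'v \<Rightarrow> 'v \<Rightarrow> 'v \<Rightarrow> real" and B R :: "'v \<Rightarrow> 'v \<Rightarrow> 'v \<Rightarrow> 'v \<Rightarrow> real" +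
  assumes R_J12: "R (J x) y z v = - R x (J y) z v"
    and R_J34: "R x y (J z) v = - R x y z (J v)"
    and R_tr12: "(\<Sum>i=1..6. R (E i) (J (E i)) z v) = 0"
    and R_tr34: "(\<Sum>i=1..6. R x y (E i) (J (E i))) = 0"
    and B_tr: "(\<Sum>i=1..6. B x y (E i) (J (E i))) = 0"
begin

text \<open>The Ricci contraction precomposed with \<open>J\<close>.\<close>

definition \<rho> :: "'v \<Rightarrow> 'v \<Rightarrow> real" where "\<rho> z x = S (\<lambda>i. R (J i) z i x)"

lemma S_R_J: "S (\<lambda>i. R i z (J i) x) = - \<rho> z x"
  unfolding \<rho>_def using S_J1[of "\<lambda>a b. R a z b x"] R_JJ by simp

lemma S_tr: "S (\<lambda>i. R i (J i) z v) = 0" "S (\<lambda>i. R (J i) i z v) = 0"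
    "S (\<lambda>i. R x y i (J i)) = 0" "S (\<lambda>i. R x y (J i) i) = 0" "S (\<lambda>i. B x y i (J i)) = 0"
proof -
  show *: "S (\<lambda>i. R i (J i) z v) = 0" "S (\<lambda>i. R x y i (J i)) = 0" "S (\<lambda>i. B x y i (J i)) = 0"
    using R_tr12 R_tr34 B_tr by (simp_all add: S_def)
  have "R (J i) i z v = - R i (J i) z v" "R x y (J i) i = - R x y i (J i)" for i
    using R_skew by blast+
  then show "S (\<lambda>i. R (J i) i z v) = 0" "S (\<lambda>i. R x y (J i) i) = 0"
    using * by (simp_all add: S_minus)
qed

text \<open>Tracing \<open>four_B\<close> against \<open>J\<close> leaves the trace of \<open>al\<close>, which is skew in \<open>z, x\<close>, plus four times the symmetric
  part of \<open>\<rho>\<close>. The sum vanishes, hence both terms do.\<close>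

lemma al_trace_and_rho: "S (\<lambda>i. al z x i (J i)) = 0" "\<rho> x z = - \<rho> z x"
proof -
  have g1: "S (\<lambda>i. G z x i (J i)) = 2 * \<rho> z x + 2 * \<rho> x z" for z x
    unfolding G_def by (simp add: S_add S_diff S_R_J \<rho>_def[symmetric])
  have g2: "S (\<lambda>i. G z i (J i) x) = \<rho> z x + \<rho> x z" for z x
  proof -
    have "G z i (J i) x = R x z (J i) i + R (J i) z i x - R i x (J i) z - R (J i) i x z" for i
      using R_skew(2)[of "J i" z i x] R_skew(1)[of x i "J i" z] unfolding G_def by linarith
    then show ?thesis by (simp add: S_add S_diff S_tr S_R_J \<rho>_def[symmetric])
  qed
  have g3: "S (\<lambda>i. G z (J i) x i) = \<rho> z x + \<rho> x z" for z x
  proof -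
    have "G z (J i) x i = - R i z (J i) x - R x z i (J i) + R i (J i) x z + R (J i) x i z" for i
      using R_skew(2)[of i z x "J i"] R_skew(1)[of x "J i" i z] unfolding G_def by linarith
    then show ?thesis by (simp add: S_add S_diff S_minus S_tr S_R_J \<rho>_def[symmetric])
  qed
  have t: "S (\<lambda>i. al z x i (J i)) + 4 * (\<rho> z x + \<rho> x z) = 0" for z x
  proof -
    have "S (\<lambda>i. 4 * B z x i (J i)) = S (\<lambda>i. al z x i (J i)) + 4 * (\<rho> z x + \<rho> x z)"
      unfolding four_B by (simp add: S_add g1 g2 g3)
    then show ?thesis by (simp add: S_cmult S_tr)
  qed
  have "S (\<lambda>i. al x z i (J i)) = - S (\<lambda>i. al z x i (J i))"
    by (subst al_skew(1)) (simp add: S_minus)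
  then show "S (\<lambda>i. al z x i (J i)) = 0" "\<rho> x z = - \<rho> z x"
    using t[of z x] t[of x z] by auto
qed

end

locale closed_instanton_point = instanton_point J E T B R
  for J :: "'v \<Rightarrow> 'v" and E :: "nat \<Rightarrow> 'v"
    and T :: "'v \<Rightarrow> 'v \<Rightarrow> 'v \<Rightarrow> real" and B R :: "'v \<Rightarrow> 'v \<Rightarrow> 'v \<Rightarrow> 'v \<Rightarrow> real" +
  assumes al_0: "al z x y v = 0"
begin

lemma B_alt: "B z x y v = B x z y v + B y x z v + B v x y z"
  using al_0[of z x y v] by (simp add: al_def)

text \<open>By \<open>four_B\<close> without its skew part, \<open>B\<close> is a sum of curvature terms, and letting \<open>J\<close> act as a derivation on
  the four arguments of \<open>R\<close> gives zero on each of the two pairs.\<close>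

lemma B_type: "B (J x) y z v + B x (J y) z v + B x y (J z) v + B x y z (J v) = 0"
proof -
  have f: "4 * B z x y v = G z x y v + G z y v x + G z v x y" for z x y v
    using four_B[of z x y v] al_0[of z x y v] by simp
  have "4 * (B (J x) y z v + B x (J y) z v + B x y (J z) v + B x y z (J v)) = 0"
    unfolding distrib_left f G_def by (simp add: R_J12 R_J34)
  then show ?thesis by simp
qed

text \<open>Acting twice with \<open>J\<close> on the last three arguments is acting twice on the first one, that is, \<open>-1\<close>. So the
  3-form \<open>B u\<close> has no component of type \<open>(3,0)\<close>.\<close>

lemma B_type2: "B u (J x) (J y) z + B u (J x) y (J z) + B u x (J y) (J z) = B u x y z"
  using B_type[of "J u" x y z] B_type[of u "J x" y z] B_type[of u x "J y" z] B_type[of u x y "J z"]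
    B_JJ(1)[of u x y z] B_JJ(2)[of u x y z] B_JJ'[of u x y z] by linarith

text \<open>Another pairing of \<open>B\<close> with \<open>T\<close>. It weighs the types of \<open>B\<close> differently from \<open>w\<close>, which is why comparing the
  two gives information.\<close>

definition w' :: "'v \<Rightarrow> real" where "w' v = Ct (\<lambda>i j k. B k v (J i) (J j))"

text \<open>The tensor \<open>K\<close> below is symmetric in two of its arguments by \<open>pair_difference\<close>, so its contraction with \<open>T\<close>
  vanishes; \<open>B_type\<close> and \<open>B_type2\<close> express this contraction and \<open>w\<close> through the same auxiliary covector \<open>h\<close>.\<close>

lemma w_plus_w': "w v + w' v = 0"
proof -
  define h where "h = Ct (\<lambda>i j k. B k (J v) i (J j))"
  have "Ct (\<lambda>i j k. B k (J v) (J i) j) = h"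
  proof -
    have "Ct (\<lambda>i j k. B k (J v) (J i) j) = - Ct (\<lambda>i j k. B k (J v) j (J i))"
      unfolding Ct_minus[symmetric] using B_skew(2) by (intro arg_cong[of _ _ Ct] ext) blast
    then show ?thesis using Ct_swap12[of "\<lambda>i j k. B k (J v) i (J j)"] by (simp add: h_def)
  qed
  moreover have "w v = Ct (\<lambda>i j k. B k (J v) (J i) j + B k (J v) i (J j) + B k v (J i) (J j))"
    by (simp add: w_def B_type2)
  ultimately have 1: "2 * h + w' v = w v"
    by (simp add: Ct_add h_def w'_def)
  have D: "B x z v y - B y z v x = B (J x) z v (J y) - B (J y) z v (J x)" for x y z v
    unfolding pair_difference[OF al_0] by (simp add: R_J12 R_J34 R_JJ R_JJ')
  define K where "K i j k = B k v i j - B (J k) v i (J j)" for i j k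
  have "K i j k = K i k j" for i j k
    using D[of k v i j] by (simp add: K_def)
  then have "Ct K = Ct (\<lambda>i j k. K i k j)" by (intro arg_cong[of _ _ Ct] ext)
  then have "Ct K = 0" using Ct_swap23[of K] by simp
  moreover have "K i j k = B k (J v) i (J j) + B k v (J i) (J j)" for i j k
    using B_type[of k v i "J j"] B_JJ'(2)[of k v i j] by (simp add: K_def)
  then have "Ct K = Ct (\<lambda>i j k. B k (J v) i (J j) + B k v (J i) (J j))" by (intro arg_cong[of _ _ Ct] ext)
  ultimately have "h + w' v = 0" by (simp add: Ct_add h_def w'_def)
  with 1 show ?thesis by simp
qed

lemma B_contraction: "Ct (\<lambda>i j k. B x i j k) = 3 * w x"
proof -
  have "Ct (\<lambda>i j k. B x i j k) = Ct (\<lambda>i j k. B i x j k + B j x k i + B k x i j)"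
    using B_alt[of x] B_cyc by (intro arg_cong[of _ _ Ct] ext) metis
  then show ?thesis
    using Ct_cyc[of "\<lambda>i j k. B k x i j"] Ct_cyc[of "\<lambda>i j k. B i x j k"] by (simp add: Ct_add w_def)
qed

text \<open>Symmetry of the Ricci contraction.\<close>

lemma \<rho>_J_sym: "\<rho> (J a) f = \<rho> (J f) a"
proof -
  have "\<rho> f (J a) = - S (\<lambda>i. R (J i) f (J i) a)"
    unfolding \<rho>_def by (simp add: R_J34 S_minus)
  also have "S (\<lambda>i. R (J i) f (J i) a) = S (\<lambda>i. R i f i a)"
    by (rule S_JJ) (simp_all add: R_JJ)
  also have "S (\<lambda>i. R i f i a) = \<rho> (J f) a"
    unfolding \<rho>_def by (simp add: R_J12 R_JJ')
  finally show ?thesis using al_trace_and_rho(2)[of f "J a"] by simp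
qed

end

text \<open>The second covariant derivative \<open>C\<close> of the torsion inherits the linear identities of \<open>B\<close>.\<close>

locale second_order_point = closed_instanton_point J E T B R
  for J :: "'v \<Rightarrow> 'v" and E :: "nat \<Rightarrow> 'v"
    and T :: "'v \<Rightarrow> 'v \<Rightarrow> 'v \<Rightarrow> real" and B R :: "'v \<Rightarrow> 'v \<Rightarrow> 'v \<Rightarrow> 'v \<Rightarrow> real" +
  fixes C :: "'v \<Rightarrow> 'v \<Rightarrow> 'v \<Rightarrow> 'v \<Rightarrow> 'v \<Rightarrow> real"
  assumes C_skew: "C u x z y v = - C u x y z v" "C u x y v z = - C u x y z v"
    and C_JJ: "C (J (J u)) x y z v = - C u x y z v" "C u (J (J x)) y z v = - C u x y z v"
      "C u x (J (J y)) z v = - C u x y z v"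
    and C_tr: "(\<Sum>i=1..6. C u x y (E i) (J (E i))) = 0"
    and C_alt: "C u z x y v = C u x z y v + C u y x z v + C u v x y z"
    and C_type: "C u (J x) y z v + C u x (J y) z v + C u x y (J z) v + C u x y z (J v) = 0"
    and ricci: "C x y k l m - C y x k l m =
      - (\<Sum>f=1..6. R x y k (E f) * T (E f) l m + R x y l (E f) * T k (E f) m + R x y m (E f) * T k l (E f))
      - (\<Sum>f=1..6. T x y (E f) * B (E f) k l m)"
begin

lemma ricci_S: "C x y k l m - C y x k l m =
    - (S (\<lambda>f. R x y k f * T f l m) + S (\<lambda>f. R x y l f * T k f m) + S (\<lambda>f. R x y m f * T k l f))
    - S (\<lambda>f. T x y f * B f k l m)"
  unfolding ricci by (simp add: S_def sum.distrib)

text \<open>With \<open>C_alt\<close> and the vanishing traces, the summand is equal to the one in which \<open>j\<close> and \<open>J j\<close> change places, and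
  that substitution changes the sign of the sum over \<open>j\<close>.\<close>

lemma C_contraction: "S (\<lambda>i. S (\<lambda>j. C i j v (J i) (J j))) = 0"
proof -
  have tr: "S (\<lambda>j. C u x y j (J j)) = 0" for u x y
    using C_tr by (simp add: S_def)
  have "C i j v (J i) (J j) = - C i v (J i) j (J j) + C i (J i) v j (J j) + C i (J j) v (J i) j" for i j
    using C_alt[of i j v "J i" "J j"] C_skew(1)[of i v "J i" j "J j"] by simp
  then have "S (\<lambda>j. C i j v (J i) (J j)) = S (\<lambda>j. C i (J j) v (J i) j)" for i
    by (simp add: S_add S_diff S_minus tr)
  moreover have "S (\<lambda>j. C i (J j) v (J i) j) = - S (\<lambda>j. C i j v (J i) (J j))" for i
  proof (rule S_J1[of "\<lambda>a b. C i a v (J i) b"])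
    show "C i x v (J i) (J (J y)) = - C i x v (J i) y" for x y
      using C_skew C_JJ(3) by metis
  qed (rule C_JJ)
  ultimately have "S (\<lambda>j. C i j v (J i) (J j)) = 0" for i by (metis neg_equal_0_iff_equal equal_neg_zero)
  then show ?thesis by (simp add: S_0)
qed

text \<open>The Ricci identity, contracted so that its left-hand side vanishes by \<open>C_contraction\<close>. Of the three curvature
  terms, the instanton condition turns the first into \<open>curvature_contraction\<close>, and the other two are
  contractions of the symmetric Ricci tensor with \<open>T\<close>.\<close>

lemma w_eq_w': "w v = w' v"
proof -
  define c where "c = S (\<lambda>i. S (\<lambda>j. C i j v (J i) (J j)))"
  have "S (\<lambda>i. S (\<lambda>j. C j i v (J i) (J j))) = S (\<lambda>i. S (\<lambda>j. C i j v (J j) (J i)))" by (rule S_swap)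
  also have "\<dots> = - c"
    unfolding c_def by (subst C_skew(2)) (simp add: S_minus)
  finally have "S (\<lambda>i. S (\<lambda>j. C i j v (J i) (J j) - C j i v (J i) (J j))) = 2 * c"
    by (simp add: S_diff c_def)
  also have "\<dots> = 0" using C_contraction by (simp add: c_def)
  finally have 0: "S (\<lambda>i. S (\<lambda>j. S (\<lambda>f. R i j v f * T f (J i) (J j))))
      + S (\<lambda>i. S (\<lambda>j. S (\<lambda>f. R i j (J i) f * T v f (J j))))
      + S (\<lambda>i. S (\<lambda>j. S (\<lambda>f. R i j (J j) f * T v (J i) f)))
      + S (\<lambda>i. S (\<lambda>j. S (\<lambda>f. T i j f * B f v (J i) (J j)))) = 0"
    unfolding ricci_S by (simp add: S_diff S_add S_minus)
  have "S (\<lambda>i. S (\<lambda>j. S (\<lambda>f. R i j v f * T f (J i) (J j)))) = S (\<lambda>f. S (\<lambda>j. S (\<lambda>i. R i j v f * T f (J i) (J j))))"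
    by (subst S_swap, subst (2) S_swap, subst S_swap) simp
  also have "\<dots> = S (\<lambda>f. S (\<lambda>j. - S (\<lambda>i. R (J i) j v f * T f i (J j))))"
    using S_J1[of "\<lambda>a b. R a j v f * T f b (J j)" for j f] by (simp add: R_JJ T_JJ')
  also have "\<dots> = S (\<lambda>f. S (\<lambda>j. S (\<lambda>i. R i (J j) v f * T f i (J j))))"
    by (simp add: R_J12 S_minus)
  also have "\<dots> = S (\<lambda>f. S (\<lambda>i. S (\<lambda>j. R i (J j) v f * T f i (J j))))"
    by (subst (2) S_swap) simp
  also have "\<dots> = S (\<lambda>f. S (\<lambda>i. S (\<lambda>j. R i j v f * T f i j)))"
    using S_JJ[of "\<lambda>a b. R i a v f * T f i b" for i f] by (simp add: R_JJ' T_JJ')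
  also have "\<dots> = S (\<lambda>i. S (\<lambda>j. S (\<lambda>f. R i j v f * T f i j)))"
    by (subst S_swap, subst (2) S_swap) simp
  also have "\<dots> = Ct (\<lambda>i j k. R i j v k)"
    unfolding Ct_def by (subst T_cyc) (simp add: mult.commute)
  finally have 1: "S (\<lambda>i. S (\<lambda>j. S (\<lambda>f. R i j v f * T f (J i) (J j)))) = - w v"
    by (simp add: curvature_contraction)
  define Q where "Q = S (\<lambda>j. S (\<lambda>f. \<rho> j f * T v f (J j)))"
  have "S (\<lambda>i. S (\<lambda>j. S (\<lambda>f. R i j (J i) f * T v f (J j)))) = S (\<lambda>j. S (\<lambda>f. S (\<lambda>i. R i j (J i) f * T v f (J j))))"
    by (subst S_swap, subst (2) S_swap) simp
  then have 2: "S (\<lambda>i. S (\<lambda>j. S (\<lambda>f. R i j (J i) f * T v f (J j)))) = - Q"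
    by (simp add: S_multc S_R_J S_minus Q_def)
  have "S (\<lambda>j. R i j (J j) f) = \<rho> i f" for i f
  proof -
    have "S (\<lambda>j. R i j (J j) f) = - S (\<lambda>j. R j i (J j) f)"
      by (subst R_skew(1)) (simp add: S_minus)
    then show ?thesis by (simp add: S_R_J)
  qed
  moreover have "S (\<lambda>i. S (\<lambda>j. S (\<lambda>f. R i j (J j) f * T v (J i) f))) = S (\<lambda>i. S (\<lambda>f. S (\<lambda>j. R i j (J j) f * T v (J i) f)))"
    by (subst (2) S_swap) simp
  ultimately have 3: "S (\<lambda>i. S (\<lambda>j. S (\<lambda>f. R i j (J j) f * T v (J i) f))) = - Q"
    unfolding Q_def by (subst T_skew(2)) (simp add: S_multc S_minus)
  have "Q = S (\<lambda>f. S (\<lambda>j. \<rho> j f * T v f (J j)))" unfolding Q_def by (rule S_swap)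
  also have "\<dots> = S (\<lambda>f. - S (\<lambda>j. \<rho> (J j) f * T v f j))"
    using S_J1[of "\<lambda>a b. \<rho> a f * T v f b" for f] by (simp add: \<rho>_def R_JJ' T_JJ' S_minus)
  also have "\<dots> = - S (\<lambda>f. S (\<lambda>j. \<rho> (J j) f * T v f j))" by (simp add: S_minus)
  also have "S (\<lambda>f. S (\<lambda>j. \<rho> (J j) f * T v f j)) = 0"
    by (rule S_skew_sym) (rule T_skew, rule \<rho>_J_sym)
  finally have "Q = 0" by simp
  with 0 1 2 3 show ?thesis by (simp add: w'_def Ct_def)
qed

lemma w_0: "w v = 0"
  using w_eq_w'[of v] w_plus_w'[of v] by simp

lemma T_B_orthogonal: "Ct (\<lambda>i j k. B x i j k) = 0"
  using B_contraction w_0 by simp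

text \<open>By \<open>C_type\<close> the trace of \<open>C\<close> over its first two arguments is the action of \<open>J\<close> on the trace against \<open>J\<close>. The
  latter is half a commutator, whose curvature part vanishes for an instanton; the torsion part is a derivative
  of \<open>T\<close> along the vector \<open>\<tau>\<close>, which is orthogonal to \<open>T\<close>.\<close>

lemma rough_laplacian: "Ct (\<lambda>i j k. S (\<lambda>a. C a a i j k)) = 0"
proof -
  define c where "c i j k = S (\<lambda>a. C (J a) a i j k)" for i j k
  define \<tau> where "\<tau> f = S (\<lambda>a. T (J a) a f)" for f
  have c: "c i j k = - S (\<lambda>f. \<tau> f * B f i j k) / 2" for i j k
  proof -
    have "c i j k = - S (\<lambda>a. C a (J a) i j k)"
      unfolding c_def by (rule S_J1[of "\<lambda>a b. C a b i j k"]) (rule C_JJ)+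
    then have "2 * c i j k = S (\<lambda>a. C (J a) a i j k - C a (J a) i j k)"
      by (simp add: S_diff c_def)
    also have "\<dots> = - (S (\<lambda>a. S (\<lambda>f. R (J a) a i f * T f j k)) + S (\<lambda>a. S (\<lambda>f. R (J a) a j f * T i f k))
        + S (\<lambda>a. S (\<lambda>f. R (J a) a k f * T i j f))) - S (\<lambda>a. S (\<lambda>f. T (J a) a f * B f i j k))"
      unfolding ricci_S by (simp add: S_diff S_add S_minus)
    also have "S (\<lambda>a. S (\<lambda>f. R (J a) a i f * T f j k)) = 0"
      by (subst S_swap) (simp add: S_multc S_tr S_0)
    also have "S (\<lambda>a. S (\<lambda>f. R (J a) a j f * T i f k)) = 0"
      by (subst S_swap) (simp add: S_multc S_tr S_0)
    also have "S (\<lambda>a. S (\<lambda>f. R (J a) a k f * T i j f)) = 0"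
      by (subst S_swap) (simp add: S_multc S_tr S_0)
    also have "S (\<lambda>a. S (\<lambda>f. T (J a) a f * B f i j k)) = S (\<lambda>f. \<tau> f * B f i j k)"
      by (subst S_swap) (simp add: S_multc \<tau>_def)
    finally show ?thesis by simp
  qed
  have "S (\<lambda>a. C a a i j k) = - (c (J i) j k + c i (J j) k + c i j (J k))" for i j k
  proof -
    have "S (\<lambda>a. C a a i j k) = S (\<lambda>a. C (J a) (J a) i j k)"
      by (rule S_JJ[of "\<lambda>a b. C a b i j k", symmetric]) (rule C_JJ)+
    also have "\<dots> = S (\<lambda>a. - (C (J a) a (J i) j k + C (J a) a i (J j) k + C (J a) a i j (J k)))"
    proof (intro arg_cong[of _ _ S] ext)
      fix a
      show "C (J a) (J a) i j k = - (C (J a) a (J i) j k + C (J a) a i (J j) k + C (J a) a i j (J k))"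
        using C_type[of "J a" a i j k] by linarith
    qed
    finally show ?thesis by (simp add: S_add S_minus S_diff c_def)
  qed
  moreover have "c (J i) j k + c i (J j) k + c i j (J k) = S (\<lambda>f. \<tau> f / 2 * B (J f) i j k)" for i j k
  proof -
    have "c (J i) j k + c i (J j) k + c i j (J k) =
        S (\<lambda>f. - \<tau> f / 2 * (B f (J i) j k + B f i (J j) k + B f i j (J k)))"
    proof -
      have "S (\<lambda>f. - \<tau> f / 2 * (B f (J i) j k + B f i (J j) k + B f i j (J k))) =
          S (\<lambda>f. (- 1 / 2) * (\<tau> f * B f (J i) j k) + (- 1 / 2) * (\<tau> f * B f i (J j) k) + (- 1 / 2) * (\<tau> f * B f i j (J k)))"
        by (intro arg_cong[of _ _ S] ext) (simp add: field_simps)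
      then show ?thesis by (simp only: S_add S_cmult c)
    qed
    also have "\<dots> = S (\<lambda>f. \<tau> f / 2 * B (J f) i j k)"
    proof (intro arg_cong[of _ _ S] ext)
      fix f
      have "B f (J i) j k + B f i (J j) k + B f i j (J k) = - B (J f) i j k"
        using B_type[of f i j k] by simp
      then show "- \<tau> f / 2 * (B f (J i) j k + B f i (J j) k + B f i j (J k)) = \<tau> f / 2 * B (J f) i j k"
        by simp
    qed
    finally show ?thesis .
  qed
  ultimately have "Ct (\<lambda>i j k. S (\<lambda>a. C a a i j k)) = - S (\<lambda>f. Ct (\<lambda>i j k. \<tau> f / 2 * B (J f) i j k))"
    by (simp add: Ct_minus Ct_S)
  then show ?thesis by (simp only: Ct_cmult T_B_orthogonal) (simp add: S_0)
qed

text \<open>The assumption is the derivative of \<open>\<langle>B x, T\<rangle> = 0\<close>. Its trace is \<open>\<langle>\<Sum> C a a, T\<rangle> + \<bar>B\<bar>\<^sup>2\<close>, and the first summand is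
  zero.\<close>

lemma B_vanishes:
  assumes diff: "\<And>u x. (\<Sum>i=1..6. \<Sum>j=1..6. \<Sum>k=1..6.
      T (E i) (E j) (E k) * C u x (E i) (E j) (E k) + B u (E i) (E j) (E k) * B x (E i) (E j) (E k)) = 0"
    and a: "a \<in> {1..6}" and ijk: "i \<in> {1..6}" "j \<in> {1..6}" "k \<in> {1..6}"
  shows "B (E a) (E i) (E j) (E k) = 0"
proof -
  define N where "N x = S (\<lambda>i. S (\<lambda>j. S (\<lambda>k. (B x i j k)\<^sup>2)))" for x
  have "Ct (\<lambda>i j k. C x x i j k) + N x = 0" for x
    using diff[of x x] by (simp add: Ct_def N_def S_def sum.distrib power2_eq_square)
  then have "S (\<lambda>x. Ct (\<lambda>i j k. C x x i j k) + N x) = 0" by (simp add: S_0)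
  then have "S N = 0" using rough_laplacian by (simp add: S_add Ct_S)
  then show ?thesis
    unfolding N_def S_def using a ijk by (simp add: sum_nonneg_eq_0_iff sum_nonneg)
qed

end

text \<open>The Lefschetz map from 4-forms to 2-forms is injective in dimension six. In a unitary basis any four
  indices contain a pair \<open>e, J e\<close>: if there is only one such pair, the component is a trace, and the three
  components with two pairs are killed by three traces, each of which is the sum of two of them.\<close>

lemma (in torsion_point) al_basis_vanishes:
  assumes tr: "\<And>x y. S (\<lambda>i. al x y i (J i)) = 0" and ijkl: "i \<in> {1..6}" "j \<in> {1..6}" "k \<in> {1..6}" "l \<in> {1..6}"
  shows "al (E i) (E j) (E k) (E l) = 0"
proof -
  define a where "a i j k l = al (E i) (E j) (E k) (E l)" for i j k l
  have six: "{1..6::nat} = {1, 2, 3, 4, 5, 6}" by auto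
  have sk: "a j i k l = - a i j k l" "a i k j l = - a i j k l" "a i j l k = - a i j k l" for i j k l
    unfolding a_def by (rule al_skew)+
  have z: "a i i k l = 0" "a i j j l = 0" "a i j k k = 0" for i j k l
    using sk(1)[of i i k l] sk(2)[of i j j l] sk(3)[of i j k k] by auto
  have t: "a x y 1 2 + a x y 3 4 + a x y 5 6 = 0" for x y
  proof -
    have "al u v (J w) (J (J w)) = al u v w (J w)" for u v w
      using al_skew(3)[of u v w "J w"] by (simp add: al_def B_JJ B_JJ')
    then show ?thesis
      using tr[of "E x" "E y"] unfolding S_def six a_def by (simp add: E_J[simplified])
  qed
  have srt: "n < m \<Longrightarrow> a m n k l = - a n m k l" "n < m \<Longrightarrow> a k m n l = - a k n m l" "n < m \<Longrightarrow> a k l m n = - a k l n m" for m n k l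
    by (rule sk)+
  note r = srt z
  have z3: "a 1 2 3 4 = 0" "a 1 2 5 6 = 0" "a 3 4 5 6 = 0"
    using t[of 1 2] t[of 3 4] t[of 5 6] by (simp_all add: r)
  have z15: "a 1 3 5 6 = 0" "a 1 4 5 6 = 0" "a 2 3 5 6 = 0" "a 2 4 5 6 = 0"
    "a 1 3 4 5 = 0" "a 1 3 4 6 = 0" "a 2 3 4 5 = 0" "a 2 3 4 6 = 0"
    "a 1 2 3 5 = 0" "a 1 2 3 6 = 0" "a 1 2 4 5 = 0" "a 1 2 4 6 = 0"
    using t[of 1 3] t[of 1 4] t[of 2 3] t[of 2 4] t[of 1 5] t[of 1 6] t[of 2 5] t[of 2 6]
      t[of 3 5] t[of 3 6] t[of 4 5] t[of 4 6] by (simp_all add: r)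
  have sorted0: "a i j k l = 0" if "i \<in> {1..6}" "j \<in> {1..6}" "k \<in> {1..6}" "l \<in> {1..6}" "i < j" "j < k" "k < l" for i j k l
  proof -
    have "i \<in> {1, 2, 3}" "j \<in> {2, 3, 4}" "k \<in> {3, 4, 5}" "l \<in> {4, 5, 6}" using that by auto
    then show ?thesis using that(5-7) z3 z15 by (elim insertE emptyE) simp_all
  qed
  define f where "f is = \<bar>a (is ! 0) (is ! 1) (is ! 2) (is ! 3)\<bar>" for "is"
  have inv: "f xs = f ys" if "mset xs = mset ys" "length xs = 4" for xs ys
  proof (rule adjacent_swap_invariant[OF _ that])
    fix xs ys :: "nat list" and x y assume len: "length xs + length ys + 2 = 4"
    have two: "\<exists>c d. zs = [c, d]" if "length zs = 2" for zs :: "nat list"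
      using that by (auto simp: length_Suc_conv numeral_2_eq_2)
    have "length (xs @ ys) = 2" using len by simp
    then obtain c d where "xs @ ys = [c, d]" using two by blast
    then consider "xs = []" "ys = [c, d]" | "xs = [c]" "ys = [d]" | "xs = [c, d]" "ys = []"
      by (auto simp: append_eq_Cons_conv)
    then show "f (xs @ y # x # ys) = f (xs @ x # y # ys)"
    proof cases
      case 1 then show ?thesis using sk(1)[of y x c d] by (simp add: f_def eval_nat_numeral)
    next
      case 2 then show ?thesis using sk(2)[of c y x d] by (simp add: f_def eval_nat_numeral)
    next
      case 3 then show ?thesis using sk(3)[of c d y x] by (simp add: f_def eval_nat_numeral)
    qed
  qed
  let ?s = "sort [i, j, k, l]"
  have four: "\<exists>c d e f. zs = [c, d, e, f]" if "length zs = 4" for zs :: "nat list"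
    using that by (auto simp: length_Suc_conv eval_nat_numeral)
  have "length ?s = 4" by (simp only: length_sort) simp
  then obtain i' j' k' l' where s: "?s = [i', j', k', l']" using four by blast
  have "f [i, j, k, l] = f ?s" by (rule inv) simp_all
  moreover have "sorted ?s" by simp
  then have le: "i' \<le> j'" "j' \<le> k'" "k' \<le> l'" by (simp_all add: s del: sort_key_simps)
  moreover have "set ?s \<subseteq> {1..6}" using ijkl by simp
  then have "i' \<in> {1..6}" "j' \<in> {1..6}" "k' \<in> {1..6}" "l' \<in> {1..6}" by (simp_all add: s del: sort_key_simps set_sort)
  then have "a i' j' k' l' = 0"
    using sorted0[of i' j' k' l'] z le by (cases "i' = j'"; cases "j' = k'"; cases "k' = l'") auto
  ultimately show ?thesis unfolding s by (simp add: f_def a_def)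
qed

section \<open>Instantons and parallel torsion\<close>

context acyt
begin

lemma sum_fun_apply: "(\<Sum>i\<in>I. f i) q = (\<Sum>i\<in>I. f i q)" for f :: "'i \<Rightarrow> 'a \<Rightarrow> real"
  by (induction I rule: infinite_finite_induct) auto

lemma covector_at_diff: "covector_at A p f \<Longrightarrow> covector_at A p h \<Longrightarrow> covector_at A p (\<lambda>x. f x - h x)"
  by (auto simp: covector_at_def algebra_simps)

lemma covector_at_cmult: "covector_at A p f \<Longrightarrow> covector_at A p (\<lambda>x. c * f x)"
  and covector_at_multc: "covector_at A p f \<Longrightarrow> covector_at A p (\<lambda>x. f x * c)"
  by (auto simp: covector_at_def algebra_simps)

lemma covector_vanishes:
  assumes "covector_at A p h" "orthonormal_at A g p E" "X \<in> vf" "\<And>i. i \<in> {1..6} \<Longrightarrow> h (E i) = 0"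
  shows "h X = 0"
  using covector_expand[OF assms(1-3)] assms(4) by simp

lemma B_minus:
  assumes "X \<in> vf" "Y \<in> vf" "Z \<in> vf" "V \<in> vf"
  shows "B (- X) Y Z V = - B X Y Z V" "B X (- Y) Z V = - B X Y Z V" "B X Y (- Z) V = - B X Y Z V"
    "B X Y Z (- V) = - B X Y Z V"
  using covector_minus[OF B_covector1 assms(1)] covector_minus[OF B_covector2 assms(2)]
    covector_minus[OF B_covector3 assms(3)] covector_minus[OF B_covector4 assms(4)] assms
  by (auto simp: fun_eq_iff)

text \<open>The pointwise algebra is applied to functions on all of the type of vector fields; arguments that are
  not vector fields are replaced by \<open>0\<close>.\<close>

definition pr :: "'a vfield \<Rightarrow> 'a vfield" where "pr X = (if X \<in> vf then X else 0)"

lemma pr_vf [simp, intro]: "pr X \<in> vf"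
  and pr_id [simp]: "X \<in> vf \<Longrightarrow> pr X = X"
  by (auto simp: pr_def)

abbreviation "J' X \<equiv> J (pr X)"
abbreviation "T' p X Y Z \<equiv> T (pr X) (pr Y) (pr Z) p"
abbreviation "B' p X Y Z V \<equiv> B (pr X) (pr Y) (pr Z) (pr V) p"
abbreviation "R' p X Y Z V \<equiv> R (pr X) (pr Y) (pr Z) (pr V) p"
abbreviation "C' p U X Y Z V \<equiv> C (pr U) (pr X) (pr Y) (pr Z) (pr V) p"

lemma torsion_point_at:
  assumes E: "positive_basis_at A g J p E"
  shows "torsion_point J' E (T' p) (B' p) (R' p)"
proof
  note on = positive_basisD(1)[OF E]
  have vf: "E i \<in> vf" if "i \<in> {1..6}" for i using orthonormal_atD(1)[OF on that] .
  then have "E 1 \<in> vf" "E 3 \<in> vf" "E 5 \<in> vf" by auto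
  then show "E 2 = J' (E 1)" "E 4 = J' (E 3)" "E 6 = J' (E 5)"
    using positive_basisD(2-4)[OF E] by simp_all
  fix x y z v
  show "T' p y x z = - T' p x y z" "T' p x z y = - T' p x y z"
    using T_skew[of "pr x" "pr y" "pr z"] by simp_all
  show "T' p (J' (J' x)) y z = - T' p x y z" by (simp add: T_minus)
  show "B' p x z y v = - B' p x y z v" "B' p x y v z = - B' p x y z v"
    using B_skew[of "pr x" "pr y" "pr z" "pr v"] by simp_all
  show "B' p (J' (J' x)) y z v = - B' p x y z v" "B' p x (J' (J' y)) z v = - B' p x y z v"
    by (simp_all add: B_minus)
  show "R' p y x z v = - R' p x y z v" "R' p x y v z = - R' p x y z v"
    using R_skew12[of "pr x" "pr y" "pr z" "pr v"] R_skew34[of "pr x" "pr y" "pr z" "pr v"] by simp_all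
  show "R' p (J' (J' x)) y z v = - R' p x y z v" by (simp add: R_minus1)
  show "R' p x y (J' (J' z)) v = - R' p x y z v"
    using covector_minus[OF R_covector3[of "pr x" "pr y" "pr v"], of "pr z" p] by simp
  have ex: "T (tor (pr x) (pr y)) (pr z) (pr v) p = (\<Sum>f=1..6. T' p x y (E f) * T' p (E f) z v)" for x y z v
    using T_tor_expand[of "pr x" "pr y" "pr z" "pr v", OF _ _ _ _ on] vf by simp
  show "R' p x y z v + R' p y z x v + R' p z x y v = B' p x y z v + B' p y z x v + B' p z x y v +
      (\<Sum>f=1..6. T' p x y (E f) * T' p (E f) z v + T' p y z (E f) * T' p (E f) x v + T' p z x (E f) * T' p (E f) y v)"
    using fun_cong[OF bianchi[of "pr x" "pr y" "pr z" "pr v"], of p] by (simp add: ex sum.distrib)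
qed

lemma positive_basis_exists: obtains E where "positive_basis_at A g J p E"
proof -
  obtain W F where "p \<in> W" "unitary_frame W F"
    by (rule unitary_frame_exists[of p]) (rule that; assumption)
  then show ?thesis using that unfolding unitary_frame_def by blast
qed

lemma parallel_torsion_imp_instanton:
  assumes par: "parallel A D 3 (torsion g D)"
  shows "su3_instanton A g J D"
proof -
  have B0: "B X Y Z V = 0" if "X \<in> vf" "Y \<in> vf" "Z \<in> vf" "V \<in> vf" for X Y Z V
    using par that unfolding parallel_def by simp
  have pair: "R X Y Z V p = R Z V X Y p"
    if v: "X \<in> vf" "Y \<in> vf" "Z \<in> vf" "V \<in> vf" for X Y Z V p
  proof -
    obtain E where E: "positive_basis_at A g J p E" by (rule positive_basis_exists)
    interpret pt: torsion_point J' E "T' p" "B' p" "R' p" by (rule torsion_point_at[OF E])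
    have "pt.al z x y v = 0" for z x y v unfolding pt.al_def by (simp add: B0)
    from pt.pair_difference[OF this, of X Z V Y] show ?thesis using v by (simp add: B0)
  qed
  show ?thesis
    unfolding su3_instanton_def
  proof (intro ballI conjI allI impI)
    fix Z V assume Z: "Z \<in> vf" and V: "V \<in> vf"
    show "curvature g D [J X, J Y, Z, V] = curvature g D [X, Y, Z, V]"
      if X: "X \<in> vf" and Y: "Y \<in> vf" for X Y
    proof
      fix p
      have "R (J X) (J Y) Z V p = R Z V (J X) (J Y) p" using X Y Z V by (intro pair) auto
      also have "\<dots> = R Z V X Y p"
        using R_J34[OF Z V X, of "J Y"] covector_minus[OF R_covector4[OF Z V X] Y, of p] X Y by simp
      also have "\<dots> = R X Y Z V p" using X Y Z V by (intro pair) auto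
      finally show "R (J X) (J Y) Z V p = R X Y Z V p" .
    qed
    fix p E assume E: "orthonormal_at A g p E"
    have "(\<Sum>i=1..6. curvature g D [E i, J (E i), Z, V] p) = (\<Sum>i=1..6. R Z V (E i) (J (E i)) p)"
      using orthonormal_atD(1)[OF E] Z V by (intro sum.cong pair) auto
    then show "(\<Sum>i=1..6. curvature g D [E i, J (E i), Z, V] p) = 0"
      using R_trace34[OF Z V E] by simp
  qed
qed

text \<open>Locally the codifferential is a trace of \<open>T\<close> over a smooth frame. Therefore it is smooth and can be
  differentiated term by term, and by \<open>frame_rotation\<close> its covariant derivative is the trace of \<open>B\<close>. The Lee
  form is evaluated at \<open>J Z\<close> to undo the \<open>J\<close> in its definition.\<close>

lemma parallel_lee_imp_trace_B:
  assumes lee: "parallel A D 1 (lee_form A g J)" and X: "X \<in> vf" and Z: "Z \<in> vf"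
    and E: "orthonormal_at A g p E"
  shows "(\<Sum>i=1..6. B X Z (E i) (J (E i)) p) = 0"
proof -
  define h where "h Y = codiff A g J (kaehler_form g J) [Y]" for Y
  have h: "h Y q = - 1 / 2 * (\<Sum>i=1..6. T Y (F i) (J (F i)) q)"
    if "Y \<in> vf" "orthonormal_at A g q F" for Y q F
    unfolding h_def by (rule codifferential_kaehler[OF that])
  obtain W F where F: "p \<in> W" "unitary_frame W F"
    by (rule unitary_frame_exists[of p]) (rule that; assumption)
  note F1 = unitary_frameD[OF F(2)]
  note Fvf = F1(3)[OF F(1)]
  have sm: "smooth_fun A (h Y)" if Y: "Y \<in> vf" for Y
  proof (rule smooth_fun_on_local)
    fix q
    obtain W G where G: "q \<in> W" "unitary_frame W G"
      by (rule unitary_frame_exists[of q]) (rule that; assumption)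
    note G1 = unitary_frameD[OF G(2)]
    have "smooth_fun A (\<lambda>r. - 1 / 2 * (\<Sum>i=1..6. T Y (G i) (J (G i)) r))"
      using Y G1(3)[OF G(1)] by (intro smooth_fun_on_mult smooth_fun_on_sum open_UNIV smooth_fun_on_const) auto
    then show "\<exists>W' k. open W' \<and> q \<in> W' \<and> smooth_fun_on A W' k \<and> (\<forall>r\<in>W'. h Y r = k r)"
      using h[OF Y G1(1)] G(1) G1(2) smooth_fun_on_subset[of UNIV _ W] by blast
  qed
  have hneg: "h (- Y) = - h Y" if Y: "Y \<in> vf" for Y
  proof
    fix q
    obtain G where "positive_basis_at A g J q G" by (rule positive_basis_exists)
    then have G: "orthonormal_at A g q G" by (rule positive_basisD)
    show "h (- Y) q = (- h Y) q"
      using h[OF vfields_minus[OF Y] G] h[OF Y G] T_minus(1)[OF Y] orthonormal_atD(1)[OF G]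
      by (simp add: sum_negf)
  qed
  have par: "X (h Z) = h (D X Z)"
  proof -
    have "cov_deriv D X (lee_form A g J) [J Z] = 0"
      using lee X Z unfolding parallel_def by simp
    then have "X (lee_form A g J [J Z]) = lee_form A g J [J (D X Z)]"
      using X Z by (simp add: cov_deriv_def D_J)
    moreover have "lee_form A g J [J Y] = - h Y" if "Y \<in> vf" for Y
      using hneg[OF that] that by (simp add: lee_form_def h_def)
    ultimately show ?thesis using X Z sm vf_minus[OF X sm[OF Z]] by simp
  qed
  let ?k = "(\<lambda>_. - 1 / 2) * (\<Sum>i=1..6. T Z (F i) (J (F i)))"
  have ks: "smooth_fun A (\<Sum>i=1..6. T Z (F i) (J (F i)))"
    by (rule vf_sum(2)[OF X]) (use Z Fvf in auto)
  have "X (h Z) p = X ?k p"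
    by (rule vf_local[OF X sm[OF Z] _ F1(2) F(1)]) (use ks h[OF Z F1(1)] in \<open>auto simp: sum_fun_apply\<close>)
  also have "X ?k = (\<lambda>_. - 1 / 2) * (\<Sum>i=1..6. X (T Z (F i) (J (F i))))"
    unfolding vf_cmult[OF X ks] by (subst vf_sum(1)[OF X]) (use Z Fvf in auto)
  finally have 1: "X (h Z) p = - 1 / 2 * (\<Sum>i=1..6. X (T Z (F i) (J (F i))) p)"
    by (simp add: sum_fun_apply)
  have 2: "(\<Sum>i=1..6. T Z (D X (F i)) (J (F i)) p + T Z (F i) (J (D X (F i))) p) = 0"
    by (rule frame_rotation[OF F(2,1) X, where h = "\<lambda>x y. T Z x (J y) p"])
      (use Z T_covector(2)[OF Z] T_covector(3)[OF Z, THEN J_covector] in auto)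
  have "(\<Sum>i=1..6. B X Z (F i) (J (F i)) p) =
      (\<Sum>i=1..6. X (T Z (F i) (J (F i))) p) - (\<Sum>i=1..6. T (D X Z) (F i) (J (F i)) p)
      - (\<Sum>i=1..6. T Z (D X (F i)) (J (F i)) p + T Z (F i) (J (D X (F i))) p)"
    unfolding sum_subtractf[symmetric] using X Fvf by (intro sum.cong refl) (simp add: B_eq D_J)
  also have "\<dots> = 0"
    using 1 2 fun_cong[OF par, of p] h[OF D_vf[OF X Z] F1(1)[OF F(1)]] by simp
  finally have "(\<Sum>i=1..6. B X Z (F i) (J (F i)) p) = 0" .
  moreover have "(\<Sum>i=1..6. B X Z (E i) (J (E i)) p) = (\<Sum>i=1..6. B X Z (F i) (J (F i)) p)"
    using trace_indep[where h = "\<lambda>x y. B X Z x (J y) p", OF _ _ F1(1)[OF F(1)] E]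
      B_covector3[OF X Z] B_covector4[OF X Z, THEN J_covector] by simp
  ultimately show ?thesis by simp
qed

context
  assumes inst: "su3_instanton A g J D" and lee: "parallel A D 1 (lee_form A g J)"
begin

lemma instanton_point_at:
  assumes E: "positive_basis_at A g J p E"
  shows "instanton_point J' E (T' p) (B' p) (R' p)"
proof -
  interpret pt: torsion_point J' E "T' p" "B' p" "R' p" by (rule torsion_point_at[OF E])
  note on = positive_basisD(1)[OF E]
  have vf: "E i \<in> vf" if "i \<in> {1..6}" for i using orthonormal_atD(1)[OF on that] .
  show ?thesis
  proof
    fix x y z v
    have "R (J (pr x)) (J (J (pr y))) (pr z) (pr v) = R (pr x) (J (pr y)) (pr z) (pr v)"
      using inst unfolding su3_instanton_def by (meson J_vf pr_vf)
    then have "R (pr x) (J (pr y)) (pr z) (pr v) = R (J (pr x)) (- pr y) (pr z) (pr v)" by simp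
    also have "\<dots> = - R (J (pr x)) (pr y) (pr z) (pr v)"
      using R_skew12[of "- pr y" "J (pr x)" "pr z" "pr v"] R_skew12[of "pr y" "J (pr x)" "pr z" "pr v"]
        R_minus1[of "pr y" "J (pr x)" "pr z" "pr v"] by simp
    finally show "R' p (J' x) y z v = - R' p x (J' y) z v" by simp
    show "R' p x y (J' z) v = - R' p x y z (J' v)" by (simp add: R_J34)
    show "(\<Sum>i=1..6. R' p (E i) (J' (E i)) z v) = 0"
      using inst on vf unfolding su3_instanton_def by simp
    show "(\<Sum>i=1..6. R' p x y (E i) (J' (E i))) = 0"
      using R_trace34[OF _ _ on, of "pr x" "pr y"] vf by simp
    show "(\<Sum>i=1..6. B' p x y (E i) (J' (E i))) = 0"
      using parallel_lee_imp_trace_B[OF lee _ _ on, of "pr x" "pr y"] vf by simp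
  qed
qed

lemma closed_instanton_point_at:
  assumes E: "positive_basis_at A g J p E"
  shows "closed_instanton_point J' E (T' p) (B' p) (R' p)"
proof -
  interpret pt: instanton_point J' E "T' p" "B' p" "R' p" by (rule instanton_point_at[OF E])
  note on = positive_basisD(1)[OF E]
  have vf: "E i \<in> vf" if "i \<in> {1..6}" for i using orthonormal_atD(1)[OF on that] .
  have cov: "covector_at A p (\<lambda>z. pt.al z (pr x) (pr y) (pr v))" for x y v
  proof -
    have "covector_at A p (\<lambda>z. B z (pr x) (pr y) (pr v) p - B (pr x) z (pr y) (pr v) p - B (pr y) (pr x) z (pr v) p - B (pr v) (pr x) (pr y) z p)"
      by (intro covector_at_diff B_covector1 B_covector2 B_covector3 B_covector4 pr_vf)
    then show ?thesis by (simp add: covector_at_def pt.al_def)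
  qed
  have sl: "pt.al z (pr x) (pr y) (pr v) = 0" if "z \<in> vf" "\<And>i. i \<in> {1..6} \<Longrightarrow> pt.al (E i) (pr x) (pr y) (pr v) = 0" for z x y v
    by (rule covector_vanishes[where h = "\<lambda>z. pt.al z (pr x) (pr y) (pr v)", OF cov on]) (fact that)+
  have cyc: "pt.al x y v z = - pt.al z x y v" for x y z v
    using pt.al_skew(1)[of x z y v] pt.al_skew(2)[of x y z v] pt.al_skew(3)[of x y v z] by linarith
  have 1: "pt.al z (E j) (E k) (E l) = 0" if "z \<in> vf" "j \<in> {1..6}" "k \<in> {1..6}" "l \<in> {1..6}" for z j k l
    using sl[of z "E j" "E k" "E l"] pt.al_basis_vanishes[OF pt.al_trace_and_rho(1)] that vf by simp
  have 2: "pt.al z (E k) (E l) y = 0" if "z \<in> vf" "y \<in> vf" "k \<in> {1..6}" "l \<in> {1..6}" for z y k l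
  proof -
    have "pt.al (E i) (E k) (E l) y = 0" if "i \<in> {1..6}" for i
      using cyc[of "E i" "E k" "E l" y] 1[OF \<open>y \<in> vf\<close> that] \<open>k \<in> {1..6}\<close> \<open>l \<in> {1..6}\<close> by simp
    then show ?thesis using sl[of z "E k" "E l" y] that vf by simp
  qed
  have 3: "pt.al z (E l) y v = 0" if "z \<in> vf" "y \<in> vf" "v \<in> vf" "l \<in> {1..6}" for z y v l
  proof -
    have "pt.al (E i) (E l) y v = 0" if "i \<in> {1..6}" for i
      using cyc[of "E i" "E l" y v] 2[OF \<open>v \<in> vf\<close> \<open>y \<in> vf\<close> that \<open>l \<in> {1..6}\<close>] by simp
    then show ?thesis using sl[of z "E l" y v] that vf by simp
  qed
  have 4: "pt.al z x y v = 0" if "z \<in> vf" "x \<in> vf" "y \<in> vf" "v \<in> vf" for z x y v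
  proof -
    have "pt.al (E i) x y v = 0" if "i \<in> {1..6}" for i
      using cyc[of "E i" x y v] 3[OF \<open>v \<in> vf\<close> \<open>x \<in> vf\<close> \<open>y \<in> vf\<close> that] by simp
    then show ?thesis using sl[of z x y v] that vf by simp
  qed
  show ?thesis
  proof
    fix z x y v
    show "pt.al z x y v = 0" using 4[of "pr z" "pr x" "pr y" "pr v"] by (simp add: pt.al_def)
  qed
qed

lemma B_alternation:
  assumes "Z \<in> vf" "X \<in> vf" "Y \<in> vf" "V \<in> vf"
  shows "B Z X Y V = B X Z Y V + B Y X Z V + B V X Y Z"
proof
  fix p
  obtain E where E: "positive_basis_at A g J p E" by (rule positive_basis_exists)
  interpret pt: closed_instanton_point J' E "T' p" "B' p" "R' p" by (rule closed_instanton_point_at[OF E])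
  show "B Z X Y V p = (B X Z Y V + B Y X Z V + B V X Y Z) p"
    using pt.B_alt[of Z X Y V] assms by simp
qed

lemma B_charge:
  assumes "X \<in> vf" "Y \<in> vf" "Z \<in> vf" "V \<in> vf"
  shows "B (J X) Y Z V + B X (J Y) Z V + B X Y (J Z) V + B X Y Z (J V) = 0"
proof
  fix p
  obtain E where E: "positive_basis_at A g J p E" by (rule positive_basis_exists)
  interpret pt: closed_instanton_point J' E "T' p" "B' p" "R' p" by (rule closed_instanton_point_at[OF E])
  show "(B (J X) Y Z V + B X (J Y) Z V + B X Y (J Z) V + B X Y Z (J V)) p = 0 p"
    using pt.B_type[of X Y Z V] assms by simp
qed

text \<open>Linear identities of \<open>B\<close> that hold at every point can be differentiated, and \<open>D\<close> commutes with \<open>J\<close>; the trace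
  identity is differentiated in a unitary frame.\<close>

lemma second_order_point_at:
  assumes F: "unitary_frame W F" and p: "p \<in> W"
  shows "second_order_point J' F (T' p) (B' p) (R' p) (C' p)"
proof -
  note F1 = unitary_frameD[OF F]
  note Fvf = F1(3)[OF p] and on = F1(1)[OF p]
  have pb: "positive_basis_at A g J q F" if "q \<in> W" for q using F that by (simp add: unitary_frame_def)
  interpret pt: closed_instanton_point J' F "T' p" "B' p" "R' p" by (rule closed_instanton_point_at[OF pb[OF p]])
  show ?thesis
  proof
    fix u x y z v
    note U = pr_vf[of u] and v5 = pr_vf[of u] pr_vf[of x] pr_vf[of y] pr_vf[of z] pr_vf[of v]
    let ?u = "pr u" and ?x = "pr x" and ?y = "pr y" and ?z = "pr z" and ?v = "pr v"
    show "C' p u x z y v = - C' p u x y z v"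
      using vf_minus[OF U B_smooth[OF v5(2-5)]] B_skew(1)[OF v5(2-5)] B_skew(1)[of "D ?u ?x" ?y ?z ?v]
        B_skew(1)[of ?x "D ?u ?y" ?z ?v] B_skew(1)[of ?x ?y "D ?u ?z" ?v] B_skew(1)[of ?x ?y ?z "D ?u ?v"]
      by (simp add: C_def)
    show "C' p u x y v z = - C' p u x y z v"
      using vf_minus[OF U B_smooth[OF v5(2-5)]] B_skew(2)[OF v5(2-5)] B_skew(2)[of "D ?u ?x" ?y ?z ?v]
        B_skew(2)[of ?x "D ?u ?y" ?z ?v] B_skew(2)[of ?x ?y "D ?u ?z" ?v] B_skew(2)[of ?x ?y ?z "D ?u ?v"]
      by (simp add: C_def)
    show "C' p (J' (J' u)) x y z v = - C' p u x y z v"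
      by (simp add: C_def D_minus1 B_minus)
    show "C' p u (J' (J' x)) y z v = - C' p u x y z v" "C' p u x (J' (J' y)) z v = - C' p u x y z v"
      by (simp_all add: C_def D_minus2 B_minus vf_minus[OF U])
    show "(\<Sum>i=1..6. C' p u x y (F i) (J' (F i))) = 0"
    proof -
      have tr: "(\<Sum>i=1..6. B X Y (F i) (J (F i)) q) = 0" if "X \<in> vf" "Y \<in> vf" "q \<in> W" for X Y q
        by (rule parallel_lee_imp_trace_B[OF lee that(1,2) F1(1)[OF that(3)]])
      have ks: "smooth_fun A (\<Sum>i=1..6. B ?x ?y (F i) (J (F i)))"
        by (rule vf_sum(2)[OF U]) (use Fvf in auto)
      have "?u (\<Sum>i=1..6. B ?x ?y (F i) (J (F i))) p = ?u 0 p"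
        by (rule vf_local[OF U ks _ F1(2) p]) (use tr in \<open>auto simp: sum_fun_apply\<close>)
      then have 1: "(\<Sum>i=1..6. ?u (B ?x ?y (F i) (J (F i))) p) = 0"
        using vf_sum(1)[OF U, of "{1..6}" "\<lambda>i. B ?x ?y (F i) (J (F i))"] Fvf vf_zero[OF U] by (simp add: sum_fun_apply)
      have 2: "(\<Sum>i=1..6. B ?x ?y (D ?u (F i)) (J (F i)) p + B ?x ?y (F i) (J (D ?u (F i))) p) = 0"
        by (rule frame_rotation[OF F p U, where h = "\<lambda>a b. B ?x ?y a (J b) p"])
          (use B_covector3[of ?x ?y] B_covector4[of ?x ?y, THEN J_covector] in auto)
      have "(\<Sum>i=1..6. C' p u x y (F i) (J' (F i))) = (\<Sum>i=1..6. ?u (B ?x ?y (F i) (J (F i))) p)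
        - (\<Sum>i=1..6. B (D ?u ?x) ?y (F i) (J (F i)) p) - (\<Sum>i=1..6. B ?x (D ?u ?y) (F i) (J (F i)) p)
        - (\<Sum>i=1..6. B ?x ?y (D ?u (F i)) (J (F i)) p + B ?x ?y (F i) (J (D ?u (F i))) p)"
        unfolding sum_subtractf[symmetric] using Fvf by (intro sum.cong refl) (simp add: C_def D_J)
      then show ?thesis using 1 2 tr[OF _ _ p] by simp
    qed
    show "C' p u z x y v = C' p u x z y v + C' p u y x z v + C' p u v x y z"
    proof -
      have "?u (B ?z ?x ?y ?v) = ?u (B ?x ?z ?y ?v) + ?u (B ?y ?x ?z ?v) + ?u (B ?v ?x ?y ?z)"
        unfolding B_alternation[OF v5(4,2,3,5)] by (simp add: vf_add[OF U])
      from fun_cong[OF this, of p] fun_cong[OF B_alternation[of "D ?u ?z" ?x ?y ?v], of p]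
        fun_cong[OF B_alternation[of ?z "D ?u ?x" ?y ?v], of p] fun_cong[OF B_alternation[of ?z ?x "D ?u ?y" ?v], of p]
        fun_cong[OF B_alternation[of ?z ?x ?y "D ?u ?v"], of p]
      show ?thesis by (simp add: C_def)
    qed
    show "C' p u (J' x) y z v + C' p u x (J' y) z v + C' p u x y (J' z) v + C' p u x y z (J' v) = 0"
    proof -
      have "?u (B (J ?x) ?y ?z ?v + B ?x (J ?y) ?z ?v + B ?x ?y (J ?z) ?v + B ?x ?y ?z (J ?v)) = 0"
        unfolding B_charge[OF v5(2-5)] by (rule vf_zero[OF U])
      then have "?u (B (J ?x) ?y ?z ?v) + ?u (B ?x (J ?y) ?z ?v) + ?u (B ?x ?y (J ?z) ?v) + ?u (B ?x ?y ?z (J ?v)) = 0"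
        by (simp add: vf_add[OF U])
      from fun_cong[OF this, of p] fun_cong[OF B_charge[of "D ?u ?x" ?y ?z ?v], of p]
        fun_cong[OF B_charge[of ?x "D ?u ?y" ?z ?v], of p] fun_cong[OF B_charge[of ?x ?y "D ?u ?z" ?v], of p]
        fun_cong[OF B_charge[of ?x ?y ?z "D ?u ?v"], of p]
      show ?thesis by (simp add: C_def D_J)
    qed
  next
    fix x y k l m
    let ?x = "pr x" and ?y = "pr y" and ?k = "pr k" and ?l = "pr l" and ?m = "pr m"
    have t: "T (Rv ?x ?y ?k) ?l ?m p = (\<Sum>f=1..6. R' p x y k (F f) * T' p (F f) l m)"
      "T ?k (Rv ?x ?y ?l) ?m p = (\<Sum>f=1..6. R' p x y l (F f) * T' p k (F f) m)"
      "T ?k ?l (Rv ?x ?y ?m) p = (\<Sum>f=1..6. R' p x y m (F f) * T' p k l (F f))"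
      "B (tor ?x ?y) ?k ?l ?m p = (\<Sum>f=1..6. T' p x y (F f) * B' p (F f) k l m)"
      using covector_expand[OF T_covector(1)[of ?l ?m] on, of "Rv ?x ?y ?k"]
        covector_expand[OF T_covector(2)[of ?k ?m] on, of "Rv ?x ?y ?l"]
        covector_expand[OF T_covector(3)[of ?k ?l] on, of "Rv ?x ?y ?m"]
        covector_expand[OF B_covector1[of ?k ?l ?m] on, of "tor ?x ?y"] Fvf
      by (simp_all add: R_eq T_eq[of ?x ?y])
    show "C' p x y k l m - C' p y x k l m =
      - (\<Sum>f=1..6. R' p x y k (F f) * T' p (F f) l m + R' p x y l (F f) * T' p k (F f) m + R' p x y m (F f) * T' p k l (F f))
      - (\<Sum>f=1..6. T' p x y (F f) * B' p (F f) k l m)"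
      using fun_cong[OF ricci_identity[of ?x ?y ?k ?l ?m], of p] by (simp add: t sum.distrib)
  qed
qed

lemma torsion_orthogonal:
  assumes F: "unitary_frame W F" and p: "p \<in> W" and X: "X \<in> vf"
  shows "(\<Sum>i=1..6. \<Sum>j=1..6. \<Sum>k=1..6. T (F i) (F j) (F k) p * B X (F i) (F j) (F k) p) = 0"
proof -
  interpret pt: second_order_point J' F "T' p" "B' p" "R' p" "C' p" by (rule second_order_point_at[OF F p])
  have "F i \<in> vf" if "i \<in> {1..6}" for i using unitary_frameD(3)[OF F p that] .
  then show ?thesis
    using pt.T_B_orthogonal[of X] X by (simp add: pt.Ct_def pt.S_def)
qed

text \<open>The product rule; the terms in which the frame is differentiated cancel by \<open>frame_rotation\<close> in each of the
  three indices, and those with \<open>D U X\<close> vanish by \<open>torsion_orthogonal\<close>.\<close>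

lemma torsion_orthogonal_derivative:
  assumes F: "unitary_frame W F" and p: "p \<in> W" and U: "U \<in> vf" and X: "X \<in> vf"
  shows "(\<Sum>i=1..6. \<Sum>j=1..6. \<Sum>k=1..6. T (F i) (F j) (F k) p * C U X (F i) (F j) (F k) p
    + B U (F i) (F j) (F k) p * B X (F i) (F j) (F k) p) = 0"
proof -
  note F1 = unitary_frameD[OF F]
  note Fvf = F1(3)[OF p]
  let ?I = "{1..6::nat}"
  let ?G = "\<lambda>i j k. T (F i) (F j) (F k) * B X (F i) (F j) (F k)"
  have sm: "smooth_fun A (\<Sum>k\<in>?I. ?G i j k)" "smooth_fun A (\<Sum>j\<in>?I. \<Sum>k\<in>?I. ?G i j k)"
    if "i \<in> ?I" "j \<in> ?I" for i j
    using Fvf X that by (intro vf_sum(2)[OF U] smooth_fun_simps T_smooth B_smooth; simp)+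
  have sm3: "smooth_fun A (\<Sum>i\<in>?I. \<Sum>j\<in>?I. \<Sum>k\<in>?I. ?G i j k)"
    by (rule vf_sum(2)[OF U]) (use sm in auto)
  have "U (\<Sum>i\<in>?I. \<Sum>j\<in>?I. \<Sum>k\<in>?I. ?G i j k) p = U 0 p"
    by (rule vf_local[OF U sm3 _ F1(2) p]) (use torsion_orthogonal[OF F _ X] in \<open>auto simp: sum_fun_apply\<close>)
  moreover have "U (\<Sum>i\<in>?I. \<Sum>j\<in>?I. \<Sum>k\<in>?I. ?G i j k) = (\<Sum>i\<in>?I. \<Sum>j\<in>?I. \<Sum>k\<in>?I. U (?G i j k))"
  proof -
    have "U (\<Sum>i\<in>?I. \<Sum>j\<in>?I. \<Sum>k\<in>?I. ?G i j k) = (\<Sum>i\<in>?I. U (\<Sum>j\<in>?I. \<Sum>k\<in>?I. ?G i j k))"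
      by (rule vf_sum(1)[OF U]) (use sm in auto)
    also have "\<dots> = (\<Sum>i\<in>?I. \<Sum>j\<in>?I. U (\<Sum>k\<in>?I. ?G i j k))"
      by (intro sum.cong[OF refl] vf_sum(1)[OF U]) (use sm in auto)
    also have "\<dots> = (\<Sum>i\<in>?I. \<Sum>j\<in>?I. \<Sum>k\<in>?I. U (?G i j k))"
      by (intro sum.cong[OF refl] vf_sum(1)[OF U]) (use Fvf X in auto)
    finally show ?thesis .
  qed
  ultimately have 0: "(\<Sum>i\<in>?I. \<Sum>j\<in>?I. \<Sum>k\<in>?I. U (?G i j k) p) = 0"
    by (simp add: sum_fun_apply vf_zero[OF U])
  define c where "c i j k = T (F i) (F j) (F k) p * C U X (F i) (F j) (F k) p + B U (F i) (F j) (F k) p * B X (F i) (F j) (F k) p" for i j k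
  define r1 where "r1 i j k = T (D U (F i)) (F j) (F k) p * B X (F i) (F j) (F k) p + T (F i) (F j) (F k) p * B X (D U (F i)) (F j) (F k) p" for i j k
  define r2 where "r2 i j k = T (F i) (D U (F j)) (F k) p * B X (F i) (F j) (F k) p + T (F i) (F j) (F k) p * B X (F i) (D U (F j)) (F k) p" for i j k
  define r3 where "r3 i j k = T (F i) (F j) (D U (F k)) p * B X (F i) (F j) (F k) p + T (F i) (F j) (F k) p * B X (F i) (F j) (D U (F k)) p" for i j k
  have "U (?G i j k) p = c i j k + T (F i) (F j) (F k) p * B (D U X) (F i) (F j) (F k) p + r1 i j k + r2 i j k + r3 i j k"
    if "i \<in> ?I" "j \<in> ?I" "k \<in> ?I" for i j k
  proof -
    have v: "F i \<in> vf" "F j \<in> vf" "F k \<in> vf" using Fvf that by auto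
    have "U (T (F i) (F j) (F k)) p = B U (F i) (F j) (F k) p + T (D U (F i)) (F j) (F k) p + T (F i) (D U (F j)) (F k) p + T (F i) (F j) (D U (F k)) p"
      by (simp add: B_eq)
    moreover have "U (B X (F i) (F j) (F k)) p = C U X (F i) (F j) (F k) p + B (D U X) (F i) (F j) (F k) p
      + B X (D U (F i)) (F j) (F k) p + B X (F i) (D U (F j)) (F k) p + B X (F i) (F j) (D U (F k)) p"
      by (simp add: C_def)
    ultimately show ?thesis
      using vf_mult[OF U T_smooth[OF v] B_smooth[OF X v]] by (simp add: c_def r1_def r2_def r3_def algebra_simps)
  qed
  then have "(\<Sum>i\<in>?I. \<Sum>j\<in>?I. \<Sum>k\<in>?I. U (?G i j k) p) = (\<Sum>i\<in>?I. \<Sum>j\<in>?I. \<Sum>k\<in>?I. c i j k)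
     + (\<Sum>i\<in>?I. \<Sum>j\<in>?I. \<Sum>k\<in>?I. T (F i) (F j) (F k) p * B (D U X) (F i) (F j) (F k) p)
     + (\<Sum>i\<in>?I. \<Sum>j\<in>?I. \<Sum>k\<in>?I. r1 i j k) + (\<Sum>i\<in>?I. \<Sum>j\<in>?I. \<Sum>k\<in>?I. r2 i j k) + (\<Sum>i\<in>?I. \<Sum>j\<in>?I. \<Sum>k\<in>?I. r3 i j k)"
    by (simp add: sum.distrib)
  moreover have "(\<Sum>i\<in>?I. \<Sum>j\<in>?I. \<Sum>k\<in>?I. r1 i j k) = 0"
  proof -
    have "(\<Sum>i\<in>?I. r1 i j k) = 0" if "j \<in> ?I" "k \<in> ?I" for j k
      unfolding r1_def
      by (rule frame_rotation[OF F p U, where h = "\<lambda>a b. T a (F j) (F k) p * B X b (F j) (F k) p"])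
        (use Fvf[OF that(1)] Fvf[OF that(2)] X in \<open>auto intro!: covector_at_cmult covector_at_multc T_covector B_covector2\<close>)
    moreover have "(\<Sum>i\<in>?I. \<Sum>j\<in>?I. \<Sum>k\<in>?I. r1 i j k) = (\<Sum>j\<in>?I. \<Sum>k\<in>?I. \<Sum>i\<in>?I. r1 i j k)"
      by (subst sum.swap, rule sum.cong[OF refl], rule sum.swap)
    ultimately show ?thesis by simp
  qed
  moreover have "(\<Sum>i\<in>?I. \<Sum>j\<in>?I. \<Sum>k\<in>?I. r2 i j k) = 0"
  proof -
    have "(\<Sum>j\<in>?I. r2 i j k) = 0" if "i \<in> ?I" "k \<in> ?I" for i k
      unfolding r2_def
      by (rule frame_rotation[OF F p U, where h = "\<lambda>a b. T (F i) a (F k) p * B X (F i) b (F k) p"])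
        (use Fvf[OF that(1)] Fvf[OF that(2)] X in \<open>auto intro!: covector_at_cmult covector_at_multc T_covector B_covector3\<close>)
    moreover have "(\<Sum>i\<in>?I. \<Sum>j\<in>?I. \<Sum>k\<in>?I. r2 i j k) = (\<Sum>i\<in>?I. \<Sum>k\<in>?I. \<Sum>j\<in>?I. r2 i j k)"
      by (rule sum.cong[OF refl], rule sum.swap)
    ultimately show ?thesis by simp
  qed
  moreover have "(\<Sum>i\<in>?I. \<Sum>j\<in>?I. \<Sum>k\<in>?I. r3 i j k) = 0"
  proof -
    have "(\<Sum>k\<in>?I. r3 i j k) = 0" if "i \<in> ?I" "j \<in> ?I" for i j
      unfolding r3_def
      by (rule frame_rotation[OF F p U, where h = "\<lambda>a b. T (F i) (F j) a p * B X (F i) (F j) b p"])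
        (use Fvf[OF that(1)] Fvf[OF that(2)] X in \<open>auto intro!: covector_at_cmult covector_at_multc T_covector B_covector4\<close>)
    then show ?thesis by simp
  qed
  ultimately show ?thesis
    using 0 torsion_orthogonal[OF F p D_vf[OF U X]] by (simp add: c_def)
qed

lemma instanton_imp_parallel_torsion: "parallel A D 3 (torsion g D)"
proof -
  have B0: "B X Y Z V p = 0" if v: "X \<in> vf" "Y \<in> vf" "Z \<in> vf" "V \<in> vf" for X Y Z V p
  proof -
    obtain W F where F: "p \<in> W" "unitary_frame W F"
      by (rule unitary_frame_exists[of p]) (rule that; assumption)
    interpret pt: second_order_point J' F "T' p" "B' p" "R' p" "C' p" by (rule second_order_point_at[OF F(2,1)])
    note on = unitary_frameD(1)[OF F(2,1)]
    have Fvf: "F i \<in> vf" if "i \<in> {1..6}" for i using unitary_frameD(3)[OF F(2,1) that] .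
    have 0: "B (F a) (F i) (F j) (F k) p = 0" if "a \<in> {1..6}" "i \<in> {1..6}" "j \<in> {1..6}" "k \<in> {1..6}" for a i j k
    proof -
      have "B' p (F a) (F i) (F j) (F k) = 0"
        by (rule pt.B_vanishes[OF _ that])
          (use torsion_orthogonal_derivative[OF F(2,1) pr_vf pr_vf] Fvf in simp)
      then show ?thesis using Fvf that by simp
    qed
    have 1: "B X (F i) (F j) (F k) p = 0" if "i \<in> {1..6}" "j \<in> {1..6}" "k \<in> {1..6}" for i j k
      by (rule covector_vanishes[OF B_covector1 on v(1)]) (use 0 Fvf that in auto)
    have 2: "B X Y (F j) (F k) p = 0" if "j \<in> {1..6}" "k \<in> {1..6}" for j k
      by (rule covector_vanishes[OF B_covector2 on v(2)]) (use 1 Fvf that v in auto)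
    have 3: "B X Y Z (F k) p = 0" if "k \<in> {1..6}" for k
      by (rule covector_vanishes[OF B_covector3 on v(3)]) (use 2 Fvf that v in auto)
    show ?thesis
      by (rule covector_vanishes[OF B_covector4 on v(4)]) (use 3 v in auto)
  qed
  show ?thesis
    unfolding parallel_def
  proof (intro ballI allI impI)
    fix X and ws :: "'a vfield list" assume X: "X \<in> vf" and ws: "length ws = 3" "set ws \<subseteq> vf"
    then obtain Y Z V where "ws = [Y, Z, V]" by (auto simp: length_Suc_conv numeral_3_eq_3)
    then show "cov_deriv D X (torsion g D) ws = 0" using B0[OF X] ws(2) by (auto simp: fun_eq_iff)
  qed
qed

end

end

theorem theorem1p1:
  fixes A :: "('a::{t2_space, second_countable_topology}) chart set"
    and g :: "('a, real) ctensor"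
    and J :: "'a vfield \<Rightarrow> 'a vfield"
    and \<Psi> :: "('a, complex) ctensor"
    and D :: "'a connection"
  assumes "ACYT A g J \<Psi>"
    and "torsion_connection A g J \<Psi> D"
    and "nijenhuis_constant_norm A g J"
    and "parallel A D 1 (lee_form A g J)"
  shows "su3_instanton A g J D \<longleftrightarrow> parallel A D 3 (torsion g D)"
proof -
  interpret acyt A g J \<Psi> D
    using assms(1,2) by unfold_locales (auto simp: ACYT_def)
  show ?thesis
    using parallel_torsion_imp_instanton instanton_imp_parallel_torsion assms(4) by blast
qed

end
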